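(* Let $H$ be a quaternion algebra over $\mathbb{Q}$ with orthogonal involution $\ddagger$. Let $\mathcal{O}$ be a maximal $\ddagger$-order of $H$. Then $SL^\ddagger(2,\mathcal{O})$ is a maximal arithmetic subgroup of $SL^\ddagger(2,H)$.
   Context: An orthogonal involution $\ddagger$ on $H$ is a $\mathbb{Q}$-linear map $x\mapsto x^\ddagger$ with $(xy)^\ddagger = y^\ddagger x^\ddagger$ and $(x^\ddagger)^\ddagger = x$, different from the standard involution (quaternion conjugation). Set $H^+ = \{x \in H : x^\ddagger = x\}$. Define $$SL^\ddagger(2,H) = \left\{\begin{pmatrix} a & b \\ c & d \end{pmatrix} \in \mathrm{Mat}(2,H) : ab^\ddagger \in H^+,\ cd^\ddagger \in H^+,\ ad^\ddagger - bc^\ddagger = 1\right\},$$ a group under matrix multiplication and (the rational points of) a linear algebraic group over $\mathbb{Q}$. A $\ddagger$-order of $H$ is an order of $H$ (a subring with $1$, finitely generated as a $\mathbb{Z}$-module, spanning $H$ over $\mathbb{Q}$) that is closed under $\ddagger$; a maximal $\ddagger$-order is a $\ddagger$-order not contained in any strictly larger $\ddagger$-order. Set $SL^\ddagger(2,\mathcal{O}) = SL^\ddagger(2,H)\cap \mathrm{Mat}(2,\mathcal{O})$. An arithmetic subgroup of $SL^\ddagger(2,H)$ is a subgroup of $SL^\ddagger(2,H)$ that is arithmetic in the usual sense for the $\mathbb{Q}$-group, i.e. commensurable with the integral points with respect to a faithful rational representation. It is maximal arithmetic if it is not strictly contained in any other arithmetic subgroup of $SL^\ddagger(2,H)$. 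*)

theory Defs
  imports "HOL-Algebra.Coset" "Jordan_Normal_Form.Determinant"
begin

section \<open>Quaternion algebras over the rationals and orthogonal involutions\<close>

text \<open>The ring is the whole type; \<open>scale\<close> is its rational algebra structure. A quaternion algebra
  has a basis \<open>1, i, j, ij\<close> with \<open>i\<^sup>2 = a\<close>, \<open>j\<^sup>2 = b\<close>, \<open>ji = -ij\<close> for nonzero rationals
  \<open>a\<close>, \<open>b\<close>; the split algebra of 2 by 2 rational matrices is included.\<close>

locale quaternion_algebra = vector_space scale
  for scale :: "rat \<Rightarrow> 'h::ring_1 \<Rightarrow> 'h" +
  fixes a b :: rat and i j :: 'h
  assumes scale_mult_left: "scale r x * y = scale r (x * y)"
    and scale_mult_right: "x * scale r y = scale r (x * y)"
    and a_nonzero: "a \<noteq> 0" and b_nonzero: "b \<noteq> 0"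
    and i_square: "i * i = scale a 1"
    and j_square: "j * j = scale b 1"
    and anticommute: "j * i = - (i * j)"
    and basis_distinct: "card {1, i, j, i * j} = 4"
    and basis_independent: "independent {1, i, j, i * j}"
    and basis_span: "span {1, i, j, i * j} = UNIV"
begin

text \<open>Quaternion conjugation, the standard involution. It does not depend on the choice of
  \<open>i\<close> and \<open>j\<close>.\<close>

definition conjugate :: "'h \<Rightarrow> 'h" where
  "conjugate x = (let r = representation {1, i, j, i * j} x in
     scale (r 1) 1 - scale (r i) i - scale (r j) j - scale (r (i * j)) (i * j))"

end

locale orthogonal_involution = quaternion_algebra scale a b i j
  for scale :: "rat \<Rightarrow> 'h::ring_1 \<Rightarrow> 'h" and a b i j +
  fixes dd :: "'h \<Rightarrow> 'h"
  assumes dd_linear: "Vector_Spaces.linear scale scale dd"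
    and dd_mult: "dd (x * y) = dd y * dd x"
    and dd_dd: "dd (dd x) = x"
    and dd_not_standard: "dd \<noteq> conjugate"

definition H_plus :: "('h \<Rightarrow> 'h) \<Rightarrow> 'h set" where
  "H_plus dd = {x. dd x = x}"


section \<open>Orders\<close>

definition is_order :: "(rat \<Rightarrow> 'h::ring_1 \<Rightarrow> 'h) \<Rightarrow> 'h set \<Rightarrow> bool" where
  "is_order scale R \<longleftrightarrow>
     1 \<in> R \<and> (\<forall>x\<in>R. \<forall>y\<in>R. x - y \<in> R \<and> x * y \<in> R) \<and>
     (\<exists>B. finite B \<and> R = range (\<lambda>c :: 'h \<Rightarrow> int. \<Sum>x\<in>B. of_int (c x) * x)) \<and>
     module.span scale R = UNIV"

definition is_dd_order :: "(rat \<Rightarrow> 'h::ring_1 \<Rightarrow> 'h) \<Rightarrow> ('h \<Rightarrow> 'h) \<Rightarrow> 'h set \<Rightarrow> bool" where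
  "is_dd_order scale dd R \<longleftrightarrow> is_order scale R \<and> dd ` R \<subseteq> R"

definition is_maximal_dd_order ::
    "(rat \<Rightarrow> 'h::ring_1 \<Rightarrow> 'h) \<Rightarrow> ('h \<Rightarrow> 'h) \<Rightarrow> 'h set \<Rightarrow> bool" where
  "is_maximal_dd_order scale dd R \<longleftrightarrow>
     is_dd_order scale dd R \<and> (\<forall>R'. is_dd_order scale dd R' \<and> R \<subseteq> R' \<longrightarrow> R' = R)"


section \<open>The group of 2 by 2 matrices\<close>

definition SL_dd :: "('h::ring_1 \<Rightarrow> 'h) \<Rightarrow> 'h mat monoid" where
  "SL_dd dd = \<lparr>carrier = {M \<in> carrier_mat 2 2.
        M $$ (0,0) * dd (M $$ (0,1)) \<in> H_plus dd \<and>
        M $$ (1,0) * dd (M $$ (1,1)) \<in> H_plus dd \<and>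
        M $$ (0,0) * dd (M $$ (1,1)) - M $$ (0,1) * dd (M $$ (1,0)) = 1},
     monoid.mult = (*), one = 1\<^sub>m 2\<rparr>"

definition SL_dd_over :: "('h::ring_1 \<Rightarrow> 'h) \<Rightarrow> 'h set \<Rightarrow> 'h mat set" where
  "SL_dd_over dd R = {M \<in> carrier (SL_dd dd). elements_mat M \<subseteq> R}"


section \<open>Arithmetic subgroups\<close>

definition finite_index :: "('g, 'm) monoid_scheme \<Rightarrow> 'g set \<Rightarrow> 'g set \<Rightarrow> bool" where
  "finite_index G K A \<longleftrightarrow> K \<subseteq> A \<and> finite ((\<lambda>x. K #>\<^bsub>G\<^esub> x) ` A)"

definition commensurable :: "('g, 'm) monoid_scheme \<Rightarrow> 'g set \<Rightarrow> 'g set \<Rightarrow> bool" where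
  "commensurable G A B \<longleftrightarrow> finite_index G (A \<inter> B) A \<and> finite_index G (A \<inter> B) B"

definition GL :: "'r::comm_ring_1 itself \<Rightarrow> nat \<Rightarrow> 'r mat monoid" where
  "GL ty n = units_of (ring_mat ty n ())"

definition GL_integral :: "nat \<Rightarrow> rat mat set" where
  "GL_integral n = map_mat rat_of_int ` carrier (GL TYPE(int) n)"

text \<open>The rational algebra of functions generated by a set of coordinate functions, that is,
  the polynomial functions with rational coefficients in these coordinates.\<close>

inductive_set poly_functions :: "('x \<Rightarrow> rat) set \<Rightarrow> ('x \<Rightarrow> rat) set"
  for C :: "('x \<Rightarrow> rat) set" where
  const: "(\<lambda>_. c) \<in> poly_functions C"
| coord: "f \<in> C \<Longrightarrow> f \<in> poly_functions C"
| add: "f \<in> poly_functions C \<Longrightarrow> g \<in> poly_functions C \<Longrightarrow> (\<lambda>x. f x + g x) \<in> poly_functions C"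
| mult: "f \<in> poly_functions C \<Longrightarrow> g \<in> poly_functions C \<Longrightarrow> (\<lambda>x. f x * g x) \<in> poly_functions C"

text \<open>Coordinates on the 16-dimensional rational vector space of 2 by 2 matrices over the
  quaternion algebra: a rational linear form applied to a matrix entry.\<close>

definition mat2_coords :: "(rat \<Rightarrow> 'h::ring_1 \<Rightarrow> 'h) \<Rightarrow> ('h mat \<Rightarrow> rat) set" where
  "mat2_coords scale = {(\<lambda>M. \<phi> (M $$ (k, l))) | \<phi> k l.
     Vector_Spaces.linear scale (*) \<phi> \<and> k < 2 \<and> l < 2}"

text \<open>Generators of the coordinate ring of the algebraic group \<open>GL\<^sub>n\<close> over the rationals.\<close>

definition GL_coords :: "nat \<Rightarrow> (rat mat \<Rightarrow> rat) set" where
  "GL_coords n = {(\<lambda>A. A $$ (k, l)) | k l. k < n \<and> l < n} \<union> {\<lambda>A. 1 / det A}"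

text \<open>A faithful rational representation is a homomorphism of algebraic groups to \<open>GL\<^sub>n\<close>, defined
  over the rationals, that is an isomorphism onto a closed subgroup: the entries are regular
  functions, and conversely every coordinate on the group is a regular function of the image.
  Injectivity on rational points would not be enough. The group is a form of \<open>Sp\<^sub>4\<close>, hence
  connected, so its rational points are Zariski dense and it suffices to compare regular functions
  on rational points.\<close>

definition faithful_rational_rep ::
    "(rat \<Rightarrow> 'h::ring_1 \<Rightarrow> 'h) \<Rightarrow> ('h \<Rightarrow> 'h) \<Rightarrow> nat \<Rightarrow> ('h mat \<Rightarrow> rat mat) \<Rightarrow> bool" where
  "faithful_rational_rep scale dd n \<rho> \<longleftrightarrow>
     \<rho> \<in> hom (SL_dd dd) (GL TYPE(rat) n) \<and>
     (\<forall>k<n. \<forall>l<n. \<exists>p \<in> poly_functions (mat2_coords scale).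
        \<forall>M \<in> carrier (SL_dd dd). \<rho> M $$ (k, l) = p M) \<and>
     (\<forall>c \<in> mat2_coords scale. \<exists>p \<in> poly_functions (GL_coords n).
        \<forall>M \<in> carrier (SL_dd dd). c M = p (\<rho> M))"

definition arithmetic_subgroup ::
    "(rat \<Rightarrow> 'h::ring_1 \<Rightarrow> 'h) \<Rightarrow> ('h \<Rightarrow> 'h) \<Rightarrow> 'h mat set \<Rightarrow> bool" where
  "arithmetic_subgroup scale dd \<Gamma> \<longleftrightarrow>
     subgroup \<Gamma> (SL_dd dd) \<and>
     (\<exists>n \<rho>. faithful_rational_rep scale dd n \<rho> \<and>
        commensurable (SL_dd dd) \<Gamma> {M \<in> carrier (SL_dd dd). \<rho> M \<in> GL_integral n})"

definition maximal_arithmetic_subgroup ::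
    "(rat \<Rightarrow> 'h::ring_1 \<Rightarrow> 'h) \<Rightarrow> ('h \<Rightarrow> 'h) \<Rightarrow> 'h mat set \<Rightarrow> bool" where
  "maximal_arithmetic_subgroup scale dd \<Gamma> \<longleftrightarrow>
     arithmetic_subgroup scale dd \<Gamma> \<and>
     \<not> (\<exists>\<Delta>. arithmetic_subgroup scale dd \<Delta> \<and> \<Gamma> \<subset> \<Delta>)"

end

theory Submission
  imports Defs "HOL-Computational_Algebra.Primes"
begin

text \<open>
  The group in question is arithmetic because it is the stabiliser of a lattice: with respect to a
  \<open>\<int>\<close>-basis of the rank 8 lattice of column vectors over the order, the action of 2 by 2 matrices
  is a faithful rational representation, and a matrix of the group goes to an integral matrix exactly
  when its entries lie in the order (\<open>rep_faithful\<close>, \<open>rep_GL_integral_iff\<close>).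

  For maximality let \<open>\<Delta>\<close> be an arithmetic group that contains \<open>SL\<^sup>\<ddagger>(2,R)\<close>, where \<open>R\<close> is the maximal
  \<open>\<ddagger>\<close>-order. A regular function on the group is a polynomial in the entries of any faithful
  representation and in the inverse of the determinant, so its values on integral points have a common
  denominator, and the finite index property extends this to \<open>\<Delta>\<close>
  (\<open>arithmetic_subgroup_denominator\<close>). Since \<open>\<Delta>\<close> contains \<open>SL(2,\<int>)\<close>, whose integral span contains all
  matrix units, the additive group \<open>T\<close> generated by the entries of elements of \<open>\<Delta>\<close> is a ring; it is
  closed under \<open>\<ddagger>\<close> because inverses in the group are given by \<open>\<ddagger>\<close>, and the unipotent matrices
  show that it contains all \<open>\<ddagger>\<close>-symmetric elements of \<open>R\<close> (\<open>entry_ring\<close>). So everything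
  reduces to a statement about orders (\<open>maximal_dd_order_contains\<close>): a \<open>\<ddagger>\<close>-stable ring \<open>T\<close> with
  bounded denominators that contains the symmetric part of \<open>R\<close> is contained in \<open>R\<close>. The difficulty is
  that the symmetric elements need not generate \<open>R\<close>, so that \<open>T\<close> is not known to contain \<open>R\<close>.

  That statement rests on an explicit form of \<open>\<ddagger>\<close>-orders (\<open>dd_order_multiplication_table\<close>): each has
  a basis \<open>1, \<alpha>, \<beta>, \<gamma>\<close> with \<open>\<alpha>, \<beta>\<close> symmetric and \<open>\<alpha>\<beta> = n\<gamma>\<close>, and then integers \<open>u, v, A, B, C\<close>
  exist with
  \<open>\<alpha>\<^sup>2 = nu\<alpha> - nA\<close>, \<open>\<beta>\<^sup>2 = nv\<beta> - nC\<close>, \<open>\<gamma>\<^sup>\<ddagger> = v\<alpha> + u\<beta> - B - \<gamma>\<close>. Conversely such relations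
  between independent elements give a \<open>\<ddagger>\<close>-order. The symmetric elements generate a subring of
  index \<open>\<bar>n\<bar>\<close>. Let \<open>x\<close> be in \<open>T\<close> with \<open>px\<close> in \<open>R\<close>, \<open>p\<close> a prime.

  If \<open>p\<close> does not divide \<open>n\<close>, then \<open>R\<close> lies in \<open>T\<close> locally at \<open>p\<close>, and the ring that equals \<open>T\<close> at \<open>p\<close>
  and \<open>R\<close> at the other primes is a \<open>\<ddagger>\<close>-order that contains \<open>R\<close> and \<open>x\<close>; hence \<open>x\<close> is in \<open>R\<close>
  (\<open>maximal_away_from_index\<close>).

  If \<open>p\<close> divides \<open>n\<close>, then maximality forces \<open>p\<close> to divide \<open>n\<close> only once and the binary form
  \<open>A s\<^sup>2 + B s t + C t\<^sup>2\<close> to be anisotropic modulo \<open>p\<close>: otherwise \<open>\<alpha>/p\<close> or a similar element can be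
  adjoined, as the multiplication table shows (\<open>maximal_square_not_dvd\<close>, \<open>maximal_form_anisotropic\<close>).
  Then \<open>R\<close> is at \<open>p\<close> the maximal order of a division algebra and consists of all elements of
  integral norm. Concretely, the reduced norm on \<open>R\<close> is a quaternary form that is divisible by \<open>p\<^sup>2\<close> only on
  \<open>pR\<close> (\<open>anisotropic_norm_form_mod_prime\<close>); since \<open>x\<close> has integral norm, this applies to \<open>px\<close>
  (\<open>maximal_at_index_prime\<close>).
\<close>

section \<open>Coordinates, trace and norm in a quaternion algebra\<close>

context quaternion_algebra
begin

definition quat :: "rat \<Rightarrow> rat \<Rightarrow> rat \<Rightarrow> rat \<Rightarrow> 'h" where
  "quat w x y z = scale w 1 + scale x i + scale y j + scale z (i * j)"

lemma scale_of_int: "scale (of_int m) x = of_int m * x"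
proof -
  have nat: "scale (of_nat n) x = of_nat n * x" for n
    by (induction n) (auto simp: scale_left_distrib algebra_simps)
  show ?thesis
  proof (cases m)
    case (nonneg n)
    with nat show ?thesis by simp
  next
    case (neg n)
    have "scale (of_int m) x = - scale (of_nat (Suc n)) x"
      unfolding neg by (simp only: of_int_minus of_int_of_nat_eq scale_minus_left)
    also have "\<dots> = of_int m * x" unfolding nat neg by (simp only: of_int_minus of_int_of_nat_eq) (simp add: algebra_simps)
    finally show ?thesis .
  qed
qed

lemma quat_add: "quat w x y z + quat w' x' y' z' = quat (w + w') (x + x') (y + y') (z + z')"
  by (simp add: quat_def scale_left_distrib algebra_simps)

lemma quat_scale: "scale q (quat w x y z) = quat (q * w) (q * x) (q * y) (q * z)"
  by (simp add: quat_def scale_right_distrib)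

lemma quat_uminus: "- quat w x y z = quat (- w) (- x) (- y) (- z)"
  by (simp add: quat_def scale_minus_left algebra_simps)

lemma quat_diff: "quat w x y z - quat w' x' y' z' = quat (w - w') (x - x') (y - y') (z - z')"
  by (simp add: quat_def scale_left_diff_distrib algebra_simps)

lemma basis_products:
  "i * (i * j) = scale a j" "(i * j) * i = - scale a j" "(i * j) * j = scale b i"
  "j * (i * j) = - scale b i" "(i * j) * (i * j) = - scale (a * b) 1"
proof -
  show 1: "i * (i * j) = scale a j"
    by (simp add: mult.assoc[symmetric] i_square scale_mult_left)
  show 2: "(i * j) * i = - scale a j"
    using 1 by (simp add: mult.assoc anticommute)
  show 3: "(i * j) * j = scale b i"
    by (simp add: mult.assoc j_square scale_mult_right)
  show 4: "j * (i * j) = - scale b i"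
    using 3 by (simp add: mult.assoc[symmetric] anticommute)
  have "(i * j) * (i * j) = ((i * j) * i) * j" by (simp add: mult.assoc)
  also have "\<dots> = - scale (a * b) 1" unfolding 2 by (simp add: scale_mult_left j_square)
  finally show "(i * j) * (i * j) = - scale (a * b) 1" .
qed

lemma quat_mult: "quat w x y z * quat w' x' y' z' =
  quat (w * w' + a * x * x' + b * y * y' - a * b * z * z') (w * x' + x * w' - b * y * z' + b * z * y')
    (w * y' + y * w' + a * x * z' - a * z * x') (w * z' + z * w' + x * y' - y * x')"
  unfolding quat_def distrib_left distrib_right scale_mult_left scale_mult_right basis_products
    i_square j_square anticommute
  by (simp add: scale_mult_left scale_mult_right basis_products i_square j_square anticommute
      scale_left_distrib scale_left_diff_distrib algebra_simps)

lemma distinct_basis: "1 \<noteq> i" "1 \<noteq> j" "1 \<noteq> i * j" "i \<noteq> j" "i \<noteq> i * j" "j \<noteq> i * j"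
  using basis_distinct by (auto simp: card_insert_if split: if_splits)

definition c0 where "c0 h = representation {1, i, j, i * j} h 1"
definition c1 where "c1 h = representation {1, i, j, i * j} h i"
definition c2 where "c2 h = representation {1, i, j, i * j} h j"
definition c3 where "c3 h = representation {1, i, j, i * j} h (i * j)"

lemma quat_coords: "quat (c0 h) (c1 h) (c2 h) (c3 h) = h"
proof -
  have "(\<Sum>v\<in>{1, i, j, i * j}. scale (representation {1, i, j, i * j} h v) v) = h"
    by (rule sum_representation_eq) (use basis_independent basis_span in auto)
  then show ?thesis using distinct_basis
    by (simp add: quat_def c0_def c1_def c2_def c3_def add.assoc)
qed

lemma coords_quat [simp]:
  "c0 (quat w x y z) = w" "c1 (quat w x y z) = x" "c2 (quat w x y z) = y" "c3 (quat w x y z) = z"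
  unfolding c0_def c1_def c2_def c3_def quat_def
  using distinct_basis basis_independent
  by (simp_all add: representation_add representation_scale representation_basis basis_span)

lemma quat_eq_iff: "quat w x y z = quat w' x' y' z' \<longleftrightarrow> w = w' \<and> x = x' \<and> y = y' \<and> z = z'"
  by (metis coords_quat)

lemma quat_cases: obtains w x y z where "h = quat w x y z"
  using quat_coords by metis

lemma quat_special: "0 = quat 0 0 0 0" "1 = quat 1 0 0 0" "i = quat 0 1 0 0" "j = quat 0 0 1 0"
  "i * j = quat 0 0 0 1"
  by (simp_all add: quat_def)

lemma coords_add [simp]: "c0 (g + h) = c0 g + c0 h" "c1 (g + h) = c1 g + c1 h"
    "c2 (g + h) = c2 g + c2 h" "c3 (g + h) = c3 g + c3 h"
  and coords_diff [simp]: "c0 (g - h) = c0 g - c0 h" "c1 (g - h) = c1 g - c1 h"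
    "c2 (g - h) = c2 g - c2 h" "c3 (g - h) = c3 g - c3 h"
  by (cases g rule: quat_cases; cases h rule: quat_cases; simp add: quat_add quat_diff)+

lemma coords_uminus [simp]: "c0 (- h) = - c0 h" "c1 (- h) = - c1 h"
    "c2 (- h) = - c2 h" "c3 (- h) = - c3 h"
  and coords_scale [simp]: "c0 (scale q h) = q * c0 h" "c1 (scale q h) = q * c1 h"
    "c2 (scale q h) = q * c2 h" "c3 (scale q h) = q * c3 h"
  by (cases h rule: quat_cases; simp add: quat_uminus quat_scale)+

lemma coords_special [simp]:
  "c0 0 = 0" "c1 0 = 0" "c2 0 = 0" "c3 0 = 0" "c0 1 = 1" "c1 1 = 0" "c2 1 = 0" "c3 1 = 0"
  "c0 i = 0" "c1 i = 1" "c2 i = 0" "c3 i = 0" "c0 j = 0" "c1 j = 0" "c2 j = 1" "c3 j = 0"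
  by (subst quat_special, simp)+

lemma coords_eqI:
  assumes "c0 g = c0 h" "c1 g = c1 h" "c2 g = c2 h" "c3 g = c3 h"
  shows "g = h"
  by (metis assms quat_coords)

lemma scalar_iff: "h = scale q 1 \<longleftrightarrow> c0 h = q \<and> c1 h = 0 \<and> c2 h = 0 \<and> c3 h = 0"
  by (auto intro: coords_eqI)

lemma coords_mult:
  "c0 (g * h) = c0 g * c0 h + a * c1 g * c1 h + b * c2 g * c2 h - a * b * c3 g * c3 h"
  "c1 (g * h) = c0 g * c1 h + c1 g * c0 h - b * c2 g * c3 h + b * c3 g * c2 h"
  "c2 (g * h) = c0 g * c2 h + c2 g * c0 h + a * c1 g * c3 h - a * c3 g * c1 h"
  "c3 (g * h) = c0 g * c3 h + c3 g * c0 h + c1 g * c2 h - c2 g * c1 h"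
  by (cases g rule: quat_cases; cases h rule: quat_cases; simp add: quat_mult)+

definition tr :: "'h \<Rightarrow> rat" where "tr h = 2 * c0 h"
definition nrd :: "'h \<Rightarrow> rat" where
  "nrd h = (c0 h)\<^sup>2 - a * (c1 h)\<^sup>2 - b * (c2 h)\<^sup>2 + a * b * (c3 h)\<^sup>2"
definition polar :: "'h \<Rightarrow> 'h \<Rightarrow> rat" where
  "polar g h = nrd (g + h) - nrd g - nrd h"

lemma nrd_mult: "nrd (g * h) = nrd g * nrd h"
  unfolding nrd_def coords_mult by (simp add: power2_eq_square algebra_simps)

lemma nrd_one [simp]: "nrd 1 = 1"
  by (simp add: nrd_def)

lemma nrd_scale [simp]: "nrd (scale q h) = q\<^sup>2 * nrd h"
  by (simp add: nrd_def power2_eq_square algebra_simps)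

text \<open>The reduced characteristic polynomial. Together with its polarisation it expresses the products that
  occur later through traces and norms, and conversely reads off traces and norms from products.\<close>

lemma cayley_hamilton: "h * h = scale (tr h) h - scale (nrd h) 1"
  by (rule coords_eqI) (simp_all add: coords_mult tr_def nrd_def power2_eq_square algebra_simps)

lemma tr_eq_nrd: "tr h = nrd (1 + h) - 1 - nrd h"
  by (simp add: tr_def nrd_def power2_eq_square algebra_simps)

text \<open>The polarised Cayley-Hamilton identity. For symmetric \<open>g\<close> and \<open>h\<close> it computes
  \<open>gh + (gh)\<^sup>\<ddagger>\<close>.\<close>

lemma anticommutator: "g * h + h * g = scale (tr g) h + scale (tr h) g - scale (polar g h) 1"
  by (rule coords_eqI)
    (simp_all add: coords_mult tr_def polar_def nrd_def power2_eq_square algebra_simps)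

lemma polar_mult_right: "polar g (g * h) = nrd g * tr h"
  by (simp add: coords_mult tr_def polar_def nrd_def power2_eq_square algebra_simps)

lemma polar_mult_left: "polar h (g * h) = tr g * nrd h"
  by (simp add: coords_mult tr_def polar_def nrd_def power2_eq_square algebra_simps)

lemma polar_add_right: "polar g (h + k) = polar g h + polar g k"
  and polar_scale_right: "polar g (scale q h) = q * polar g h"
  and polar_commute: "polar g h = polar h g"
  by (simp_all add: polar_def nrd_def power2_eq_square algebra_simps)

lemma nrd_add: "nrd (g + h) = nrd g + nrd h + polar g h"
  by (simp add: polar_def)

lemma polar_one: "polar 1 h = tr h"
  by (simp add: polar_def tr_eq_nrd)

end

section \<open>Symmetric generators for an orthogonal involution\<close>

text \<open>The normal form of an orthogonal involution: the generators \<open>i\<close> and \<open>j\<close> are symmetric, so that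
  \<open>ij\<close> spans the skew elements and an element is symmetric exactly when its last coordinate vanishes.\<close>

locale symmetric_quaternion = quaternion_algebra scale a b i j
  for scale :: "rat \<Rightarrow> 'h::ring_1 \<Rightarrow> 'h" and a b i j +
  fixes dd :: "'h \<Rightarrow> 'h"
  assumes dd_linear: "Vector_Spaces.linear scale scale dd"
    and dd_mult: "dd (x * y) = dd y * dd x"
    and dd_dd [simp]: "dd (dd x) = x"
    and dd_i [simp]: "dd i = i" and dd_j [simp]: "dd j = j"

lemma (in quaternion_algebra) pure_square: "c0 x = 0 \<Longrightarrow> x * x = scale (- nrd x) 1"
  by (subst cayley_hamilton) (simp add: tr_def)

lemma (in quaternion_algebra) square_scalar_imp:
  assumes "x * x = scale q 1"
  shows "c0 x = 0 \<or> x = scale (c0 x) 1"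
proof -
  have "scale (tr x) x = scale (q + nrd x) 1"
    using assms cayley_hamilton[of x] by (simp add: scale_left_distrib algebra_simps)
  then have "tr x * c1 x = 0" "tr x * c2 x = 0" "tr x * c3 x = 0"
    by (metis coords_scale coords_special mult_zero_right)+
  then show ?thesis by (auto simp: tr_def scalar_iff)
qed

text \<open>The polar form is diagonal in the basis \<open>i, j, ij\<close> with nonzero entries.\<close>

lemma (in quaternion_algebra) pure_nondegenerate:
  assumes "c0 u = 0" and "\<And>v. c0 v = 0 \<Longrightarrow> polar u v = 0"
  shows "u = 0"
proof (rule coords_eqI)
  have k: "c0 (i * j) = 0" "c1 (i * j) = 0" "c2 (i * j) = 0" "c3 (i * j) = 1"
    by (simp_all add: coords_mult)
  have "polar u i = - 2 * a * c1 u" "polar u j = - 2 * b * c2 u" "polar u (i * j) = 2 * a * b * c3 u"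
    by (simp_all add: polar_def nrd_def k power2_eq_square algebra_simps)
  moreover have "polar u i = 0" "polar u j = 0" "polar u (i * j) = 0"
    by (rule assms(2), simp add: k)+
  ultimately show "c1 u = c1 0" "c2 u = c2 0" "c3 u = c3 0"
    using a_nonzero b_nonzero by auto
qed (simp add: assms(1))

context orthogonal_involution
begin

interpretation dd: Vector_Spaces.linear scale scale dd by (rule dd_linear)

lemma involution_one: "dd 1 = 1"
  using dd_mult[of "dd 1" 1] dd_dd[of 1] by simp

text \<open>The nonzero pure quaternions are the non-scalar elements with scalar square, a property
  that every linear anti-automorphism respects.\<close>

lemma dd_pure:
  assumes "c0 x = 0" shows "c0 (dd x) = 0"
proof -
  have "dd x * dd x = dd (x * x)" by (simp add: dd_mult)
  also have "\<dots> = scale (- nrd x) 1"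
    unfolding pure_square[OF assms] by (simp only: dd.scale involution_one)
  finally have "c0 (dd x) = 0 \<or> dd x = scale (c0 (dd x)) 1" by (rule square_scalar_imp)
  then show ?thesis
  proof
    assume "dd x = scale (c0 (dd x)) 1"
    then have "x = scale (c0 (dd x)) 1" by (metis dd.scale involution_one dd_dd)
    then show ?thesis using assms by (metis coords_scale(1) coords_special(5) mult.right_neutral)
  qed
qed

text \<open>For pure elements the polar form is the anticommutator up to sign; it is a scalar, hence fixed
  by the involution, while the signs of \<open>u\<close> and \<open>w\<close> say that the involution negates it.\<close>

lemma pure_eigenspaces_orthogonal:
  assumes "c0 u = 0" "c0 w = 0" "dd u = scale e u" "dd w = scale (- e) w" "e * e = 1"
  shows "polar u w = 0"
proof -
  have 1: "u * w + w * u = scale (- polar u w) 1"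
    using anticommutator[of u w] assms(1,2) by (simp add: tr_def)
  have "dd (u * w + w * u) = - (u * w + w * u)"
    unfolding dd.add dd_mult assms(3,4)
    using assms(5) by (simp add: scale_mult_left scale_mult_right algebra_simps)
  then show ?thesis unfolding 1 dd.scale involution_one
    by (metis coords_scale(1) coords_special(5) coords_uminus(1) equal_neg_zero mult.right_neutral
        neg_equal_0_iff_equal)
qed

text \<open>The pure quaternions are the orthogonal sum of the two eigenspaces of the involution. If the norm
  vanishes on one of them, that eigenspace is orthogonal to everything, hence zero. This produces
  elements of nonzero norm in both eigenspaces without a discussion of dimensions.\<close>

lemma pure_eigenspace_trivial:
  assumes iso: "\<And>x. c0 x = 0 \<Longrightarrow> dd x = scale e x \<Longrightarrow> nrd x = 0"
    and e: "e * e = 1" and u: "c0 u = 0" "dd u = scale e u"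
  shows "u = 0"
proof (rule pure_nondegenerate[OF u(1)])
  fix v assume v: "c0 v = 0"
  define p where "p = scale (1/2) (v + scale e (dd v))"
  define q where "q = scale (1/2) (v - scale e (dd v))"
  have v_eq: "v = p + q"
    by (rule coords_eqI) (simp_all add: p_def q_def algebra_simps)
  have pq: "c0 p = 0" "c0 q = 0" using v dd_pure[OF v] by (simp_all add: p_def q_def)
  have p: "dd p = scale e p" and q: "dd q = scale (- e) q"
    unfolding p_def q_def dd.scale dd.add dd.diff dd_dd
    using e by (simp_all add: scale_right_distrib scale_right_diff_distrib algebra_simps)
  have "nrd (u + p) = 0" "nrd u = 0" "nrd p = 0"
    by (rule iso; simp add: u p pq dd.add scale_right_distrib)+
  then have "polar u p = 0" by (simp add: polar_def)
  moreover have "polar u q = 0"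
    by (rule pure_eigenspaces_orthogonal[OF u(1) pq(2) u(2) q e])
  ultimately show "polar u v = 0" by (simp add: v_eq polar_add_right)
qed

lemma conjugate_eq: "conjugate x = scale (2 * c0 x) 1 - x"
proof (rule coords_eqI)
  have "c0 (i * j) = 0" "c1 (i * j) = 0" "c2 (i * j) = 0" "c3 (i * j) = 1"
    by (simp_all add: coords_mult)
  then show "c0 (conjugate x) = c0 (scale (2 * c0 x) 1 - x)"
    "c1 (conjugate x) = c1 (scale (2 * c0 x) 1 - x)"
    "c2 (conjugate x) = c2 (scale (2 * c0 x) 1 - x)"
    "c3 (conjugate x) = c3 (scale (2 * c0 x) 1 - x)"
    by (simp_all add: conjugate_def Let_def c0_def[symmetric] c1_def[symmetric] c2_def[symmetric]
      c3_def[symmetric])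
qed

text \<open>Without such an element all pure quaternions would be skew, and the involution would be
  conjugation. This is where the involution is required not to be the standard one.\<close>

lemma ex_symmetric_pure: obtains u where "c0 u = 0" "dd u = u" "nrd u \<noteq> 0"
proof -
  have "\<exists>u. c0 u = 0 \<and> dd u = u \<and> nrd u \<noteq> 0"
  proof (rule ccontr)
    assume "\<not> ?thesis"
    then have triv: "u = 0" if "c0 u = 0" "dd u = u" for u
      using pure_eigenspace_trivial[of 1 u] that by auto
    have "dd x = conjugate x" for x
    proof -
      define v where "v = x - scale (c0 x) 1"
      have v: "c0 v = 0" by (simp add: v_def)
      have "v + dd v = 0"
        by (rule triv) (simp_all add: v dd_pure[OF v] dd.add dd_dd add.commute)
      then have "x - scale (c0 x) 1 + (dd x - scale (c0 x) 1) = 0"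
        by (simp add: v_def dd.diff dd.scale involution_one)
      then have "dd x = scale (c0 x) 1 + scale (c0 x) 1 - x"
        by (simp add: algebra_simps eq_neg_iff_add_eq_0)
      also have "\<dots> = conjugate x"
        unfolding conjugate_eq mult_2 scale_left_distrib ..
      finally show ?thesis .
    qed
    then show False using dd_not_standard by auto
  qed
  then show ?thesis using that by blast
qed

text \<open>Without such an element all pure quaternions would be symmetric, and \<open>i\<close> and \<open>j\<close> would commute.\<close>

lemma ex_skew_pure: obtains m where "c0 m = 0" "dd m = - m" "nrd m \<noteq> 0"
proof -
  have "\<exists>m. c0 m = 0 \<and> dd m = - m \<and> nrd m \<noteq> 0"
  proof (rule ccontr)
    assume "\<not> ?thesis"
    then have triv: "m = 0" if "c0 m = 0" "dd m = - m" for m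
      using pure_eigenspace_trivial[of "-1" m] that by auto
    have sym: "dd v = v" if v: "c0 v = 0" for v
      using triv[of "v - dd v"] by (simp add: v dd_pure[OF v] dd.diff dd_dd)
    have "c0 (i * j) = 0" by (simp add: coords_mult)
    then have "i * j = - (i * j)"
      using sym[of "i * j"] sym[of i] sym[of j] by (simp add: dd_mult anticommute)
    then have "c3 (i * j) = - c3 (i * j)" by (metis coords_uminus(4))
    then show False by (simp add: coords_mult)
  qed
  then show ?thesis using that by blast
qed

text \<open>A symmetric \<open>u\<close> and a skew \<open>m\<close> of nonzero norm anticommute, so \<open>mu\<close> is again symmetric and
  \<open>u, mu\<close> is a pair of generators of the required kind.\<close>

lemma ex_symmetric_generators: "\<exists>a' b' i' j'. symmetric_quaternion scale a' b' i' j' dd"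
proof -
  obtain u where u: "c0 u = 0" "dd u = u" "nrd u \<noteq> 0" by (rule ex_symmetric_pure)
  obtain m where m: "c0 m = 0" "dd m = - m" "nrd m \<noteq> 0" by (rule ex_skew_pure)
  define r where "r = - nrd u"
  define s where "s = - nrd m"
  have r: "u * u = scale r 1" "r \<noteq> 0" and s: "m * m = scale s 1" "s \<noteq> 0"
    using pure_square[OF u(1)] pure_square[OF m(1)] u m by (auto simp: r_def s_def)
  have "polar u m = 0"
    by (rule pure_eigenspaces_orthogonal[of u m 1]) (use u m in auto)
  then have "u * m + m * u = 0"
    using anticommutator[of u m] u(1) m(1) by (simp add: tr_def)
  then have um: "u * m = - (m * u)" by (simp add: eq_neg_iff_add_eq_0)
  have k: "u * (m * u) = - scale r m"
    by (simp add: mult.assoc[symmetric] um) (simp add: mult.assoc r scale_mult_right)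
  have ddmu: "dd (m * u) = m * u" by (simp add: dd_mult u m um)
  have c0mu: "c0 (m * u) = 0"
    using arg_cong[OF um, of c0] by (simp add: coords_mult u m algebra_simps)
  have jj: "m * u * (m * u) = scale (- (s * r)) 1"
    by (simp add: mult.assoc k) (simp add: scale_mult_right s mult.commute)
  have ji: "m * u * u = - (u * (m * u))"
    by (simp add: k mult.assoc r scale_mult_right)
  have indep: "q0 = 0 \<and> q1 = 0 \<and> q2 = 0 \<and> q3 = 0"
    if eq: "scale q0 1 + scale q1 u + scale q2 (m * u) + scale q3 (u * (m * u)) = 0" for q0 q1 q2 q3
  proof -
    have "dd (scale q0 1 + scale q1 u + scale q2 (m * u) + scale q3 (u * (m * u))) = 0"
      unfolding eq by (rule dd.zero)
    then have "scale q0 1 + scale q1 u + scale q2 (m * u) - scale q3 (u * (m * u)) = 0"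
      by (simp add: dd.add dd.diff dd.scale involution_one u m dd.neg k ddmu)
    with eq have "scale q3 (u * (m * u)) + scale q3 (u * (m * u)) = 0"
      by (metis add_diff_cancel_left' diff_diff_eq2 diff_zero)
    then have "scale (2 * q3) (u * (m * u)) = 0"
      by (simp only: mult_2 scale_left_distrib)
    moreover have "m \<noteq> 0" using m(3) by (auto simp: nrd_def)
    ultimately have q3: "q3 = 0" using r by (simp add: k)
    have q0: "q0 = 0" using arg_cong[OF eq, of c0] q3 by (simp add: u c0mu)
    have "(scale q1 1 + scale q2 m) * u = 0"
      using eq q0 q3 by (simp add: distrib_right scale_mult_left)
    then have "(scale q1 1 + scale q2 m) * u * u = 0" by simp
    then have "scale r (scale q1 1 + scale q2 m) = 0"
      by (simp add: mult.assoc r scale_mult_right)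
    then have z: "scale q1 1 + scale q2 m = 0" using r by simp
    have q1: "q1 = 0" using arg_cong[OF z, of c0] by (simp add: m)
    have "q2 = 0" using z q1 m(3) by (auto simp: nrd_def)
    with q0 q1 q3 show ?thesis by simp
  qed
  have neq: "1 \<noteq> u" "1 \<noteq> m * u" "1 \<noteq> u * (m * u)" "u \<noteq> m * u" "u \<noteq> u * (m * u)"
    "m * u \<noteq> u * (m * u)"
    using indep[of 1 "-1" 0 0] indep[of 1 0 "-1" 0] indep[of 1 0 0 "-1"] indep[of 0 1 "-1" 0]
      indep[of 0 1 0 "-1"] indep[of 0 0 1 "-1"] by auto
  have card: "card {1, u, m * u, u * (m * u)} = 4" using neq by simp
  have ind: "independent {1, u, m * u, u * (m * u)}"
  proof (rule independent_if_scalars_zero)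
    fix f x
    assume "(\<Sum>v\<in>{1, u, m * u, u * (m * u)}. scale (f v) v) = 0"
      and x: "x \<in> {1, u, m * u, u * (m * u)}"
    then have "scale (f 1) 1 + scale (f u) u + scale (f (m * u)) (m * u)
        + scale (f (u * (m * u))) (u * (m * u)) = 0"
      using neq by (simp add: add.assoc)
    from indep[OF this] x show "f x = 0" by auto
  qed simp
  interpret fd: finite_dimensional_vector_space scale "{1, i, j, i * j}"
    by unfold_locales (use basis_independent basis_span in auto)
  have "UNIV \<subseteq> span {1, u, m * u, u * (m * u)}"
    by (rule fd.card_ge_dim_independent) (use ind card fd.dim_UNIV basis_distinct in auto)
  then have "symmetric_quaternion scale r (- (s * r)) u (m * u) dd"
    by unfold_locales
      (use r s jj ji card ind scale_mult_left scale_mult_right dd_linear dd_mult dd_dd u ddmu in auto)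
  then show ?thesis by blast
qed

end

section \<open>Additive subgroups, integral spans and rational denominators\<close>

definition additive_subgroup :: "'g::ring_1 set \<Rightarrow> bool" where
  "additive_subgroup G \<longleftrightarrow> 0 \<in> G \<and> (\<forall>x\<in>G. \<forall>y\<in>G. x - y \<in> G)"

lemma additive_subgroup_zero: "additive_subgroup G \<Longrightarrow> 0 \<in> G"
  and additive_subgroup_diff: "additive_subgroup G \<Longrightarrow> x \<in> G \<Longrightarrow> y \<in> G \<Longrightarrow> x - y \<in> G"
  by (auto simp: additive_subgroup_def)

lemma additive_subgroup_uminus: "additive_subgroup G \<Longrightarrow> x \<in> G \<Longrightarrow> - x \<in> G"
  using additive_subgroup_diff[of G 0 x] additive_subgroup_zero by auto

lemma additive_subgroup_add: "additive_subgroup G \<Longrightarrow> x \<in> G \<Longrightarrow> y \<in> G \<Longrightarrow> x + y \<in> G"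
  using additive_subgroup_diff[of G x "- y"] additive_subgroup_uminus by auto

lemma additive_subgroup_of_int:
  assumes G: "additive_subgroup G" and x: "x \<in> G"
  shows "of_int m * x \<in> G"
proof (induction m rule: int_induct[where k = 0])
  case base
  show ?case using additive_subgroup_zero[OF G] by simp
next
  case (step1 m)
  then show ?case using additive_subgroup_add[OF G _ x] by (simp add: distrib_right)
next
  case (step2 m)
  then show ?case using additive_subgroup_diff[OF G _ x] by (simp add: left_diff_distrib)
qed

lemma additive_subgroup_sum:
  assumes "additive_subgroup G" "\<And>x. x \<in> B \<Longrightarrow> f x \<in> G"
  shows "sum f B \<in> G"
  using assms(2)
  by (induction B rule: infinite_finite_induct)
    (auto intro: additive_subgroup_zero additive_subgroup_add assms(1))

inductive_set zspan :: "'g::ring_1 set \<Rightarrow> 'g set" for X where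
  zero: "0 \<in> zspan X"
| gen: "x \<in> X \<Longrightarrow> x \<in> zspan X"
| diff: "x \<in> zspan X \<Longrightarrow> y \<in> zspan X \<Longrightarrow> x - y \<in> zspan X"

lemma additive_subgroup_zspan: "additive_subgroup (zspan X)"
  by (auto simp: additive_subgroup_def intro: zspan.intros)

lemma zspan_least:
  assumes "additive_subgroup G" "X \<subseteq> G" shows "zspan X \<subseteq> G"
proof
  fix x assume "x \<in> zspan X"
  then show "x \<in> G"
    by induction (use assms in \<open>auto simp: additive_subgroup_def\<close>)
qed

lemma zspan_mult_closed:
  assumes gens: "\<And>x y. x \<in> X \<Longrightarrow> y \<in> X \<Longrightarrow> x * y \<in> zspan X"
    and x: "x \<in> zspan X" and y: "y \<in> zspan X"
  shows "x * y \<in> zspan X"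
proof -
  have 1: "x * y \<in> zspan X" if "x \<in> X" "y \<in> zspan X" for x y
    using that(2,1) by induction (auto intro: gens zspan.intros simp: right_diff_distrib)
  show ?thesis using x
    by induction (auto intro: 1 y zspan.intros simp: left_diff_distrib)
qed

lemma zspan_finite:
  assumes "finite B"
  shows "zspan B = range (\<lambda>c. \<Sum>x\<in>B. of_int (c x) * x)" (is "_ = ?R")
proof
  have "additive_subgroup ?R"
  proof -
    have "0 \<in> ?R" by (rule image_eqI[of _ _ "\<lambda>_. 0"]) auto
    moreover have "x - y \<in> ?R" if xy: "x \<in> ?R" "y \<in> ?R" for x y
    proof -
      from xy obtain c d where "x = (\<Sum>x\<in>B. of_int (c x) * x)" "y = (\<Sum>x\<in>B. of_int (d x) * x)"
        by auto
      then have "x - y = (\<Sum>x\<in>B. of_int (c x - d x) * x)"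
        by (simp add: left_diff_distrib sum_subtractf)
      then show ?thesis by (intro image_eqI[of _ _ "\<lambda>x. c x - d x"]) auto
    qed
    ultimately show ?thesis by (auto simp: additive_subgroup_def)
  qed
  moreover have "B \<subseteq> ?R"
  proof
    fix x assume "x \<in> B"
    then have "x = (\<Sum>y\<in>B. of_int (if y = x then 1 else 0) * y)"
      using assms by (subst sum.remove[of B x]) auto
    then show "x \<in> ?R" by (intro image_eqI[of _ _ "\<lambda>y. if y = x then 1 else 0"]) auto
  qed
  ultimately show "zspan B \<subseteq> ?R" by (rule zspan_least)
  show "?R \<subseteq> zspan B"
    by (auto intro!: additive_subgroup_sum additive_subgroup_of_int additive_subgroup_zspan
        intro: zspan.gen)
qed

lemma zspan4_iff:
  "x \<in> zspan {g0, g1, g2, g3} \<longleftrightarrow>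
    (\<exists>m0 m1 m2 m3. x = of_int m0 * g0 + of_int m1 * g1 + of_int m2 * g2 + of_int m3 * g3)"
  (is "_ \<longleftrightarrow> ?P x")
proof
  assume "x \<in> zspan {g0, g1, g2, g3}"
  moreover have "zspan {g0, g1, g2, g3} \<subseteq> Collect ?P"
  proof (rule zspan_least)
    have "x - y \<in> Collect ?P" if xy: "x \<in> Collect ?P" "y \<in> Collect ?P" for x y
    proof -
      from xy obtain m0 m1 m2 m3 n0 n1 n2 n3
        where x: "x = of_int m0 * g0 + of_int m1 * g1 + of_int m2 * g2 + of_int m3 * g3"
        and y: "y = of_int n0 * g0 + of_int n1 * g1 + of_int n2 * g2 + of_int n3 * g3" by blast
      have "x - y = of_int (m0 - n0) * g0 + of_int (m1 - n1) * g1 + of_int (m2 - n2) * g2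
          + of_int (m3 - n3) * g3"
        by (simp add: x y left_diff_distrib)
      then show ?thesis by blast
    qed
    moreover have "0 \<in> Collect ?P" by (auto intro!: exI[of _ 0])
    ultimately show "additive_subgroup (Collect ?P)" by (auto simp: additive_subgroup_def)
    have "?P g0" by (intro exI[of _ 1] exI[of _ 0]) auto
    moreover have "?P g1" by (rule exI[of _ 0], rule exI[of _ 1], intro exI[of _ 0]) auto
    moreover have "?P g2" by (rule exI[of _ 0], rule exI[of _ 0], rule exI[of _ 1], intro exI[of _ 0]) auto
    moreover have "?P g3" by (rule exI[of _ 0], rule exI[of _ 0], rule exI[of _ 0], intro exI[of _ 1]) auto
    ultimately show "{g0, g1, g2, g3} \<subseteq> Collect ?P" by auto
  qed
  ultimately show "?P x" by auto
next
  assume "?P x"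
  then show "x \<in> zspan {g0, g1, g2, g3}"
    by (auto intro!: additive_subgroup_add additive_subgroup_of_int additive_subgroup_zspan
        intro: zspan.gen)
qed

lemma rat_denominator: obtains d :: int where "d > 0" "of_int d * (q :: rat) \<in> \<int>"
proof -
  obtain n d where nd: "quotient_of q = (n, d)" by force
  have "d > 0" using quotient_of_denom_pos[OF nd] .
  moreover have "of_int d * q = of_int n"
    using quotient_of_div[OF nd] \<open>d > 0\<close> by simp
  ultimately show ?thesis using that by auto
qed

text \<open>If \<open>d\<close> is the reduced denominator of \<open>x\<close>, then \<open>d\<^sup>k\<close> divides \<open>D\<close> for all \<open>k\<close>. This replaces integral
  closure: elements of a ring with bounded denominators have integral norm because the norms of
  their powers have bounded denominators.\<close>

lemma bounded_powers_imp_int: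
  fixes x :: rat
  assumes D: "(D::int) > 0" and pow: "\<And>k. of_int D * x ^ k \<in> \<int>"
  shows "x \<in> \<int>"
proof -
  obtain n d where nd: "quotient_of x = (n, d)" by force
  have d: "d > 0" and cop: "coprime n d" and x: "x = of_int n / of_int d"
    using quotient_of_denom_pos[OF nd] quotient_of_coprime[OF nd] quotient_of_div[OF nd] by auto
  have "d = 1"
  proof (rule ccontr)
    assume "d \<noteq> 1"
    with d have d2: "d \<ge> 2" by simp
    define k where "k = nat D"
    obtain m where "of_int D * x ^ k = of_int m" using pow[of k] by (auto elim: Ints_cases)
    then have "(of_int (D * n ^ k) :: rat) = of_int (m * d ^ k)"
      using d by (simp add: x field_simps)
    then have "D * n ^ k = m * d ^ k" by (simp only: of_int_eq_iff)
    then have "d ^ k dvd D * n ^ k" by simp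
    moreover have "coprime (d ^ k) (n ^ k)" using cop by (simp add: coprime_commute)
    ultimately have "d ^ k dvd D" using coprime_dvd_mult_left_iff by blast
    then have "d ^ k \<le> D" using D zdvd_imp_le by blast
    moreover have "2 ^ k \<le> d ^ k" using d2 by (intro power_mono) auto
    moreover have "int k < 2 ^ k" using of_nat_less_two_power[of k] by simp
    ultimately show False using D by (simp add: k_def)
  qed
  then show ?thesis by (simp add: x)
qed

text \<open>A generator is an element with the least positive numerator over the common denominator.\<close>

lemma rat_subgroup_cyclic:
  fixes G :: "rat set"
  assumes G: "additive_subgroup G" and D: "(D::int) > 0" and int: "\<And>x. x \<in> G \<Longrightarrow> of_int D * x \<in> \<int>"
  shows "\<exists>g\<in>G. \<forall>x\<in>G. \<exists>m::int. x = of_int m * g"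
proof (cases "G \<subseteq> {0}")
  case True
  then show ?thesis using additive_subgroup_zero[OF G] by (intro bexI[of _ 0]) auto
next
  case False
  let ?P = "\<lambda>n::nat. n > 0 \<and> (\<exists>x\<in>G. of_int D * x = of_nat n)"
  have ex: "\<exists>n. ?P n"
  proof -
    from False obtain x where x: "x \<in> G" "x \<noteq> 0" by auto
    obtain m where m: "of_int D * x = of_int m" using int[OF x(1)] by (auto elim: Ints_cases)
    have m0: "m \<noteq> 0"
    proof
      assume "m = 0"
      with m have "of_int D * x = 0" by simp
      with x D show False by simp
    qed
    have "\<exists>y\<in>G. of_int D * y = of_int \<bar>m\<bar>"
    proof (cases "m \<ge> 0")
      case True then show ?thesis using m x by (intro bexI[of _ x]) auto
    next
      case False then show ?thesis using m x additive_subgroup_uminus[OF G]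
        by (intro bexI[of _ "- x"]) auto
    qed
    then show ?thesis using m0 by (intro exI[of _ "nat \<bar>m\<bar>"]) auto
  qed
  define n where "n = (LEAST n. ?P n)"
  have n: "?P n" unfolding n_def using ex by (rule LeastI_ex)
  have least: "n \<le> m" if "?P m" for m unfolding n_def using that by (rule Least_le)
  from n obtain g where g: "g \<in> G" "of_int D * g = of_nat n" by auto
  have "\<exists>m::int. x = of_int m * g" if x: "x \<in> G" for x
  proof -
    obtain m where m: "of_int D * x = of_int m" using int[OF x] by (auto elim: Ints_cases)
    define q r where "q = m div int n" and "r = m mod int n"
    have r: "0 \<le> r" "r < int n" using n by (auto simp: r_def)
    have y: "x - of_int q * g \<in> G" by (intro additive_subgroup_diff additive_subgroup_of_int G x g)
    have "of_int D * (x - of_int q * g) = of_int D * x - of_int q * (of_int D * g)"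
      by (simp add: algebra_simps)
    also have "\<dots> = of_int (m - q * int n)" by (simp add: m g)
    also have "m - q * int n = r" by (simp add: q_def r_def minus_div_mult_eq_mod)
    finally have Dy: "of_int D * (x - of_int q * g) = of_int r" .
    have "r = 0"
    proof (rule ccontr)
      assume "r \<noteq> 0"
      then have "?P (nat r)" using y Dy r by auto
      then show False using least[of "nat r"] r by auto
    qed
    then have "x = of_int q * g" using Dy D by simp
    then show ?thesis by blast
  qed
  then show ?thesis using g by blast
qed

section \<open>Orders as full rings with bounded denominators\<close>

definition unital_subring :: "'g::ring_1 set \<Rightarrow> bool" where
  "unital_subring R \<longleftrightarrow> 1 \<in> R \<and> (\<forall>x\<in>R. \<forall>y\<in>R. x - y \<in> R \<and> x * y \<in> R)"

lemma unital_subring_additive: "unital_subring R \<Longrightarrow> additive_subgroup R"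
  unfolding unital_subring_def additive_subgroup_def by (metis diff_self)

context quaternion_algebra
begin

definition integral_coords :: "'h set" where
  "integral_coords = {x. c0 x \<in> \<int> \<and> c1 x \<in> \<int> \<and> c2 x \<in> \<int> \<and> c3 x \<in> \<int>}"

text \<open>Boundedness with respect to the fixed lattice \<open>integral_coords\<close>. For additive groups it is the same as
  being finitely generated, and it passes to subgroups by definition.\<close>

definition bounded_denominators :: "'h set \<Rightarrow> bool" where
  "bounded_denominators S \<longleftrightarrow> (\<exists>D::int. D > 0 \<and> (\<forall>x\<in>S. scale (of_int D) x \<in> integral_coords))"

definition full :: "'h set \<Rightarrow> bool" where
  "full R \<longleftrightarrow> (\<forall>h. \<exists>m::int. m > 0 \<and> scale (of_int m) h \<in> R)"

lemma additive_subgroup_scaled_integral: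
  "additive_subgroup {x. scale (of_int D) x \<in> integral_coords}"
  by (auto simp: additive_subgroup_def integral_coords_def right_diff_distrib)

lemma ex_integral_multiple: "\<exists>D::int. D > 0 \<and> scale (of_int D) x \<in> integral_coords"
proof -
  obtain d0 where d0: "d0 > 0" "of_int d0 * c0 x \<in> \<int>" by (rule rat_denominator)
  obtain d1 where d1: "d1 > 0" "of_int d1 * c1 x \<in> \<int>" by (rule rat_denominator)
  obtain d2 where d2: "d2 > 0" "of_int d2 * c2 x \<in> \<int>" by (rule rat_denominator)
  obtain d3 where d3: "d3 > 0" "of_int d3 * c3 x \<in> \<int>" by (rule rat_denominator)
  have "of_int (d1 * d2 * d3) * (of_int d0 * c0 x) \<in> \<int>" "of_int (d0 * d2 * d3) * (of_int d1 * c1 x) \<in> \<int>"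
    "of_int (d0 * d1 * d3) * (of_int d2 * c2 x) \<in> \<int>" "of_int (d0 * d1 * d2) * (of_int d3 * c3 x) \<in> \<int>"
    by (intro Ints_mult Ints_of_int d0 d1 d2 d3)+
  then have "scale (of_int (d0 * d1 * d2 * d3)) x \<in> integral_coords"
    by (simp add: integral_coords_def algebra_simps)
  then show ?thesis using d0 d1 d2 d3 by (intro exI[of _ "d0 * d1 * d2 * d3"]) simp
qed

lemma integral_coords_scale: "x \<in> integral_coords \<Longrightarrow> scale (of_int m) x \<in> integral_coords"
  by (simp add: integral_coords_def)

lemma bounded_denominators_Un:
  assumes "bounded_denominators A" "bounded_denominators B"
  shows "bounded_denominators (A \<union> B)"
proof -
  from assms obtain d e :: int where d: "d > 0" "\<And>x. x \<in> A \<Longrightarrow> scale (of_int d) x \<in> integral_coords"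
    and e: "e > 0" "\<And>x. x \<in> B \<Longrightarrow> scale (of_int e) x \<in> integral_coords"
    unfolding bounded_denominators_def by blast
  have "scale (of_int (d * e)) x \<in> integral_coords" if "x \<in> A \<union> B" for x
    using that integral_coords_scale[of "scale (of_int d) x" e]
      integral_coords_scale[of "scale (of_int e) x" d] d e
    by (auto simp: mult.commute)
  then show ?thesis unfolding bounded_denominators_def
    using d(1) e(1) by (intro exI[of _ "d * e"]) auto
qed

lemma bounded_denominators_subset: "bounded_denominators B \<Longrightarrow> A \<subseteq> B \<Longrightarrow> bounded_denominators A"
  unfolding bounded_denominators_def by blast

lemma bounded_denominators_finite: "finite B \<Longrightarrow> bounded_denominators B"
proof (induction B rule: finite_induct)
  case empty
  show ?case unfolding bounded_denominators_def by (auto intro: exI[of _ 1])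
next
  case (insert x B)
  have "bounded_denominators {x}"
    using ex_integral_multiple[of x] by (simp add: bounded_denominators_def)
  from bounded_denominators_Un[OF this insert.IH] show ?case by simp
qed

lemma bounded_denominators_zspan:
  assumes "bounded_denominators B" shows "bounded_denominators (zspan B)"
proof -
  from assms obtain D :: int where "D > 0" and D: "\<And>x. x \<in> B \<Longrightarrow> scale (of_int D) x \<in> integral_coords"
    unfolding bounded_denominators_def by blast
  have "zspan B \<subseteq> {x. scale (of_int D) x \<in> integral_coords}"
    by (rule zspan_least) (use D additive_subgroup_scaled_integral in auto)
  with \<open>D > 0\<close> show ?thesis unfolding bounded_denominators_def by blast
qed

lemma subgroup_coordinate_generator:
  assumes S: "additive_subgroup S" and bd: "bounded_denominators S"
    and c: "c \<in> {c0, c1, c2, c3}"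
  shows "\<exists>g\<in>S. \<forall>x\<in>S. \<exists>m::int. c x = of_int m * c g"
proof -
  from bd obtain D :: int where D: "D > 0" "\<And>x. x \<in> S \<Longrightarrow> scale (of_int D) x \<in> integral_coords"
    unfolding bounded_denominators_def by blast
  have diff: "c (x - y) = c x - c y" for x y using c by auto
  have "c 0 = 0" using c by auto
  then have "additive_subgroup (c ` S)"
    using additive_subgroup_zero[OF S] additive_subgroup_diff[OF S]
    unfolding additive_subgroup_def by (force simp: diff[symmetric])
  moreover have "of_int D * q \<in> \<int>" if "q \<in> c ` S" for q
    using that c D by (auto simp: integral_coords_def)
  ultimately have "\<exists>g\<in>c ` S. \<forall>x\<in>c ` S. \<exists>m::int. x = of_int m * g"
    by (rule rat_subgroup_cyclic[OF _ D(1)])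
  then show ?thesis by blast
qed

text \<open>A Hermite normal form. Only the last three coordinates are reduced: for an order the remaining
  scalars turn out to be the integers.\<close>

lemma triangular_generators:
  assumes S: "additive_subgroup S" and bd: "bounded_denominators S"
  obtains g1 g2 g3 where "g1 \<in> S" "g2 \<in> S" "g3 \<in> S" "c2 g1 = 0" "c3 g1 = 0" "c3 g2 = 0"
    "\<And>x. x \<in> S \<Longrightarrow> \<exists>m1 m2 m3 q. x = of_int m1 * g1 + of_int m2 * g2 + of_int m3 * g3 + scale q 1"
proof -
  define S2 where "S2 = {x \<in> S. c3 x = 0}"
  define S1 where "S1 = {x \<in> S. c3 x = 0 \<and> c2 x = 0}"
  have sub: "additive_subgroup S2" "additive_subgroup S1"
    using S by (auto simp: additive_subgroup_def S2_def S1_def)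
  have bds: "bounded_denominators S2" "bounded_denominators S1"
    by (rule bounded_denominators_subset[OF bd], auto simp: S2_def S1_def)+
  obtain g3 where g3: "g3 \<in> S" "\<And>x. x \<in> S \<Longrightarrow> \<exists>m::int. c3 x = of_int m * c3 g3"
    using subgroup_coordinate_generator[OF S bd, of c3] by auto
  obtain g2 where g2: "g2 \<in> S2" "\<And>x. x \<in> S2 \<Longrightarrow> \<exists>m::int. c2 x = of_int m * c2 g2"
    using subgroup_coordinate_generator[OF sub(1) bds(1), of c2] by auto
  obtain g1 where g1: "g1 \<in> S1" "\<And>x. x \<in> S1 \<Longrightarrow> \<exists>m::int. c1 x = of_int m * c1 g1"
    using subgroup_coordinate_generator[OF sub(2) bds(2), of c1] by auto
  have mem: "g1 \<in> S" "g2 \<in> S" using g1 g2 by (auto simp: S1_def S2_def)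
  have "\<exists>m1 m2 m3 q. x = of_int m1 * g1 + of_int m2 * g2 + of_int m3 * g3 + scale q 1"
    if x: "x \<in> S" for x
  proof -
    obtain m3 where m3: "c3 x = of_int m3 * c3 g3" using g3(2)[OF x] by blast
    have "x - of_int m3 * g3 \<in> S2"
      using m3 by (auto simp: S2_def simp flip: scale_of_int
          intro!: additive_subgroup_diff[OF S] x) (simp add: scale_of_int additive_subgroup_of_int S g3)
    then obtain m2 where m2: "c2 (x - of_int m3 * g3) = of_int m2 * c2 g2" using g2(2) by blast
    have "x - of_int m3 * g3 - of_int m2 * g2 \<in> S2"
      by (intro additive_subgroup_diff additive_subgroup_of_int sub g2 \<open>x - of_int m3 * g3 \<in> S2\<close>)
    then have "x - of_int m3 * g3 - of_int m2 * g2 \<in> S1"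
      using m2 by (auto simp: S2_def S1_def simp flip: scale_of_int)
    then obtain m1 where m1: "c1 (x - of_int m3 * g3 - of_int m2 * g2) = of_int m1 * c1 g1"
      using g1(2) by blast
    have "x - of_int m3 * g3 - of_int m2 * g2 - of_int m1 * g1 \<in> S1"
      by (intro additive_subgroup_diff[of S1] additive_subgroup_of_int sub g1
          \<open>x - of_int m3 * g3 - of_int m2 * g2 \<in> S1\<close>)
    moreover define y where "y = x - of_int m3 * g3 - of_int m2 * g2 - of_int m1 * g1"
    ultimately have "c2 y = 0" "c3 y = 0" by (auto simp: S1_def)
    moreover have "c1 y = 0" using m1 by (simp add: y_def flip: scale_of_int)
    ultimately have "y = scale (c0 y) 1" by (simp add: scalar_iff)
    then have "x = of_int m1 * g1 + of_int m2 * g2 + of_int m3 * g3 + scale (c0 y) 1"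
      by (simp add: y_def algebra_simps)
    then show ?thesis by blast
  qed
  then show ?thesis using that[OF mem g3(1)] g1(1) g2(1) by (auto simp: S1_def S2_def)
qed

lemma bounded_subgroup_finitely_generated:
  assumes S: "additive_subgroup S" and bd: "bounded_denominators S"
  shows "\<exists>B. finite B \<and> S = zspan B"
proof -
  obtain g1 g2 g3 where g: "g1 \<in> S" "g2 \<in> S" "g3 \<in> S"
    and rep: "\<And>x. x \<in> S \<Longrightarrow> \<exists>m1 m2 m3 q. x = of_int m1 * g1 + of_int m2 * g2 + of_int m3 * g3 + scale q 1"
    using triangular_generators[OF assms] by metis
  define S0 where "S0 = {x \<in> S. c1 x = 0 \<and> c2 x = 0 \<and> c3 x = 0}"
  have S0: "additive_subgroup S0" using S by (auto simp: additive_subgroup_def S0_def)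
  have "bounded_denominators S0"
    by (rule bounded_denominators_subset[OF bd]) (auto simp: S0_def)
  then obtain g0 where g0: "g0 \<in> S0" "\<And>x. x \<in> S0 \<Longrightarrow> \<exists>m::int. c0 x = of_int m * c0 g0"
    using subgroup_coordinate_generator[OF S0, of c0] by auto
  have "S = zspan {g0, g1, g2, g3}"
  proof
    show "zspan {g0, g1, g2, g3} \<subseteq> S"
      by (rule zspan_least[OF S]) (use g g0 in \<open>auto simp: S0_def\<close>)
    show "S \<subseteq> zspan {g0, g1, g2, g3}"
    proof
      fix x assume x: "x \<in> S"
      obtain m1 m2 m3 q where q: "x = of_int m1 * g1 + of_int m2 * g2 + of_int m3 * g3 + scale q 1"
        using rep[OF x] by blast
      have "scale q 1 = x - of_int m1 * g1 - of_int m2 * g2 - of_int m3 * g3"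
        using q by (simp add: algebra_simps)
      also have "\<dots> \<in> S" by (intro additive_subgroup_diff[OF S] additive_subgroup_of_int S g x)
      finally have "scale q 1 \<in> S0" by (simp add: S0_def)
      then obtain m where m: "q = of_int m * c0 g0" using g0(2)[of "scale q 1"] by auto
      have "g0 = scale (c0 g0) 1" using g0(1) by (simp add: S0_def scalar_iff)
      then have "of_int m * g0 = scale q 1" by (metis m scale_of_int scale_scale)
      then show "x \<in> zspan {g0, g1, g2, g3}" unfolding zspan4_iff using q
        by (metis add.assoc add.commute)
    qed
  qed
  then show ?thesis by (intro exI[of _ "{g0, g1, g2, g3}"]) simp
qed

lemma full_iff_span:
  assumes R: "unital_subring R"
  shows "span R = UNIV \<longleftrightarrow> full R"
proof
  note Ra = unital_subring_additive[OF R]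
  have up: "scale (of_int (m * k)) h \<in> R" if "scale (of_int m) h \<in> R" for m k h
    using additive_subgroup_of_int[OF Ra that, of k] by (simp add: mult.commute flip: scale_of_int)
  assume "span R = UNIV"
  moreover have "span R \<subseteq> {h. \<exists>m::int. m > 0 \<and> scale (of_int m) h \<in> R}" (is "_ \<subseteq> ?T")
  proof (rule span_minimal)
    show "R \<subseteq> ?T" by (auto intro!: exI[of _ 1])
    show "subspace ?T"
    proof (rule subspaceI)
      show "0 \<in> ?T" using additive_subgroup_zero[OF Ra] by (auto intro!: exI[of _ 1])
    next
      fix x y assume "x \<in> ?T" "y \<in> ?T"
      then obtain m n :: int where "m > 0" "scale (of_int m) x \<in> R" "n > 0" "scale (of_int n) y \<in> R"
        by auto
      then have "scale (of_int (m * n)) (x + y) \<in> R"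
        using additive_subgroup_add[OF Ra up[of m x n] up[of n y m]]
        by (simp add: scale_right_distrib mult.commute)
      then show "x + y \<in> ?T" using \<open>m > 0\<close> \<open>n > 0\<close> by (auto intro!: exI[of _ "m * n"])
    next
      fix c :: rat and x assume "x \<in> ?T"
      then obtain m :: int where m: "m > 0" "scale (of_int m) x \<in> R" by auto
      obtain d :: int where d: "d > 0" "of_int d * c \<in> \<int>" using rat_denominator[of c] by blast
      then obtain k where k: "of_int d * c = of_int k" by (auto elim: Ints_cases)
      have "scale (of_int (m * d)) (scale c x) = scale (of_int m * (of_int d * c)) x"
        by (simp add: mult.assoc)
      also have "\<dots> \<in> R" unfolding k using up[OF m(2), of k] by simp
      finally show "scale c x \<in> ?T" using m d by (auto intro!: exI[of _ "m * d"])
    qed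
  qed
  ultimately show "full R" unfolding full_def by auto
next
  assume f: "full R"
  show "span R = UNIV"
  proof (intro equalityI subset_UNIV subsetI)
    fix h
    obtain m :: int where m: "m > 0" "scale (of_int m) h \<in> R" using f by (auto simp: full_def)
    have "scale (1 / of_int m) (scale (of_int m) h) \<in> span R"
      by (intro span_scale span_base m)
    then show "h \<in> span R" using m by simp
  qed
qed

text \<open>The form in which orders are used: finite generation is replaced by bounded denominators, and
  spanning over the rationals by the existence of nonzero integral multiples.\<close>

lemma is_order_iff:
  "is_order scale R \<longleftrightarrow> unital_subring R \<and> bounded_denominators R \<and> full R"
proof
  assume o: "is_order scale R"
  then have u: "unital_subring R" by (simp add: is_order_def unital_subring_def)
  from o obtain B where B: "finite B" "R = range (\<lambda>c :: 'h \<Rightarrow> int. \<Sum>x\<in>B. of_int (c x) * x)"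
    unfolding is_order_def by auto
  have "R = zspan B" using zspan_finite[OF B(1)] B(2) by simp
  then have "bounded_denominators R"
    using bounded_denominators_zspan[OF bounded_denominators_finite[OF B(1)]] by simp
  with u o show "unital_subring R \<and> bounded_denominators R \<and> full R"
    using full_iff_span[OF u] by (simp add: is_order_def)
next
  assume *: "unital_subring R \<and> bounded_denominators R \<and> full R"
  then obtain B where B: "finite B" "R = zspan B"
    using bounded_subgroup_finitely_generated unital_subring_additive by blast
  have "R = range (\<lambda>c :: 'h \<Rightarrow> int. \<Sum>x\<in>B. of_int (c x) * x)"
    unfolding B(2) by (rule zspan_finite[OF B(1)])
  with B(1) have "\<exists>B. finite B \<and> R = range (\<lambda>c :: 'h \<Rightarrow> int. \<Sum>x\<in>B. of_int (c x) * x)"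
    by (intro exI conjI)
  moreover have "module.span scale R = UNIV" using * full_iff_span by blast
  ultimately show "is_order scale R"
    using * unfolding is_order_def unital_subring_def by blast
qed

lemma nrd_bounded:
  assumes "D > 0"
  shows "\<exists>E::int. E > 0 \<and> (\<forall>x. scale (of_int D) x \<in> integral_coords \<longrightarrow> of_int E * nrd x \<in> \<int>)"
proof -
  obtain da where da: "da > 0" "of_int da * a \<in> \<int>" by (rule rat_denominator)
  obtain db where db: "db > 0" "of_int db * b \<in> \<int>" by (rule rat_denominator)
  have "of_int (da * db * D ^ 2) * nrd x \<in> \<int>" if x: "scale (of_int D) x \<in> integral_coords" for x
  proof -
    let ?d = "of_int D :: rat"
    have "of_int (da * db * D ^ 2) * nrd x
      = of_int (da * db) * ((?d * c0 x)\<^sup>2) - (of_int db * (of_int da * a)) * (?d * c1 x)\<^sup>2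
        - (of_int da * (of_int db * b)) * (?d * c2 x)\<^sup>2
        + ((of_int da * a) * (of_int db * b)) * (?d * c3 x)\<^sup>2"
      by (simp add: nrd_def power2_eq_square algebra_simps)
    also have "\<dots> \<in> \<int>"
    proof -
      have sq: "(?d * c0 x)\<^sup>2 \<in> \<int>" "(?d * c1 x)\<^sup>2 \<in> \<int>" "(?d * c2 x)\<^sup>2 \<in> \<int>" "(?d * c3 x)\<^sup>2 \<in> \<int>"
        using x unfolding integral_coords_def mem_Collect_eq coords_scale by (blast intro: Ints_power)+
      show ?thesis by (intro Ints_add Ints_diff) (rule Ints_mult sq Ints_of_int da(2) db(2))+
    qed
    finally show ?thesis .
  qed
  then show ?thesis using da(1) db(1) assms by (intro exI[of _ "da * db * D ^ 2"]) auto
qed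

text \<open>The norm is multiplicative and all powers of \<open>x\<close> lie in \<open>R\<close>, so the powers of \<open>nrd x\<close> have a common
  denominator.\<close>

lemma nrd_integral:
  assumes R: "unital_subring R" "bounded_denominators R" and x: "x \<in> R"
  shows "nrd x \<in> \<int>"
proof -
  from R(2) obtain D :: int where D: "D > 0" "\<And>x. x \<in> R \<Longrightarrow> scale (of_int D) x \<in> integral_coords"
    unfolding bounded_denominators_def by blast
  obtain E :: int where E: "E > 0" "\<And>x. x \<in> R \<Longrightarrow> of_int E * nrd x \<in> \<int>"
    using nrd_bounded[OF D(1)] D(2) by blast
  have pow: "x ^ k \<in> R" for k
    by (induction k) (use R(1) x in \<open>auto simp: unital_subring_def\<close>)
  have "nrd (x ^ k) = nrd x ^ k" for k by (induction k) (simp_all add: nrd_mult)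
  then have "of_int E * nrd x ^ k \<in> \<int>" for k using E(2)[OF pow[of k]] by simp
  then show ?thesis using bounded_powers_imp_int[OF E(1)] by blast
qed

lemma scalar_integral:
  assumes R: "unital_subring R" "bounded_denominators R" and x: "scale q 1 \<in> R"
  shows "q \<in> \<int>"
proof -
  from R(2) obtain D :: int where D: "D > 0" "\<And>x. x \<in> R \<Longrightarrow> scale (of_int D) x \<in> integral_coords"
    unfolding bounded_denominators_def by blast
  have "scale (q ^ k) 1 \<in> R" for k
  proof (induction k)
    case 0 then show ?case using R(1) by (simp add: unital_subring_def)
  next
    case (Suc k)
    then have "scale q 1 * scale (q ^ k) 1 \<in> R" using x R(1) by (auto simp: unital_subring_def)
    then show ?case by (simp add: scale_mult_left)
  qed
  then have "of_int D * q ^ k \<in> \<int>" for k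
    using D(2)[of "scale (q ^ k) 1"] by (simp add: integral_coords_def)
  then show ?thesis using bounded_powers_imp_int[OF D(1)] by blast
qed

end

section \<open>Orders stable under the involution given by a multiplication table\<close>

text \<open>The quaternary form is the norm form of an order given by a multiplication table. Modulo \<open>p\<close> it
  reduces to \<open>y0\<^sup>2 - B y0 y3 + A C y3\<^sup>2\<close>, which after multiplication by \<open>A\<close> is the given binary form at
  \<open>(y0, -A y3)\<close>; so \<open>p\<close> divides \<open>y0\<close> and \<open>y3\<close>. Modulo \<open>p\<^sup>2\<close> only \<open>n\<close> times the binary form at \<open>(y1, y2)\<close>
  then remains.\<close>

lemma anisotropic_norm_form_mod_prime:
  fixes p :: int
  assumes p: "prime p" "p dvd n" "\<not> p\<^sup>2 dvd n"
    and aniso: "\<And>s t. p dvd A * s\<^sup>2 + B * s * t + C * t\<^sup>2 \<Longrightarrow> p dvd s \<and> p dvd t"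
    and N: "p\<^sup>2 dvd y0\<^sup>2 + n * (A * y1\<^sup>2 + B * y1 * y2 + C * y2\<^sup>2) + A * C * y3\<^sup>2
      + n * u * y0 * y1 + n * v * y0 * y2 + (n * u * v - B) * y0 * y3
      + n * A * v * y1 * y3 + n * u * C * y2 * y3"
  shows "p dvd y0 \<and> p dvd y1 \<and> p dvd y2 \<and> p dvd y3"
proof -
  obtain n' where n': "n = p * n'" using p(2) by (elim dvdE)
  have pn': "\<not> p dvd n'" using p(3) by (auto simp: n' power2_eq_square)
  have "\<not> p dvd A" using aniso[of 1 0] p(1) by (auto simp: not_prime_unit)
  have "p dvd y0\<^sup>2 - B * y0 * y3 + A * C * y3\<^sup>2"
  proof -
    have "p dvd y0\<^sup>2 + n * (A * y1\<^sup>2 + B * y1 * y2 + C * y2\<^sup>2) + A * C * y3\<^sup>2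
      + n * u * y0 * y1 + n * v * y0 * y2 + (n * u * v - B) * y0 * y3
      + n * A * v * y1 * y3 + n * u * C * y2 * y3"
      using N by (meson dvd_trans dvd_triv_left power2_eq_square dvd_power zero_less_numeral)
    also have "y0\<^sup>2 + n * (A * y1\<^sup>2 + B * y1 * y2 + C * y2\<^sup>2) + A * C * y3\<^sup>2
      + n * u * y0 * y1 + n * v * y0 * y2 + (n * u * v - B) * y0 * y3
      + n * A * v * y1 * y3 + n * u * C * y2 * y3
      = (y0\<^sup>2 - B * y0 * y3 + A * C * y3\<^sup>2) + p * (n' * (A * y1\<^sup>2 + B * y1 * y2 + C * y2\<^sup>2
        + u * y0 * y1 + v * y0 * y2 + u * v * y0 * y3 + A * v * y1 * y3 + u * C * y2 * y3))"
      by (simp add: n' algebra_simps)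
    finally show ?thesis using dvd_add_left_iff dvd_triv_left by blast
  qed
  then have "p dvd A * (y0\<^sup>2 - B * y0 * y3 + A * C * y3\<^sup>2)" by simp
  also have "A * (y0\<^sup>2 - B * y0 * y3 + A * C * y3\<^sup>2)
      = A * y0\<^sup>2 + B * y0 * (- A * y3) + C * (- A * y3)\<^sup>2"
    by (simp add: power2_eq_square algebra_simps)
  finally have "p dvd y0 \<and> p dvd - A * y3" by (rule aniso)
  then have y0: "p dvd y0" and y3: "p dvd y3"
    using p(1) \<open>\<not> p dvd A\<close> by (auto simp: prime_dvd_mult_iff)
  obtain z0 where z0: "y0 = p * z0" using y0 by (elim dvdE)
  obtain z3 where z3: "y3 = p * z3" using y3 by (elim dvdE)
  have "y0\<^sup>2 + n * (A * y1\<^sup>2 + B * y1 * y2 + C * y2\<^sup>2) + A * C * y3\<^sup>2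
      + n * u * y0 * y1 + n * v * y0 * y2 + (n * u * v - B) * y0 * y3
      + n * A * v * y1 * y3 + n * u * C * y2 * y3
    = p * n' * (A * y1\<^sup>2 + B * y1 * y2 + C * y2\<^sup>2)
      + p\<^sup>2 * (z0\<^sup>2 + A * C * z3\<^sup>2 + n' * u * z0 * y1 + n' * v * z0 * y2 + (n * u * v - B) * z0 * z3
        + n' * A * v * y1 * z3 + n' * u * C * y2 * z3)"
    by (simp add: n' z0 z3 power2_eq_square algebra_simps)
  with N have "p\<^sup>2 dvd p * n' * (A * y1\<^sup>2 + B * y1 * y2 + C * y2\<^sup>2)"
    using dvd_add_left_iff dvd_triv_left by metis
  then have "p dvd n' * (A * y1\<^sup>2 + B * y1 * y2 + C * y2\<^sup>2)"
    using p(1) by (simp add: power2_eq_square mult.assoc)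
  then have "p dvd A * y1\<^sup>2 + B * y1 * y2 + C * y2\<^sup>2"
    using p(1) pn' prime_dvd_mult_iff by blast
  then show ?thesis using aniso y0 y3 by blast
qed

context symmetric_quaternion
begin

interpretation dd: Vector_Spaces.linear scale scale dd by (rule dd_linear)

lemma dd_add: "dd (x + y) = dd x + dd y" by (rule dd.add)
lemma dd_diff: "dd (x - y) = dd x - dd y" by (rule dd.diff)
lemma dd_uminus: "dd (- x) = - dd x" by (rule dd.neg)
lemma dd_scale: "dd (scale q x) = scale q (dd x)" by (rule dd.scale)
lemma dd_zero [simp]: "dd 0 = 0" by (rule dd.zero)
lemma dd_one [simp]: "dd 1 = 1"
  using dd_mult[of "dd 1" 1] dd_dd[of 1] by simp

lemmas dd_simps = dd_add dd_diff dd_uminus dd_scale dd_mult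

lemma dd_quat: "dd (quat w x y z) = quat w x y (- z)"
  by (simp add: quat_def dd_simps anticommute)

lemma symmetric_iff: "dd x = x \<longleftrightarrow> c3 x = 0"
proof (cases x rule: quat_cases)
  case (1 w y z t)
  have "(- t = t) = (t = 0)" by auto
  then show ?thesis unfolding 1 dd_quat quat_eq_iff by simp
qed

lemma zspan_scale: "x \<in> zspan X \<Longrightarrow> scale (of_int m) x \<in> zspan X"
  by (simp add: scale_of_int additive_subgroup_of_int additive_subgroup_zspan)

lemma zspan_add: "x \<in> zspan X \<Longrightarrow> y \<in> zspan X \<Longrightarrow> x + y \<in> zspan X"
  by (rule additive_subgroup_add[OF additive_subgroup_zspan])

lemma zspan_uminus: "x \<in> zspan X \<Longrightarrow> - x \<in> zspan X"
  by (rule additive_subgroup_uminus[OF additive_subgroup_zspan])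

lemmas zspan_closed = zspan_add zspan_uminus zspan_scale zspan.diff

lemma zspan_basis_iff: "x \<in> zspan {1, \<alpha>, \<beta>, \<gamma>} \<longleftrightarrow> (\<exists>m0 m1 m2 m3. x =
    scale (of_int m0) 1 + scale (of_int m1) \<alpha> + scale (of_int m2) \<beta> + scale (of_int m3) \<gamma>)"
  unfolding zspan4_iff scale_of_int ..

definition lin_indep :: "'h \<Rightarrow> 'h \<Rightarrow> 'h \<Rightarrow> bool" where
  "lin_indep \<alpha> \<beta> \<gamma> \<longleftrightarrow> (\<forall>q0 q1 q2 q3. scale q0 1 + scale q1 \<alpha> + scale q2 \<beta> + scale q3 \<gamma> = 0 \<longrightarrow>
     q0 = 0 \<and> q1 = 0 \<and> q2 = 0 \<and> q3 = 0)"

lemma lin_indep_eq: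
  assumes "lin_indep \<alpha> \<beta> \<gamma>" and "scale q0 1 + scale q1 \<alpha> + scale q2 \<beta> + scale q3 \<gamma>
    = scale r0 1 + scale r1 \<alpha> + scale r2 \<beta> + scale r3 \<gamma>"
  shows "q0 = r0 \<and> q1 = r1 \<and> q2 = r2 \<and> q3 = r3"
proof -
  have "scale (q0 - r0) 1 + scale (q1 - r1) \<alpha> + scale (q2 - r2) \<beta> + scale (q3 - r3) \<gamma> = 0"
    using assms(2) by (simp add: scale_left_diff_distrib algebra_simps)
  then have "q0 - r0 = 0 \<and> q1 - r1 = 0 \<and> q2 - r2 = 0 \<and> q3 - r3 = 0"
    using assms(1) unfolding lin_indep_def by blast
  then show ?thesis by simp
qed

text \<open>These few relations determine all products, since \<open>n\<close> is invertible over the rationals. For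
  independent \<open>1, \<alpha>, \<beta>, \<gamma>\<close> the integer \<open>\<bar>n\<bar>\<close> is the index in \<open>\<int>1 + \<int>\<alpha> + \<int>\<beta> + \<int>\<gamma>\<close> of the ring
  generated by \<open>\<alpha>\<close> and \<open>\<beta>\<close>; up to the factor \<open>n\<close>, the norm of \<open>s\<alpha> + t\<beta>\<close> is the binary form \<open>A s\<^sup>2 + B s t + C t\<^sup>2\<close>.\<close>

definition multiplication_table :: "'h \<Rightarrow> 'h \<Rightarrow> 'h \<Rightarrow> int \<Rightarrow> int \<Rightarrow> int \<Rightarrow> int \<Rightarrow> int \<Rightarrow> int \<Rightarrow> bool" where
  "multiplication_table \<alpha> \<beta> \<gamma> n u v A B C \<longleftrightarrow> n \<noteq> 0 \<and> dd \<alpha> = \<alpha> \<and> dd \<beta> = \<beta> \<and>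
     \<alpha> * \<beta> = scale (of_int n) \<gamma> \<and>
     \<alpha> * \<alpha> = scale (of_int (n * u)) \<alpha> - scale (of_int (n * A)) 1 \<and>
     \<beta> * \<beta> = scale (of_int (n * v)) \<beta> - scale (of_int (n * C)) 1 \<and>
     dd \<gamma> = scale (of_int v) \<alpha> + scale (of_int u) \<beta> - scale (of_int B) 1 - \<gamma>"

text \<open>Each product is computed after multiplication by \<open>n\<close>, where \<open>n\<gamma>\<close> can be replaced by \<open>\<alpha>\<beta>\<close> and
  \<open>n\<gamma>\<^sup>\<ddagger>\<close> by \<open>\<beta>\<alpha>\<close>.\<close>

lemma multiplication_table_products:
  assumes "multiplication_table \<alpha> \<beta> \<gamma> n u v A B C"
  shows "\<beta> * \<alpha> = scale (of_int n) (dd \<gamma>)"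
    and "\<alpha> * \<gamma> = scale (of_int (n * u)) \<gamma> - scale (of_int A) \<beta>"
    and "\<gamma> * \<beta> = scale (of_int (n * v)) \<gamma> - scale (of_int C) \<alpha>"
    and "\<gamma> * \<alpha> = scale (of_int A) \<beta> + scale (of_int (n * u * v - B)) \<alpha> - scale (of_int (n * A * v)) 1"
    and "\<beta> * \<gamma> = scale (of_int C) \<alpha> + scale (of_int (n * u * v - B)) \<beta> - scale (of_int (n * u * C)) 1"
    and "\<gamma> * \<gamma> = scale (of_int (n * u * v - B)) \<gamma> - scale (of_int (A * C)) 1"
proof -
  let ?n = "of_int n :: rat"
  have n: "?n \<noteq> 0" and dd: "dd \<alpha> = \<alpha>" "dd \<beta> = \<beta>" and ab: "\<alpha> * \<beta> = scale ?n \<gamma>"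
    and aa: "\<alpha> * \<alpha> = scale (of_int (n * u)) \<alpha> - scale (of_int (n * A)) 1"
    and bb: "\<beta> * \<beta> = scale (of_int (n * v)) \<beta> - scale (of_int (n * C)) 1"
    and ddg: "dd \<gamma> = scale (of_int v) \<alpha> + scale (of_int u) \<beta> - scale (of_int B) 1 - \<gamma>"
    using assms unfolding multiplication_table_def by auto
  have cancel: "x = y" if "scale ?n x = scale ?n y" for x y
    using that n by simp
  show ba: "\<beta> * \<alpha> = scale ?n (dd \<gamma>)"
    using dd_mult[of \<alpha> \<beta>] by (simp add: ab dd dd_scale)
  show ag: "\<alpha> * \<gamma> = scale (of_int (n * u)) \<gamma> - scale (of_int A) \<beta>"
  proof (rule cancel)
    have "scale ?n (\<alpha> * \<gamma>) = (\<alpha> * \<alpha>) * \<beta>" by (simp add: mult.assoc ab scale_mult_right)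
    also have "\<dots> = scale ?n (scale (of_int (n * u)) \<gamma> - scale (of_int A) \<beta>)"
      by (simp add: aa left_diff_distrib scale_mult_left ab scale_right_diff_distrib mult_ac)
    finally show "scale ?n (\<alpha> * \<gamma>) = \<dots>" .
  qed
  show gb: "\<gamma> * \<beta> = scale (of_int (n * v)) \<gamma> - scale (of_int C) \<alpha>"
  proof (rule cancel)
    have "scale ?n (\<gamma> * \<beta>) = \<alpha> * (\<beta> * \<beta>)" by (simp add: mult.assoc[symmetric] ab scale_mult_left)
    also have "\<dots> = scale ?n (scale (of_int (n * v)) \<gamma> - scale (of_int C) \<alpha>)"
      by (simp add: bb right_diff_distrib scale_mult_right ab scale_right_diff_distrib mult_ac)
    finally show "scale ?n (\<gamma> * \<beta>) = \<dots>" .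
  qed
  \<comment> \<open>both sides become \<open>\<alpha>\<beta>\<alpha>\<close> after multiplication by \<open>n\<close>\<close>
  have "\<gamma> * \<alpha> = \<alpha> * dd \<gamma>"
  proof (rule cancel)
    have "scale ?n (\<gamma> * \<alpha>) = \<alpha> * (\<beta> * \<alpha>)" by (simp add: mult.assoc[symmetric] ab scale_mult_left)
    then show "scale ?n (\<gamma> * \<alpha>) = scale ?n (\<alpha> * dd \<gamma>)" by (simp add: ba scale_mult_right)
  qed
  then show "\<gamma> * \<alpha> = scale (of_int A) \<beta> + scale (of_int (n * u * v - B)) \<alpha> - scale (of_int (n * A * v)) 1"
    by (simp add: ddg distrib_left right_diff_distrib scale_mult_right aa ab ag
        scale_right_diff_distrib scale_left_diff_distrib scale_left_distrib mult_ac algebra_simps)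
  have "\<beta> * \<gamma> = dd \<gamma> * \<beta>"
  proof (rule cancel)
    have "scale ?n (\<beta> * \<gamma>) = (\<beta> * \<alpha>) * \<beta>" by (simp add: mult.assoc ab scale_mult_right)
    then show "scale ?n (\<beta> * \<gamma>) = scale ?n (dd \<gamma> * \<beta>)" by (simp add: ba scale_mult_left)
  qed
  then show bg: "\<beta> * \<gamma> = scale (of_int C) \<alpha> + scale (of_int (n * u * v - B)) \<beta> - scale (of_int (n * u * C)) 1"
    by (simp add: ddg distrib_right left_diff_distrib scale_mult_left bb ab gb
        scale_right_diff_distrib scale_left_diff_distrib scale_left_distrib mult_ac algebra_simps)
  show "\<gamma> * \<gamma> = scale (of_int (n * u * v - B)) \<gamma> - scale (of_int (A * C)) 1"
  proof (rule cancel)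
    have "scale ?n (\<gamma> * \<gamma>) = \<alpha> * (\<beta> * \<gamma>)" by (simp add: mult.assoc[symmetric] ab scale_mult_left)
    also have "\<dots> = scale ?n (scale (of_int (n * u * v - B)) \<gamma> - scale (of_int (A * C)) 1)"
      unfolding bg by (simp add: distrib_left right_diff_distrib scale_mult_right aa ab
        scale_right_diff_distrib scale_left_diff_distrib scale_left_distrib mult_ac algebra_simps)
    finally show "scale ?n (\<gamma> * \<gamma>) = \<dots>" .
  qed
qed

lemma multiplication_table_subring:
  assumes "multiplication_table \<alpha> \<beta> \<gamma> n u v A B C"
  shows "unital_subring (zspan {1, \<alpha>, \<beta>, \<gamma>})" and "dd ` zspan {1, \<alpha>, \<beta>, \<gamma>} \<subseteq> zspan {1, \<alpha>, \<beta>, \<gamma>}"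
proof -
  let ?Z = "zspan {1, \<alpha>, \<beta>, \<gamma>}"
  note t = assms[unfolded multiplication_table_def]
  note pr = multiplication_table_products[OF assms]
  have g: "1 \<in> ?Z" "\<alpha> \<in> ?Z" "\<beta> \<in> ?Z" "\<gamma> \<in> ?Z" by (auto intro: zspan.gen)
  have ddg: "dd \<gamma> \<in> ?Z" using t by (auto intro!: zspan_closed g)
  have "\<alpha> * \<alpha> \<in> ?Z" "\<alpha> * \<beta> \<in> ?Z" "\<beta> * \<beta> \<in> ?Z"
    using t by (auto simp del: of_int_mult intro!: zspan_closed g)
  moreover have "\<beta> * \<alpha> \<in> ?Z" "\<alpha> * \<gamma> \<in> ?Z" "\<gamma> * \<beta> \<in> ?Z" "\<gamma> * \<alpha> \<in> ?Z" "\<beta> * \<gamma> \<in> ?Z" "\<gamma> * \<gamma> \<in> ?Z"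
    unfolding pr by (intro zspan_closed g ddg)+
  ultimately have "x * y \<in> ?Z" if "x \<in> {1, \<alpha>, \<beta>, \<gamma>}" "y \<in> {1, \<alpha>, \<beta>, \<gamma>}" for x y
    using that g by auto
  then have "x * y \<in> ?Z" if "x \<in> ?Z" "y \<in> ?Z" for x y using zspan_mult_closed that by blast
  then show "unital_subring ?Z" using g by (auto simp: unital_subring_def intro: zspan.diff)
  have "?Z \<subseteq> {x. dd x \<in> ?Z}"
  proof (rule zspan_least)
    show "additive_subgroup {x. dd x \<in> ?Z}"
      by (auto simp: additive_subgroup_def dd_diff intro: zspan.intros)
    show "{1, \<alpha>, \<beta>, \<gamma>} \<subseteq> {x. dd x \<in> ?Z}" using t g ddg by auto
  qed
  then show "dd ` ?Z \<subseteq> ?Z" by auto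
qed

lemma maximal_dd_orderD:
  assumes "is_maximal_dd_order scale dd R"
  shows "unital_subring R" "bounded_denominators R" "full R" "dd ` R \<subseteq> R"
  using assms unfolding is_maximal_dd_order_def is_dd_order_def is_order_iff by auto

lemma maximal_dd_order_eqI:
  assumes "is_maximal_dd_order scale dd R" and "unital_subring T" "bounded_denominators T"
    "dd ` T \<subseteq> T" "R \<subseteq> T"
  shows "T = R"
proof -
  have "full T" using maximal_dd_orderD(3)[OF assms(1)] assms(5) unfolding full_def by blast
  then have "is_dd_order scale dd T"
    unfolding is_dd_order_def is_order_iff using assms(2-4) by simp
  then show ?thesis using assms(1,5) unfolding is_maximal_dd_order_def by simp
qed

text \<open>How maximality excludes divisibility: a multiplication table whose basis generates the basis of a
  maximal order describes that same order.\<close>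

lemma maximal_dd_order_no_extension:
  assumes "is_maximal_dd_order scale dd (zspan {1, \<alpha>, \<beta>, \<gamma>})"
    and "multiplication_table \<alpha>' \<beta>' \<gamma>' n u v A B C"
    and "{\<alpha>, \<beta>, \<gamma>} \<subseteq> zspan {1, \<alpha>', \<beta>', \<gamma>'}"
  shows "{\<alpha>', \<beta>', \<gamma>'} \<subseteq> zspan {1, \<alpha>, \<beta>, \<gamma>}"
proof -
  have "zspan {1, \<alpha>', \<beta>', \<gamma>'} = zspan {1, \<alpha>, \<beta>, \<gamma>}"
  proof (rule maximal_dd_order_eqI[OF assms(1)])
    show "zspan {1, \<alpha>, \<beta>, \<gamma>} \<subseteq> zspan {1, \<alpha>', \<beta>', \<gamma>'}"
      by (rule zspan_least) (use assms(3) in \<open>auto simp: additive_subgroup_zspan intro: zspan.gen\<close>)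
    show "bounded_denominators (zspan {1, \<alpha>', \<beta>', \<gamma>'})"
      by (intro bounded_denominators_zspan bounded_denominators_finite) simp
  qed (rule multiplication_table_subring[OF assms(2)])+
  then show ?thesis by (auto intro: zspan.gen)
qed

lemma fraction_not_in_zspan:
  assumes "lin_indep \<alpha> \<beta> \<gamma>" and p: "prime (p::int)"
  shows "scale (1 / of_int p) \<alpha> \<notin> zspan {1, \<alpha>, \<beta>, \<gamma>}" "scale (1 / of_int p) \<beta> \<notin> zspan {1, \<alpha>, \<beta>, \<gamma>}"
proof -
  have no: "1 / rat_of_int p \<noteq> of_int m" for m
  proof
    assume "1 / rat_of_int p = of_int m"
    then have "rat_of_int (m * p) = of_int 1" using p by (simp add: field_simps)
    then have "m * p = 1" by (simp only: of_int_eq_iff)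
    then show False using p by (metis dvd_triv_right not_prime_unit)
  qed
  show "scale (1 / of_int p) \<alpha> \<notin> zspan {1, \<alpha>, \<beta>, \<gamma>}"
  proof
    assume "scale (1 / of_int p) \<alpha> \<in> zspan {1, \<alpha>, \<beta>, \<gamma>}"
    then obtain m0 m1 m2 m3 where "scale 0 1 + scale (1 / of_int p) \<alpha> + scale 0 \<beta> + scale 0 \<gamma> =
      scale (of_int m0) 1 + scale (of_int m1) \<alpha> + scale (of_int m2) \<beta> + scale (of_int m3) \<gamma>"
      unfolding zspan_basis_iff by auto
    from lin_indep_eq[OF assms(1) this] no show False by blast
  qed
  show "scale (1 / of_int p) \<beta> \<notin> zspan {1, \<alpha>, \<beta>, \<gamma>}"
  proof
    assume "scale (1 / of_int p) \<beta> \<in> zspan {1, \<alpha>, \<beta>, \<gamma>}"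
    then obtain m0 m1 m2 m3 where "scale 0 1 + scale 0 \<alpha> + scale (1 / of_int p) \<beta> + scale 0 \<gamma> =
      scale (of_int m0) 1 + scale (of_int m1) \<alpha> + scale (of_int m2) \<beta> + scale (of_int m3) \<gamma>"
      unfolding zspan_basis_iff by auto
    from lin_indep_eq[OF assms(1) this] no show False by blast
  qed
qed

lemma in_zspan_basis: "1 \<in> zspan {1, \<alpha>, \<beta>, \<gamma>}" "\<alpha> \<in> zspan {1, \<alpha>, \<beta>, \<gamma>}" "\<beta> \<in> zspan {1, \<alpha>, \<beta>, \<gamma>}"
  "\<gamma> \<in> zspan {1, \<alpha>, \<beta>, \<gamma>}"
  by (auto intro: zspan.gen)

text \<open>Dividing \<open>\<alpha>\<close> by \<open>p\<close> and \<open>\<beta>\<close> by \<open>q\<close> while keeping \<open>\<gamma>\<close> again gives a multiplication table, provided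
  that \<open>pq\<close> divides \<open>n\<close> and \<open>A\<close> and \<open>C\<close> are divisible as needed. For \<open>p = q\<close> the binary form does not change.\<close>

lemma multiplication_table_rescale:
  assumes t: "multiplication_table (scale (of_int p) x) (scale (of_int q) y) \<gamma> (p * q * m) u v A B C"
    and pq: "p \<noteq> 0" "q \<noteq> 0" and A': "p * A' = q * A" and C': "q * C' = p * C"
  shows "multiplication_table x y \<gamma> m (q * u) (p * v) A' B C'"
proof -
  let ?p = "rat_of_int p" and ?q = "rat_of_int q"
  have p0: "?p \<noteq> 0" "?q \<noteq> 0" using pq by auto
  have dd: "dd x = x" "dd y = y"
    and ab: "scale (?p * ?q) (x * y) = scale (?p * ?q) (scale (of_int m) \<gamma>)"
    and aa: "scale (?p * ?p) (x * x) = scale (of_int (p * q * m * u)) (scale ?p x) - scale (of_int (p * q * m * A)) 1"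
    and bb: "scale (?q * ?q) (y * y) = scale (of_int (p * q * m * v)) (scale ?q y) - scale (of_int (p * q * m * C)) 1"
    and ddg: "dd \<gamma> = scale (of_int v) (scale ?p x) + scale (of_int u) (scale ?q y) - scale (of_int B) 1 - \<gamma>"
    using t p0 unfolding multiplication_table_def
    by (auto simp: dd_scale scale_mult_left scale_mult_right mult_ac)
  have "p * q * m * A = p * m * (q * A)" "p * q * m * C = q * m * (p * C)" by simp_all
  then have eq: "p * q * m * A = p * p * (m * A')" "p * q * m * C = q * q * (m * C')"
    unfolding A'[symmetric] C'[symmetric] by simp_all
  have "scale (?p * ?p) (x * x) = scale (?p * ?p) (scale (of_int (m * (q * u))) x - scale (of_int (m * A')) 1)"
    and "scale (?q * ?q) (y * y) = scale (?q * ?q) (scale (of_int (m * (p * v))) y - scale (of_int (m * C')) 1)"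
    unfolding aa bb eq by (simp_all add: scale_right_diff_distrib mult_ac)
  moreover have "x * y = scale (of_int m) \<gamma>"
    using ab p0 by (simp only: scale_cancel_left mult_eq_0_iff) simp
  ultimately show ?thesis
    using t p0 unfolding multiplication_table_def by (simp add: dd ddg mult_ac)
qed

text \<open>Otherwise \<open>\<alpha>/p\<close> and \<open>\<beta>/p\<close> could both be adjoined: rescaling with \<open>p = q\<close> turns \<open>n\<close> into \<open>n/p\<^sup>2\<close>.\<close>

lemma maximal_square_not_dvd:
  assumes max: "is_maximal_dd_order scale dd (zspan {1, \<alpha>, \<beta>, \<gamma>})"
    and t: "multiplication_table \<alpha> \<beta> \<gamma> n u v A B C" and ind: "lin_indep \<alpha> \<beta> \<gamma>"
    and p: "prime (p::int)"
  shows "\<not> p\<^sup>2 dvd n"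
proof
  assume "p\<^sup>2 dvd n"
  then obtain m where m: "n = p\<^sup>2 * m" by (elim dvdE)
  define x y where "x = scale (1 / of_int p) \<alpha>" and "y = scale (1 / of_int p) \<beta>"
  have p0: "of_int p \<noteq> (0::rat)" using p by auto
  have \<alpha>: "\<alpha> = scale (of_int p) x" and \<beta>: "\<beta> = scale (of_int p) y" using p0 by (simp_all add: x_def y_def)
  have "multiplication_table x y \<gamma> m (p * u) (p * v) A B C"
    using t p by (intro multiplication_table_rescale[of p x p y \<gamma> m u v A B C])
      (auto simp: m \<alpha> \<beta> power2_eq_square)
  moreover have "{\<alpha>, \<beta>, \<gamma>} \<subseteq> zspan {1, x, y, \<gamma>}"
    by (auto simp: \<alpha> \<beta> intro!: zspan_scale in_zspan_basis)
  ultimately have "x \<in> zspan {1, \<alpha>, \<beta>, \<gamma>}"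
    using maximal_dd_order_no_extension[OF max] by simp
  then show False using fraction_not_in_zspan[OF ind p] by (simp add: x_def)
qed

text \<open>Otherwise \<open>\<alpha>/p\<close> could be adjoined: rescaling turns \<open>n, A, C\<close> into \<open>n/p, A/p, pC\<close>.\<close>

lemma maximal_left_coeff_not_dvd:
  assumes max: "is_maximal_dd_order scale dd (zspan {1, \<alpha>, \<beta>, \<gamma>})"
    and t: "multiplication_table \<alpha> \<beta> \<gamma> n u v A B C" and ind: "lin_indep \<alpha> \<beta> \<gamma>"
    and p: "prime (p::int)" "p dvd n"
  shows "\<not> p dvd A"
proof
  assume "p dvd A"
  then obtain A' where A': "A = p * A'" by (elim dvdE)
  obtain m where m: "n = p * m" using p(2) by (elim dvdE)
  define x where "x = scale (1 / of_int p) \<alpha>"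
  have p0: "of_int p \<noteq> (0::rat)" using p by auto
  have \<alpha>: "\<alpha> = scale (of_int p) x" using p0 by (simp add: x_def)
  have "multiplication_table x \<beta> \<gamma> m u (p * v) A' B (p * C)"
    using t p multiplication_table_rescale[of p x 1 \<beta> \<gamma> m u v A B C A' "p * C"]
    unfolding m A' \<alpha> by simp
  moreover have "{\<alpha>, \<beta>, \<gamma>} \<subseteq> zspan {1, x, \<beta>, \<gamma>}"
    by (auto simp: \<alpha> intro!: zspan_scale in_zspan_basis)
  ultimately have "x \<in> zspan {1, \<alpha>, \<beta>, \<gamma>}"
    using maximal_dd_order_no_extension[OF max] by simp
  then show False using fraction_not_in_zspan[OF ind p(1)] by (simp add: x_def)
qed

lemma maximal_right_coeff_not_dvd:
  assumes max: "is_maximal_dd_order scale dd (zspan {1, \<alpha>, \<beta>, \<gamma>})"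
    and t: "multiplication_table \<alpha> \<beta> \<gamma> n u v A B C" and ind: "lin_indep \<alpha> \<beta> \<gamma>"
    and p: "prime (p::int)" "p dvd n"
  shows "\<not> p dvd C"
proof
  assume "p dvd C"
  then obtain C' where C': "C = p * C'" by (elim dvdE)
  obtain m where m: "n = p * m" using p(2) by (elim dvdE)
  define y where "y = scale (1 / of_int p) \<beta>"
  have p0: "of_int p \<noteq> (0::rat)" using p by auto
  have \<beta>: "\<beta> = scale (of_int p) y" using p0 by (simp add: y_def)
  have "multiplication_table \<alpha> y \<gamma> m (p * u) v (p * A) B C'"
    using t p multiplication_table_rescale[of 1 \<alpha> p y \<gamma> m u v A B C "p * A" C']
    unfolding m C' \<beta> by simp
  moreover have "{\<alpha>, \<beta>, \<gamma>} \<subseteq> zspan {1, \<alpha>, y, \<gamma>}"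
    by (auto simp: \<beta> intro!: zspan_scale in_zspan_basis)
  ultimately have "y \<in> zspan {1, \<alpha>, \<beta>, \<gamma>}"
    using maximal_dd_order_no_extension[OF max] by simp
  then show False using fraction_not_in_zspan[OF ind p(1)] by (simp add: y_def)
qed

text \<open>The substitution \<open>\<alpha> \<mapsto> \<alpha> + k\<beta>\<close>; the correction of \<open>\<gamma>\<close> is \<open>k\<beta>\<^sup>2/n\<close>. The binary form undergoes the
  corresponding substitution, and its leading coefficient becomes the value at \<open>(1, k)\<close>.\<close>

lemma multiplication_table_shear:
  assumes t: "multiplication_table \<alpha> \<beta> \<gamma> n u v A B C"
  shows "multiplication_table (\<alpha> + scale (of_int k) \<beta>) \<beta>
     (\<gamma> + scale (of_int (k * v)) \<beta> - scale (of_int (k * C)) 1)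
     n (u + k * v) v (A + k * B + k\<^sup>2 * C) (B + 2 * k * C) C"
proof -
  note pr = multiplication_table_products(1)[OF t]
  have dd: "dd \<alpha> = \<alpha>" "dd \<beta> = \<beta>" and ab: "\<alpha> * \<beta> = scale (of_int n) \<gamma>"
    and aa: "\<alpha> * \<alpha> = scale (of_int (n * u)) \<alpha> - scale (of_int (n * A)) 1"
    and bb: "\<beta> * \<beta> = scale (of_int (n * v)) \<beta> - scale (of_int (n * C)) 1"
    and ddg: "dd \<gamma> = scale (of_int v) \<alpha> + scale (of_int u) \<beta> - scale (of_int B) 1 - \<gamma>"
    using t unfolding multiplication_table_def by auto
  show ?thesis
    unfolding multiplication_table_def
  proof (intro conjI)
    show "n \<noteq> 0" using t by (simp add: multiplication_table_def)
    show "(\<alpha> + scale (of_int k) \<beta>) * (\<alpha> + scale (of_int k) \<beta>) =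
      scale (of_int (n * (u + k * v))) (\<alpha> + scale (of_int k) \<beta>) -
      scale (of_int (n * (A + k * B + k\<^sup>2 * C))) 1"
      by (simp add: distrib_left distrib_right scale_mult_left scale_mult_right aa bb ab pr ddg
        scale_right_diff_distrib scale_right_distrib scale_left_diff_distrib scale_left_distrib
        power2_eq_square algebra_simps)
    have "scale (of_int (B + 2 * k * C)) 1
      = scale (of_int B) 1 + scale (of_int (k * C)) 1 + scale (of_int (k * C)) 1"
      unfolding scale_left_distrib[symmetric] by simp
    then show "dd (\<gamma> + scale (of_int (k * v)) \<beta> - scale (of_int (k * C)) 1) =
      scale (of_int v) (\<alpha> + scale (of_int k) \<beta>) + scale (of_int (u + k * v)) \<beta>
      - scale (of_int (B + 2 * k * C)) 1 - (\<gamma> + scale (of_int (k * v)) \<beta> - scale (of_int (k * C)) 1)"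
      by (simp add: dd dd_simps ddg scale_right_distrib scale_left_distrib algebra_simps del: of_int_add)
        (simp add: scale_left_distrib)
  qed (simp_all add: dd dd_simps ddg distrib_left distrib_right scale_mult_left scale_mult_right aa bb ab
        scale_right_diff_distrib scale_right_distrib scale_left_diff_distrib scale_left_distrib
        algebra_simps)
qed

text \<open>A zero of the form modulo \<open>p\<close> can be moved to \<open>(1, 0)\<close> by a shear, or to \<open>(0, 1)\<close>, so that the leading or
  the last coefficient becomes divisible by \<open>p\<close>. Then \<open>\<alpha>/p\<close> or \<open>\<beta>/p\<close> can be adjoined.\<close>

lemma maximal_form_anisotropic:
  assumes max: "is_maximal_dd_order scale dd (zspan {1, \<alpha>, \<beta>, \<gamma>})"
    and t: "multiplication_table \<alpha> \<beta> \<gamma> n u v A B C" and ind: "lin_indep \<alpha> \<beta> \<gamma>"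
    and p: "prime (p::int)" "p dvd n"
    and f: "p dvd A * x\<^sup>2 + B * x * y + C * y\<^sup>2"
  shows "p dvd x \<and> p dvd y"
proof -
  have C: "\<not> p dvd C" by (rule maximal_right_coeff_not_dvd[OF max t ind p])
  have A: "\<not> p dvd A + k * B + k\<^sup>2 * C" for k
  proof -
    let ?\<alpha> = "\<alpha> + scale (of_int k) \<beta>" and ?\<gamma> = "\<gamma> + scale (of_int (k * v)) \<beta> - scale (of_int (k * C)) 1"
    have "?\<alpha> \<in> zspan {1, \<alpha>, \<beta>, \<gamma>}" "?\<gamma> \<in> zspan {1, \<alpha>, \<beta>, \<gamma>}"
      by (intro zspan_closed in_zspan_basis)+
    then have 1: "zspan {1, ?\<alpha>, \<beta>, ?\<gamma>} \<subseteq> zspan {1, \<alpha>, \<beta>, \<gamma>}"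
      by (intro zspan_least additive_subgroup_zspan) (auto intro: in_zspan_basis)
    let ?Z' = "zspan {1, ?\<alpha>, \<beta>, ?\<gamma>}"
    have "?\<alpha> - scale (of_int k) \<beta> \<in> ?Z'" "?\<gamma> - scale (of_int (k * v)) \<beta> + scale (of_int (k * C)) 1 \<in> ?Z'"
      by (intro zspan_add zspan.diff zspan_scale in_zspan_basis)+
    then have "\<alpha> \<in> ?Z'" "\<gamma> \<in> ?Z'" by (simp_all add: algebra_simps)
    then have "zspan {1, \<alpha>, \<beta>, \<gamma>} \<subseteq> ?Z'"
      by (intro zspan_least additive_subgroup_zspan) (auto intro: in_zspan_basis)
    with 1 have Z': "?Z' = zspan {1, \<alpha>, \<beta>, \<gamma>}" by blast
    have "lin_indep ?\<alpha> \<beta> ?\<gamma>" unfolding lin_indep_def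
    proof (intro allI impI)
      fix q0 q1 q2 q3
      assume "scale q0 1 + scale q1 ?\<alpha> + scale q2 \<beta> + scale q3 ?\<gamma> = 0"
      then have "scale (q0 - q3 * of_int (k * C)) 1 + scale q1 \<alpha>
          + scale (q2 + q1 * of_int k + q3 * of_int (k * v)) \<beta> + scale q3 \<gamma> = 0"
        by (simp add: scale_right_diff_distrib scale_right_distrib scale_left_diff_distrib
            scale_left_distrib algebra_simps)
      with ind have "q0 - q3 * of_int (k * C) = 0 \<and> q1 = 0 \<and> q2 + q1 * of_int k + q3 * of_int (k * v) = 0
          \<and> q3 = 0" unfolding lin_indep_def by blast
      then show "q0 = 0 \<and> q1 = 0 \<and> q2 = 0 \<and> q3 = 0" by auto
    qed
    from maximal_left_coeff_not_dvd[OF _ multiplication_table_shear[OF t] this p] max Z'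
    show ?thesis by simp
  qed
  show ?thesis
  proof (cases "p dvd x")
    case True
    then have "p dvd A * x\<^sup>2 + B * x * y" by (auto simp: power2_eq_square)
    with f have "p dvd C * y\<^sup>2" using dvd_add_right_iff by blast
    then have "p dvd y" using C p(1) by (auto simp: prime_dvd_mult_iff prime_dvd_power_iff)
    with True show ?thesis by simp
  next
    case False
    then have "coprime x p" using p(1) by (metis coprime_commute prime_imp_coprime)
    then obtain r s where rs: "x * r + p * s = 1" by (metis bezout_int coprime_imp_gcd_eq_1 mult.commute)
    \<comment> \<open>\<open>r\<close> inverts \<open>x\<close> modulo \<open>p\<close>, so \<open>(x, y)\<close> is proportional to \<open>(1, k)\<close>\<close>
    define k where "k = r * y"
    have y: "y = x * k + p * (s * y)"
    proof -
      have "y = (x * r + p * s) * y" by (simp add: rs)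
      then show ?thesis by (simp add: k_def algebra_simps)
    qed
    have "A * x\<^sup>2 + B * x * y + C * y\<^sup>2 = x\<^sup>2 * (A + k * B + k\<^sup>2 * C)
      + p * (B * x * (s * y) + C * (2 * x * k * (s * y) + p * (s * y)\<^sup>2))"
    proof -
      define z where "z = s * y"
      have yz: "y = x * k + p * z" using y by (simp add: z_def)
      show ?thesis unfolding z_def[symmetric] unfolding yz
        by (simp add: power2_eq_square algebra_simps)
    qed
    with f have "p dvd x\<^sup>2 * (A + k * B + k\<^sup>2 * C)" by (metis dvd_add_left_iff dvd_triv_left)
    then have False using False A p(1) by (auto simp: prime_dvd_mult_iff prime_dvd_power_iff)
    then show ?thesis ..
  qed
qed

section \<open>Every stable order has a multiplication table\<close>

lemma trace_norm_of_quadratic_equation: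
  assumes ind: "\<And>q r. scale q x + scale r 1 = 0 \<Longrightarrow> q = 0 \<and> r = 0"
    and sq: "x * x = scale s x - scale m 1"
  shows "tr x = s" "nrd x = m"
proof -
  have "scale (tr x - s) x + scale (m - nrd x) 1 = 0"
    using sq cayley_hamilton[of x] by (simp add: scale_left_diff_distrib algebra_simps)
  from ind[OF this] show "tr x = s" "nrd x = m" by auto
qed

text \<open>The polar form is read off from the multiplication table: \<open>n\<gamma> = \<alpha>\<beta>\<close> gives its values at \<open>\<gamma>\<close>, and
  \<open>n(\<gamma> + \<gamma>\<^sup>\<ddagger>) = \<alpha>\<beta> + \<beta>\<alpha>\<close> its value at \<open>\<alpha>\<close> and \<open>\<beta>\<close>.\<close>

lemma multiplication_table_nrd:
  assumes t: "multiplication_table \<alpha> \<beta> \<gamma> n u v A B C" and ind: "lin_indep \<alpha> \<beta> \<gamma>"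
  shows "nrd (scale (of_int y0) 1 + scale (of_int y1) \<alpha> + scale (of_int y2) \<beta> + scale (of_int y3) \<gamma>)
    = of_int (y0\<^sup>2 + n * (A * y1\<^sup>2 + B * y1 * y2 + C * y2\<^sup>2) + A * C * y3\<^sup>2
      + n * u * y0 * y1 + n * v * y0 * y2 + (n * u * v - B) * y0 * y3
      + n * A * v * y1 * y3 + n * u * C * y2 * y3)"
proof -
  have n: "of_int n \<noteq> (0::rat)" and ab: "\<alpha> * \<beta> = scale (of_int n) \<gamma>"
    and aa: "\<alpha> * \<alpha> = scale (of_int (n * u)) \<alpha> - scale (of_int (n * A)) 1"
    and bb: "\<beta> * \<beta> = scale (of_int (n * v)) \<beta> - scale (of_int (n * C)) 1"
    and ddg: "dd \<gamma> = scale (of_int v) \<alpha> + scale (of_int u) \<beta> - scale (of_int B) 1 - \<gamma>"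
    using t unfolding multiplication_table_def by auto
  note pr = multiplication_table_products[OF t]
  have ind1: "q = 0 \<and> r = 0" if "scale q \<alpha> + scale r 1 = 0" for q r
    using ind[unfolded lin_indep_def, rule_format, of r q 0 0] that by (simp add: add.commute)
  have ind2: "q = 0 \<and> r = 0" if "scale q \<beta> + scale r 1 = 0" for q r
    using ind[unfolded lin_indep_def, rule_format, of r 0 q 0] that by (simp add: add.commute)
  have ind3: "q = 0 \<and> r = 0" if "scale q \<gamma> + scale r 1 = 0" for q r
    using ind[unfolded lin_indep_def, rule_format, of r 0 0 q] that by (simp add: add.commute)
  note \<alpha> = trace_norm_of_quadratic_equation[OF ind1 aa] and \<beta> = trace_norm_of_quadratic_equation[OF ind2 bb]
    and \<gamma> = trace_norm_of_quadratic_equation[OF ind3 pr(6)]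
  have "polar \<alpha> \<beta> = of_int (n * B)"
  proof -
    have "scale (of_int n) (\<gamma> + dd \<gamma>) = scale (tr \<alpha>) \<beta> + scale (tr \<beta>) \<alpha> - scale (polar \<alpha> \<beta>) 1"
      using anticommutator[of \<alpha> \<beta>] by (simp add: ab pr(1) scale_right_distrib)
    then have "scale (polar \<alpha> \<beta>) 1 = scale (of_int (n * B)) 1"
      by (simp add: ddg \<alpha> \<beta> scale_right_distrib scale_right_diff_distrib algebra_simps)
    then show ?thesis by (metis coords_scale(1) coords_special(5) mult.right_neutral)
  qed
  moreover have "polar \<alpha> \<gamma> = of_int (n * A * v)"
    using polar_mult_right[of \<alpha> \<beta>] n by (simp add: ab polar_scale_right \<alpha> \<beta>)
  moreover have "polar \<beta> \<gamma> = of_int (n * u * C)"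
    using polar_mult_left[of \<beta> \<alpha>] n by (simp add: ab polar_scale_right \<alpha> \<beta>)
  moreover have "tr (g + h) = tr g + tr h" for g h by (simp add: tr_def)
  moreover have l: "polar (g + h) k = polar g k + polar h k" "polar (scale q g) h = q * polar g h" for g h k q
    by (metis polar_commute polar_add_right, metis polar_commute polar_scale_right)
  ultimately show ?thesis
    by (simp add: nrd_add l polar_scale_right polar_add_right polar_one \<alpha> \<beta> \<gamma> power2_eq_square algebra_simps)
qed

lemma full_triangular_nonzero:
  assumes R: "full R"
    and g: "c2 g1 = 0" "c3 g1 = 0" "c3 g2 = 0"
    and rep: "\<And>x. x \<in> R \<Longrightarrow> \<exists>m1 m2 m3 q. x = of_int m1 * g1 + of_int m2 * g2 + of_int m3 * g3 + scale q 1"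
  shows "c1 g1 \<noteq> 0" "c2 g2 \<noteq> 0" "c3 g3 \<noteq> 0"
proof -
  have ex: "\<exists>m m1 m2 m3 q. m > 0 \<and> scale (of_int m) h =
    scale (of_int m1) g1 + scale (of_int m2) g2 + scale (of_int m3) g3 + scale q 1" for h
  proof -
    obtain m :: int where "m > 0" "scale (of_int m) h \<in> R" using R by (auto simp: full_def)
    with rep show ?thesis unfolding scale_of_int[symmetric] by meson
  qed
  have k: "c3 (i * j) = 1" by (simp add: coords_mult)
  obtain m m1 m2 m3 q where m: "m > (0::int)" "scale (of_int m) (i * j) =
    scale (of_int m1) g1 + scale (of_int m2) g2 + scale (of_int m3) g3 + scale q 1" using ex by meson
  from arg_cong[OF m(2), of c3] m(1) show 3: "c3 g3 \<noteq> 0" by (auto simp: g k)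
  obtain m m1 m2 m3 q where m: "m > (0::int)" and eq: "scale (of_int m) j =
    scale (of_int m1) g1 + scale (of_int m2) g2 + scale (of_int m3) g3 + scale q 1" using ex by meson
  from arg_cong[OF eq, of c3] 3 have "m3 = 0" by (simp add: g)
  with arg_cong[OF eq, of c2] m show 2: "c2 g2 \<noteq> 0" by (auto simp: g)
  obtain m m1 m2 m3 q where m: "m > (0::int)" and eq: "scale (of_int m) i =
    scale (of_int m1) g1 + scale (of_int m2) g2 + scale (of_int m3) g3 + scale q 1" using ex by meson
  from arg_cong[OF eq, of c3] 3 have "m3 = 0" by (simp add: g)
  with arg_cong[OF eq, of c2] 2 have "m2 = 0" by (simp add: g)
  with arg_cong[OF eq, of c1] m \<open>m3 = 0\<close> show "c1 g1 \<noteq> 0" by auto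
qed

text \<open>In a triangular basis \<open>g1, g2, g3\<close> the first two members are symmetric. Integral translates \<open>\<alpha>, \<beta>\<close>
  of them have \<open>\<alpha>\<beta> = n g3 + s\<close> with integers \<open>n, s\<close>. All divisibility by \<open>n\<close> then comes for free: the
  elements \<open>\<alpha>g3\<close>, \<open>\<gamma>\<^sup>\<ddagger>\<close> and \<open>\<gamma>\<beta>\<close> have integral coordinates because they lie in \<open>R\<close>, while the
  Cayley-Hamilton identity computes \<open>n\<close> times these coordinates in terms of \<open>s\<close> and the traces and norms of
  \<open>\<alpha>\<close> and \<open>\<beta>\<close>.\<close>

theorem dd_order_multiplication_table:
  assumes R: "unital_subring R" "bounded_denominators R" "full R" "dd ` R \<subseteq> R"
  obtains \<alpha> \<beta> \<gamma> n u v A B C where "R = zspan {1, \<alpha>, \<beta>, \<gamma>}" "lin_indep \<alpha> \<beta> \<gamma>"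
    "multiplication_table \<alpha> \<beta> \<gamma> n u v A B C"
proof -
  note Ra = unital_subring_additive[OF R(1)]
  have one: "1 \<in> R" and mult: "\<And>x y. x \<in> R \<Longrightarrow> y \<in> R \<Longrightarrow> x * y \<in> R"
    using R(1) by (auto simp: unital_subring_def)
  have sc: "scale (of_int m) x \<in> R" if "x \<in> R" for m x
    unfolding scale_of_int by (rule additive_subgroup_of_int[OF Ra that])
  obtain g1 g2 g3 where g: "g1 \<in> R" "g2 \<in> R" "g3 \<in> R" and tri: "c2 g1 = 0" "c3 g1 = 0" "c3 g2 = 0"
    and rep: "\<And>x. x \<in> R \<Longrightarrow> \<exists>m1 m2 m3 q. x = of_int m1 * g1 + of_int m2 * g2 + of_int m3 * g3 + scale q 1"
    using triangular_generators[OF Ra R(2)] by blast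
  note nz = full_triangular_nonzero[OF R(3) tri rep]
  have rep': "\<exists>m0 m1 m2 m3. x = scale (of_int m0) 1 + scale (of_int m1) g1 + scale (of_int m2) g2 + scale (of_int m3) g3"
    if x: "x \<in> R" for x
  proof -
    obtain m1 m2 m3 q where eq: "x = scale (of_int m1) g1 + scale (of_int m2) g2 + scale (of_int m3) g3 + scale q 1"
      using rep[OF x] unfolding scale_of_int by blast
    then have "scale q 1 = x - scale (of_int m1) g1 - scale (of_int m2) g2 - scale (of_int m3) g3"
      by (simp add: algebra_simps)
    also have "\<dots> \<in> R" by (intro additive_subgroup_diff[OF Ra] sc x g)
    finally have "q \<in> \<int>" by (rule scalar_integral[OF R(1,2)])
    then obtain m0 where "q = of_int m0" by (auto elim: Ints_cases)
    with eq have "x = scale (of_int m0) 1 + scale (of_int m1) g1 + scale (of_int m2) g2 + scale (of_int m3) g3"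
      by (simp add: add_ac)
    then show ?thesis by blast
  qed
  obtain s0 s1 s2 n where n: "g1 * g2 = scale (of_int s0) 1 + scale (of_int s1) g1
      + scale (of_int s2) g2 + scale (of_int n) g3"
    using rep'[OF mult[OF g(1,2)]] by blast
  have n0: "n \<noteq> 0"
    using arg_cong[OF n, of c3] nz by (auto simp: coords_mult tri)
  let ?n = "of_int n :: rat"
  \<comment> \<open>the translates absorb the terms of \<open>g1 * g2\<close> that are linear in \<open>g1\<close> and \<open>g2\<close>\<close>
  define \<alpha> where "\<alpha> = g1 - scale (of_int s2) 1"
  define \<beta> where "\<beta> = g2 - scale (of_int s1) 1"
  define s where "s = s0 + s1 * s2"
  have ab: "\<alpha> * \<beta> = scale ?n g3 + scale (of_int s) 1"
    by (simp add: \<alpha>_def \<beta>_def s_def left_diff_distrib right_diff_distrib scale_mult_left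
        scale_mult_right n scale_left_distrib algebra_simps)
  have mem: "\<alpha> \<in> R" "\<beta> \<in> R"
    unfolding \<alpha>_def \<beta>_def by (intro additive_subgroup_diff[OF Ra] sc g one)+
  have dd: "dd \<alpha> = \<alpha>" "dd \<beta> = \<beta>"
    by (simp_all add: symmetric_iff \<alpha>_def \<beta>_def tri)
  have indep: "lin_indep \<alpha> \<beta> (g3 + scale r 1)" for r
    unfolding lin_indep_def
  proof (intro allI impI)
    fix q0 q1 q2 q3
    assume eq: "scale q0 1 + scale q1 \<alpha> + scale q2 \<beta> + scale q3 (g3 + scale r 1) = 0"
    from arg_cong[OF eq, of c3] nz have q3: "q3 = 0" by (simp add: \<alpha>_def \<beta>_def tri)
    from arg_cong[OF eq, of c2] nz q3 have q2: "q2 = 0" by (simp add: \<alpha>_def \<beta>_def tri)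
    from arg_cong[OF eq, of c1] nz q2 q3 have q1: "q1 = 0" by (simp add: \<alpha>_def \<beta>_def tri)
    from arg_cong[OF eq, of c0] q1 q2 q3 show "q0 = 0 \<and> q1 = 0 \<and> q2 = 0 \<and> q3 = 0" by simp
  qed
  have gen: "R = zspan {1, \<alpha>, \<beta>, g3 + scale (of_int r) 1}" for r
  proof
    let ?Z = "zspan {1, \<alpha>, \<beta>, g3 + scale (of_int r) 1}"
    show "?Z \<subseteq> R"
      by (rule zspan_least[OF Ra]) (auto intro!: one mem g sc additive_subgroup_add[OF Ra])
    have "\<alpha> + scale (of_int s2) 1 \<in> ?Z" "\<beta> + scale (of_int s1) 1 \<in> ?Z"
      "(g3 + scale (of_int r) 1) - scale (of_int r) 1 \<in> ?Z"
      by (intro zspan_closed in_zspan_basis)+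
    then have "g1 \<in> ?Z" "g2 \<in> ?Z" "g3 \<in> ?Z" by (simp_all add: \<alpha>_def \<beta>_def)
    then show "R \<subseteq> ?Z"
      by (auto dest!: rep' intro!: zspan_closed in_zspan_basis)
  qed
  obtain k0 k1 k2 k3 where k: "\<alpha> * g3 = scale (of_int k0) 1 + scale (of_int k1) \<alpha>
      + scale (of_int k2) \<beta> + scale (of_int k3) g3"
    using mult[OF mem(1) g(3)] gen[of 0] zspan_basis_iff[of "\<alpha> * g3" \<alpha> \<beta> g3] by auto
  have "scale ?n (\<alpha> * g3) = \<alpha> * (\<alpha> * \<beta>) - scale (of_int s) \<alpha>"
    by (simp add: ab distrib_left scale_mult_right)
  also have "\<alpha> * (\<alpha> * \<beta>) = scale (tr \<alpha>) (\<alpha> * \<beta>) - scale (nrd \<alpha>) \<beta>"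
    by (subst mult.assoc[symmetric], subst cayley_hamilton) (simp add: left_diff_distrib scale_mult_left)
  finally have "scale (?n * of_int k0) 1 + scale (?n * of_int k1) \<alpha> + scale (?n * of_int k2) \<beta>
      + scale (?n * of_int k3) g3
    = scale (tr \<alpha> * of_int s) 1 + scale (- of_int s) \<alpha> + scale (- nrd \<alpha>) \<beta> + scale (tr \<alpha> * ?n) g3"
    by (simp add: k ab scale_right_distrib algebra_simps)
  from lin_indep_eq[OF indep[of 0, simplified] this]
  have s: "?n * of_int k1 = - of_int s" and k2: "?n * of_int k2 = - nrd \<alpha>" by auto
  \<comment> \<open>\<open>n\<close> divides \<open>s\<close>, so the constant can be moved into the third generator\<close>
  define \<gamma> where "\<gamma> = g3 + scale (of_int (- k1)) 1"
  have \<gamma>: "R = zspan {1, \<alpha>, \<beta>, \<gamma>}" "lin_indep \<alpha> \<beta> \<gamma>"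
    unfolding \<gamma>_def using gen indep by blast+
  then have \<gamma>R: "\<gamma> \<in> R" using in_zspan_basis(4) by blast
  have ab: "\<alpha> * \<beta> = scale ?n \<gamma>"
    using s by (simp add: ab \<gamma>_def scale_right_diff_distrib)
  have ba: "\<beta> * \<alpha> = scale ?n (dd \<gamma>)"
    using dd_mult[of \<alpha> \<beta>] by (simp add: ab dd dd_scale)
  have "dd \<gamma> \<in> R" using R(4) \<gamma>R by auto
  then obtain l0 l1 l2 l3 where l: "dd \<gamma> = scale (of_int l0) 1 + scale (of_int l1) \<alpha>
      + scale (of_int l2) \<beta> + scale (of_int l3) \<gamma>"
    using \<gamma>(1) zspan_basis_iff by blast
  have "scale ?n \<gamma> + scale ?n (dd \<gamma>) = scale (tr \<alpha>) \<beta> + scale (tr \<beta>) \<alpha> - scale (polar \<alpha> \<beta>) 1"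
    using anticommutator[of \<alpha> \<beta>] by (simp add: ab ba)
  then have "scale (?n * of_int l0) 1 + scale (?n * of_int l1) \<alpha> + scale (?n * of_int l2) \<beta>
      + scale (?n + ?n * of_int l3) \<gamma>
    = scale (- polar \<alpha> \<beta>) 1 + scale (tr \<beta>) \<alpha> + scale (tr \<alpha>) \<beta> + scale 0 \<gamma>"
    by (simp add: l scale_right_distrib scale_left_distrib algebra_simps)
  from lin_indep_eq[OF \<gamma>(2) this]
  have tr: "tr \<beta> = ?n * of_int l1" "tr \<alpha> = ?n * of_int l2" and "?n + ?n * of_int l3 = 0"
    by simp_all
  then have "?n * of_int (1 + l3) = 0" by (simp add: distrib_left)
  then have l3: "l3 = - 1" using n0 by (simp only: mult_eq_0_iff of_int_eq_0_iff) simp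
  obtain e0 e1 e2 e3 where e: "\<gamma> * \<beta> = scale (of_int e0) 1 + scale (of_int e1) \<alpha>
      + scale (of_int e2) \<beta> + scale (of_int e3) \<gamma>"
    using mult[OF \<gamma>R mem(2)] \<gamma>(1) zspan_basis_iff by blast
  have "scale ?n (\<gamma> * \<beta>) = \<alpha> * (\<beta> * \<beta>)" by (simp add: mult.assoc[symmetric] ab scale_mult_left)
  also have "\<dots> = scale (tr \<beta>) (\<alpha> * \<beta>) - scale (nrd \<beta>) \<alpha>"
    by (subst cayley_hamilton) (simp add: right_diff_distrib scale_mult_right)
  finally have "scale (?n * of_int e0) 1 + scale (?n * of_int e1) \<alpha> + scale (?n * of_int e2) \<beta>
      + scale (?n * of_int e3) \<gamma>
    = scale 0 1 + scale (- nrd \<beta>) \<alpha> + scale 0 \<beta> + scale (tr \<beta> * ?n) \<gamma>"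
    by (simp add: e ab scale_right_distrib algebra_simps)
  from lin_indep_eq[OF \<gamma>(2) this] have e1: "?n * of_int e1 = - nrd \<beta>" by simp
  have "multiplication_table \<alpha> \<beta> \<gamma> n l2 l1 (- k2) (- l0) (- e1)"
    unfolding multiplication_table_def
  proof (intro conjI n0 dd ab)
    show "\<alpha> * \<alpha> = scale (of_int (n * l2)) \<alpha> - scale (of_int (n * - k2)) 1"
      by (subst cayley_hamilton) (simp add: tr k2)
    show "\<beta> * \<beta> = scale (of_int (n * l1)) \<beta> - scale (of_int (n * - e1)) 1"
      by (subst cayley_hamilton) (simp add: tr e1)
    show "dd \<gamma> = scale (of_int l1) \<alpha> + scale (of_int l2) \<beta> - scale (of_int (- l0)) 1 - \<gamma>"
      by (simp add: l l3 algebra_simps)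
  qed
  with \<gamma> show ?thesis using that by blast
qed

text \<open>The norm of \<open>px\<close> is divisible by \<open>p\<^sup>2\<close>, and since the binary form is anisotropic modulo \<open>p\<close> and \<open>p\<close> divides \<open>n\<close>
  only once, the norm form of the order forces all coordinates of \<open>px\<close> to be divisible by \<open>p\<close>.\<close>

lemma maximal_at_index_prime:
  assumes max: "is_maximal_dd_order scale dd (zspan {1, \<alpha>, \<beta>, \<gamma>})"
    and t: "multiplication_table \<alpha> \<beta> \<gamma> n u v A B C" and ind: "lin_indep \<alpha> \<beta> \<gamma>"
    and p: "prime (p::int)" "p dvd n"
    and x: "scale (of_int p) x \<in> zspan {1, \<alpha>, \<beta>, \<gamma>}" "nrd x \<in> \<int>"
  shows "x \<in> zspan {1, \<alpha>, \<beta>, \<gamma>}"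
proof -
  obtain y0 y1 y2 y3 where y: "scale (of_int p) x = scale (of_int y0) 1 + scale (of_int y1) \<alpha>
      + scale (of_int y2) \<beta> + scale (of_int y3) \<gamma>"
    using x(1) zspan_basis_iff by blast
  obtain N where N: "nrd x = of_int N" using x(2) by (auto elim: Ints_cases)
  have "rat_of_int (p\<^sup>2 * N) = nrd (scale (of_int p) x)" by (simp add: N)
  also note y
  also note multiplication_table_nrd[OF t ind]
  finally have "p\<^sup>2 * N = y0\<^sup>2 + n * (A * y1\<^sup>2 + B * y1 * y2 + C * y2\<^sup>2) + A * C * y3\<^sup>2
      + n * u * y0 * y1 + n * v * y0 * y2 + (n * u * v - B) * y0 * y3
      + n * A * v * y1 * y3 + n * u * C * y2 * y3"
    by (simp only: of_int_eq_iff)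
  then have "p dvd y0 \<and> p dvd y1 \<and> p dvd y2 \<and> p dvd y3"
    using anisotropic_norm_form_mod_prime[OF p maximal_square_not_dvd[OF max t ind p(1)]
        maximal_form_anisotropic[OF max t ind p]] by (metis dvd_triv_left)
  then obtain z0 z1 z2 z3 where "y0 = p * z0" "y1 = p * z1" "y2 = p * z2" "y3 = p * z3"
    by (auto elim!: dvdE)
  with y have "scale (of_int p) x = scale (of_int p) (scale (of_int z0) 1 + scale (of_int z1) \<alpha>
      + scale (of_int z2) \<beta> + scale (of_int z3) \<gamma>)"
    by (simp add: scale_right_distrib)
  then have "x = scale (of_int z0) 1 + scale (of_int z1) \<alpha> + scale (of_int z2) \<beta> + scale (of_int z3) \<gamma>"
    using p(1) by auto
  then show ?thesis using zspan_basis_iff by blast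
qed

text \<open>At a prime that does not divide the index, \<open>R\<close> is locally contained in \<open>T\<close>. The ring \<open>U\<close> of elements
  that are in \<open>R\<close> away from \<open>p\<close> and in \<open>T\<close> at \<open>p\<close> therefore contains \<open>R\<close>, and by maximality equals it.\<close>

lemma maximal_away_from_index:
  assumes max: "is_maximal_dd_order scale dd R"
    and T: "unital_subring T" "dd ` T \<subseteq> T"
    and p: "prime (p::int)" "\<not> p dvd n"
    and n: "\<And>r. r \<in> R \<Longrightarrow> scale (of_int n) r \<in> T"
    and bd: "bounded_denominators T"
    and x: "x \<in> T" "scale (of_int p) x \<in> R"
  shows "x \<in> R"
proof -
  note R = maximal_dd_orderD[OF max]
  note Ra = unital_subring_additive[OF R(1)] and Ta = unital_subring_additive[OF T(1)]
  have scR: "scale (of_int m) y \<in> R" if "y \<in> R" for m y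
    unfolding scale_of_int by (rule additive_subgroup_of_int[OF Ra that])
  have scT: "scale (of_int m) y \<in> T" if "y \<in> T" for m y
    unfolding scale_of_int by (rule additive_subgroup_of_int[OF Ta that])
  \<comment> \<open>the first condition disregards the prime \<open>p\<close>, the second one all other primes\<close>
  define U where "U = {y. (\<exists>k. scale (of_int (p ^ k)) y \<in> R) \<and> (\<exists>m. \<not> p dvd m \<and> scale (of_int m) y \<in> T)}"
  have "U = R"
  proof (rule maximal_dd_order_eqI[OF max])
    show RU: "R \<subseteq> U"
      unfolding U_def using p(2) n by (auto intro!: exI[of _ 0] exI[of _ n])
    show "dd ` U \<subseteq> U"
      unfolding U_def using R(4) T(2) by (auto simp: image_subset_iff) (metis dd_scale)+
    show "unital_subring U"
      unfolding unital_subring_def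
    proof (intro conjI ballI)
      show "1 \<in> U" using RU R(1) by (auto simp: unital_subring_def)
      fix y z assume "y \<in> U" "z \<in> U"
      then obtain k m k' m' where k: "scale (of_int (p ^ k)) y \<in> R" "scale (of_int (p ^ k')) z \<in> R"
        and m: "\<not> p dvd m" "scale (of_int m) y \<in> T" "\<not> p dvd m'" "scale (of_int m') z \<in> T"
        unfolding U_def by blast
      have mm: "\<not> p dvd m * m'" using m p(1) by (simp add: prime_dvd_mult_iff)
      have "scale (of_int (p ^ k')) (scale (of_int (p ^ k)) y) - scale (of_int (p ^ k)) (scale (of_int (p ^ k')) z) \<in> R"
        by (intro additive_subgroup_diff[OF Ra] scR k)
      also have "scale (of_int (p ^ k')) (scale (of_int (p ^ k)) y) - scale (of_int (p ^ k)) (scale (of_int (p ^ k')) z)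
          = scale (of_int (p ^ (k + k'))) (y - z)"
        by (simp add: scale_right_diff_distrib power_add mult.commute)
      finally have 1: "scale (of_int (p ^ (k + k'))) (y - z) \<in> R" .
      have "scale (of_int m') (scale (of_int m) y) - scale (of_int m) (scale (of_int m') z) \<in> T"
        by (intro additive_subgroup_diff[OF Ta] scT m)
      also have "scale (of_int m') (scale (of_int m) y) - scale (of_int m) (scale (of_int m') z)
          = scale (of_int (m * m')) (y - z)"
        by (simp add: scale_right_diff_distrib mult.commute)
      finally show "y - z \<in> U" unfolding U_def using 1 mm by blast
      have "scale (of_int (p ^ k)) y * scale (of_int (p ^ k')) z \<in> R"
        using R(1) k by (simp add: unital_subring_def)
      then have 2: "scale (of_int (p ^ (k + k'))) (y * z) \<in> R"
        by (simp add: scale_mult_left scale_mult_right power_add mult.commute)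
      have "scale (of_int m) y * scale (of_int m') z \<in> T"
        using T(1) m by (simp add: unital_subring_def)
      then have "scale (of_int (m * m')) (y * z) \<in> T"
        by (simp add: scale_mult_left scale_mult_right mult.commute)
      with 2 mm show "y * z \<in> U" unfolding U_def by blast
    qed
    have "bounded_denominators (R \<union> T)" by (rule bounded_denominators_Un[OF R(2) bd])
    then obtain D :: int where D: "D > 0" "\<And>y. y \<in> R \<union> T \<Longrightarrow> scale (of_int D) y \<in> integral_coords"
      unfolding bounded_denominators_def by blast
    have "scale (of_int D) y \<in> integral_coords" if yU: "y \<in> U" for y
    proof -
      obtain k m where k: "scale (of_int (p ^ k)) y \<in> R" and m: "\<not> p dvd m" "scale (of_int m) y \<in> T"
        using yU unfolding U_def by blast
      have "coprime (p ^ k) m" using m(1) p(1) by (simp add: prime_imp_coprime)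
      then obtain r s where rs: "r * p ^ k + s * m = 1" by (metis bezout_int coprime_imp_gcd_eq_1)
      have "scale (of_int D) y = scale (of_int D * of_int (r * p ^ k + s * m)) y" by (simp add: rs)
      also have "\<dots> = scale (of_int r) (scale (of_int D) (scale (of_int (p ^ k)) y))
          + scale (of_int s) (scale (of_int D) (scale (of_int m) y))"
        by (simp add: scale_left_distrib algebra_simps)
      also have "\<dots> \<in> integral_coords"
        using integral_coords_scale[OF D(2), of "scale (of_int (p ^ k)) y" r]
          integral_coords_scale[OF D(2), of "scale (of_int m) y" s] k m
        by (simp add: integral_coords_def)
      finally show ?thesis .
    qed
    then show "bounded_denominators U" using D(1) unfolding bounded_denominators_def by blast
  qed
  moreover have "x \<in> U"
    unfolding U_def using x p(1) by (auto intro!: exI[of _ 1])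
  ultimately show ?thesis by simp
qed

text \<open>An element of \<open>T\<close> has an integral multiple in \<open>R\<close>; the prime factors of the multiplier are removed
  one by one, with different reasons according to whether they divide \<open>n\<close>.\<close>

theorem maximal_dd_order_contains:
  assumes max: "is_maximal_dd_order scale dd R"
    and T: "unital_subring T" "bounded_denominators T" "dd ` T \<subseteq> T"
    and sym: "\<And>r. r \<in> R \<Longrightarrow> dd r = r \<Longrightarrow> r \<in> T"
  shows "T \<subseteq> R"
proof
  note R = maximal_dd_orderD[OF max]
  note Ra = unital_subring_additive[OF R(1)] and Ta = unital_subring_additive[OF T(1)]
  have scT: "scale (of_int m) y \<in> T" if "y \<in> T" for m y
    unfolding scale_of_int by (rule additive_subgroup_of_int[OF Ta that])
  obtain \<alpha> \<beta> \<gamma> n u v A B C where gen: "R = zspan {1, \<alpha>, \<beta>, \<gamma>}" and ind: "lin_indep \<alpha> \<beta> \<gamma>"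
    and t: "multiplication_table \<alpha> \<beta> \<gamma> n u v A B C"
    by (rule dd_order_multiplication_table[OF R])
  have ab: "\<alpha> \<in> T" "\<beta> \<in> T" "1 \<in> T" and abg: "scale (of_int n) \<gamma> = \<alpha> * \<beta>"
    using t gen T(1) by (auto simp: multiplication_table_def unital_subring_def intro: sym in_zspan_basis)
  then have g: "scale (of_int n) \<gamma> \<in> T" using T(1) by (simp add: unital_subring_def)
  have nT: "scale (of_int n) r \<in> T" if r: "r \<in> R" for r
  proof -
    obtain m0 m1 m2 m3 where "r = scale (of_int m0) 1 + scale (of_int m1) \<alpha> + scale (of_int m2) \<beta> + scale (of_int m3) \<gamma>"
      using r gen zspan_basis_iff by blast
    then have "scale (of_int n) r = scale (of_int (n * m0)) 1 + scale (of_int (n * m1)) \<alpha>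
        + scale (of_int (n * m2)) \<beta> + scale (of_int m3) (scale (of_int n) \<gamma>)"
      by (simp add: scale_right_distrib mult.commute)
    also have "\<dots> \<in> T" by (intro additive_subgroup_add[OF Ta] scT ab g)
    finally show ?thesis .
  qed
  have prime_step: "x \<in> R" if x: "x \<in> T" "scale (of_int p) x \<in> R" and p: "prime (p::int)" for x p
  proof (cases "p dvd n")
    case True
    show ?thesis unfolding gen
      by (rule maximal_at_index_prime[OF max[unfolded gen] t ind p True x(2)[unfolded gen]
            nrd_integral[OF T(1,2) x(1)]])
  next
    case False
    show ?thesis by (rule maximal_away_from_index[OF max T(1,3) p False nT T(2) x])
  qed
  have ind_step: "\<forall>x. x \<in> T \<longrightarrow> scale (of_int (int m)) x \<in> R \<longrightarrow> m > 0 \<longrightarrow> x \<in> R" for m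
  proof (induction m rule: less_induct)
    case (less m)
    show ?case
    proof (intro allI impI)
      fix x assume x: "x \<in> T" "scale (of_int (int m)) x \<in> R" "m > 0"
      show "x \<in> R"
      proof (cases "m = 1")
        case True then show ?thesis using x by simp
      next
        case False
        then obtain p where p: "prime p" "p dvd m" using prime_factor_nat by blast
        then obtain k where k: "m = p * k" by (elim dvdE)
        have k0: "k > 0" "k < m" using x(3) p(1) prime_gt_1_nat[OF p(1)] by (auto simp: k)
        have "scale (of_int (int p)) (scale (of_int (int k)) x) \<in> R"
          using x(2) by (simp add: k)
        moreover have "scale (of_int (int k)) x \<in> T" by (rule scT[OF x(1)])
        ultimately have "scale (of_int (int k)) x \<in> R"
          using p(1) prime_step[of "scale (of_int (int k)) x" "int p"] by simp
        then show ?thesis by (rule less.IH[OF k0(2), rule_format, OF x(1) _ k0(1)])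
      qed
    qed
  qed
  fix x assume x: "x \<in> T"
  obtain m :: int where "m > 0" "scale (of_int m) x \<in> R" using R(3) by (auto simp: full_def)
  then have "scale (of_int (int (nat m))) x \<in> R" "nat m > 0" by simp_all
  then show "x \<in> R" by (rule ind_step[rule_format, OF x])
qed

end

section \<open>Two by two matrices and the symplectic description of the group\<close>

definition mat2 :: "'a \<Rightarrow> 'a \<Rightarrow> 'a \<Rightarrow> 'a \<Rightarrow> 'a mat" where
  "mat2 a b c d = mat 2 2 (\<lambda>(k, l). if k = 0 then if l = 0 then a else b else if l = 0 then c else d)"

lemma less_two_cases: "(k::nat) < 2 \<longleftrightarrow> k = 0 \<or> k = 1" by auto

lemma mat2_index [simp]:
  "mat2 a b c d $$ (0, 0) = a" "mat2 a b c d $$ (0, Suc 0) = b"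
  "mat2 a b c d $$ (Suc 0, 0) = c" "mat2 a b c d $$ (Suc 0, Suc 0) = d"
  and mat2_carrier [simp]: "mat2 a b c d \<in> carrier_mat 2 2"
  and mat2_dim [simp]: "dim_row (mat2 a b c d) = 2" "dim_col (mat2 a b c d) = 2"
  by (simp_all add: mat2_def)

lemma mat2_eta: "M \<in> carrier_mat 2 2 \<Longrightarrow> mat2 (M $$ (0,0)) (M $$ (0,1)) (M $$ (1,0)) (M $$ (1,1)) = M"
  by (rule eq_matI) (auto simp: less_two_cases)

lemma mat2_cases:
  assumes "M \<in> carrier_mat 2 2" obtains a b c d where "M = mat2 a b c d"
  using mat2_eta[OF assms] by metis

lemma mat2_eq_iff: "mat2 a b c d = mat2 a' b' c' d' \<longleftrightarrow> a = a' \<and> b = b' \<and> c = c' \<and> d = d'"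
  by (metis mat2_index)

lemma times_mat2_index:
  fixes M N :: "'a::semiring_0 mat"
  assumes "M \<in> carrier_mat 2 2" "N \<in> carrier_mat 2 2" "k < 2" "l < 2"
  shows "(M * N) $$ (k, l) = M $$ (k, 0) * N $$ (0, l) + M $$ (k, 1) * N $$ (1, l)"
proof -
  have "(M * N) $$ (k, l) = (\<Sum>r = 0..<2. M $$ (k, r) * N $$ (r, l))"
    using assms by (auto simp: scalar_prod_def intro!: sum.cong)
  then show ?thesis by (simp add: numeral_2_eq_2)
qed

lemma mat2_mult:
  fixes a :: "'a::semiring_0"
  shows "mat2 a b c d * mat2 a' b' c' d'
    = mat2 (a * a' + b * c') (a * b' + b * d') (c * a' + d * c') (c * b' + d * d')"
proof (rule eq_matI)
  fix k l assume "k < dim_row (mat2 (a * a' + b * c') (a * b' + b * d') (c * a' + d * c') (c * b' + d * d'))"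
    "l < dim_col (mat2 (a * a' + b * c') (a * b' + b * d') (c * a' + d * c') (c * b' + d * d'))"
  then have kl: "k < 2" "l < 2" by simp_all
  then show "(mat2 a b c d * mat2 a' b' c' d') $$ (k, l) =
    mat2 (a * a' + b * c') (a * b' + b * d') (c * a' + d * c') (c * b' + d * d') $$ (k, l)"
    using times_mat2_index[OF mat2_carrier mat2_carrier kl, of a b c d a' b' c' d']
    by (auto simp: less_two_cases)
qed simp_all

lemma one_mat2: "1\<^sub>m 2 = mat2 1 0 0 (1::'a::semiring_1)"
  by (rule eq_matI) (auto simp: less_two_cases)

context symmetric_quaternion
begin

definition conj_transpose :: "'h mat \<Rightarrow> 'h mat" where
  "conj_transpose M = mat2 (dd (M $$ (0,0))) (dd (M $$ (1,0))) (dd (M $$ (0,1))) (dd (M $$ (1,1)))"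

definition symplectic_form :: "'h mat" where "symplectic_form = mat2 0 1 (-1) 0"

lemma conj_transpose_mat2: "conj_transpose (mat2 w x y z) = mat2 (dd w) (dd y) (dd x) (dd z)"
  by (simp add: conj_transpose_def)

lemma conj_transpose_mult:
  assumes "M \<in> carrier_mat 2 2" "N \<in> carrier_mat 2 2"
  shows "conj_transpose (M * N) = conj_transpose N * conj_transpose M"
  by (cases rule: mat2_cases[OF assms(1)]; cases rule: mat2_cases[OF assms(2)])
    (simp add: conj_transpose_mat2 mat2_mult dd_simps)

lemma conj_transpose_carrier [simp]: "conj_transpose M \<in> carrier_mat 2 2"
  and symplectic_form_carrier [simp]: "symplectic_form \<in> carrier_mat 2 2"
  by (simp_all add: conj_transpose_def symplectic_form_def)

lemma mat2_in_SL_dd_iff: "mat2 w x y z \<in> carrier (SL_dd dd) \<longleftrightarrow>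
    x * dd w = w * dd x \<and> z * dd y = y * dd z \<and> w * dd z - x * dd y = 1"
  by (simp add: SL_dd_def H_plus_def dd_mult)

text \<open>The three defining equations are the entries of one matrix equation, the invariance of a
  skew-hermitian form. Closure under products is immediate in this description.\<close>

lemma SL_dd_iff: "M \<in> carrier (SL_dd dd) \<longleftrightarrow> M \<in> carrier_mat 2 2 \<and> M * symplectic_form * conj_transpose M = symplectic_form"
proof (cases "M \<in> carrier_mat 2 2")
  case True
  then obtain w x y z where M: "M = mat2 w x y z" by (rule mat2_cases)
  have "y * dd x - z * dd w = - dd (w * dd z - x * dd y)" by (simp add: dd_simps)
  then have "w * dd z - x * dd y = 1 \<Longrightarrow> y * dd x - z * dd w = - 1" by simp
  then show ?thesis
    unfolding M mat2_in_SL_dd_iff by (auto simp: symplectic_form_def conj_transpose_mat2 mat2_mult mat2_eq_iff)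
next
  case False
  then show ?thesis by (simp add: SL_dd_def)
qed

lemma SL_dd_carrier: "M \<in> carrier (SL_dd dd) \<Longrightarrow> M \<in> carrier_mat 2 2"
  by (simp add: SL_dd_def)

lemma SL_dd_mult: "x \<otimes>\<^bsub>SL_dd dd\<^esub> y = x * y" and SL_dd_one: "\<one>\<^bsub>SL_dd dd\<^esub> = 1\<^sub>m 2"
  by (simp_all add: SL_dd_def)

lemma SL_dd_mult_closed:
  assumes "M \<in> carrier (SL_dd dd)" "N \<in> carrier (SL_dd dd)"
  shows "M * N \<in> carrier (SL_dd dd)"
proof -
  have M: "M \<in> carrier_mat 2 2" "M * symplectic_form * conj_transpose M = symplectic_form"
    and N: "N \<in> carrier_mat 2 2" "N * symplectic_form * conj_transpose N = symplectic_form" using assms by (auto simp: SL_dd_iff)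
  have "(M * N) * symplectic_form * conj_transpose (M * N) = M * (N * symplectic_form * conj_transpose N) * conj_transpose M"
    using M(1) N(1) by (simp add: conj_transpose_mult assoc_mult_mat[of _ 2 2 _ 2 _ 2] mult_carrier_mat[of _ 2 2 _ 2])
  then show ?thesis using M N by (simp add: SL_dd_iff)
qed

definition SL_inverse :: "'h mat \<Rightarrow> 'h mat" where
  "SL_inverse M = mat2 (dd (M $$ (1,1))) (- dd (M $$ (0,1))) (- dd (M $$ (1,0))) (dd (M $$ (0,0)))"

lemma SL_inverse_carrier [simp]: "SL_inverse M \<in> carrier_mat 2 2"
  by (simp add: SL_inverse_def)

lemma SL_inverse_right:
  assumes "M \<in> carrier (SL_dd dd)" shows "M * SL_inverse M = 1\<^sub>m 2"
proof -
  obtain w x y z where M: "M = mat2 w x y z" using SL_dd_carrier[OF assms] by (rule mat2_cases)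
  note e = assms[unfolded M mat2_in_SL_dd_iff]
  then have "dd (w * dd z - x * dd y) = 1" by simp
  then have "z * dd w - y * dd x = 1" by (simp add: dd_simps)
  then show ?thesis using e by (simp add: M SL_inverse_def mat2_mult one_mat2 mat2_eq_iff)
qed

end

text \<open>An order together with the coordinate functions \<open>\<kappa>\<close> of a \<open>\<int>\<close>-basis \<open>e\<close>. The first basis vector is \<open>1\<close>, so that
  the entries of a matrix can be recovered from its action.\<close>

locale order_coordinates = symmetric_quaternion scale a b i j dd
  for scale :: "rat \<Rightarrow> 'h::ring_1 \<Rightarrow> 'h" and a b i j dd +
  fixes R :: "'h set" and e :: "nat \<Rightarrow> 'h" and \<kappa> :: "nat \<Rightarrow> 'h \<Rightarrow> rat"
  assumes subring: "unital_subring R" and dd_closed: "dd ` R \<subseteq> R" and bounded: "bounded_denominators R"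
    and \<kappa>_linear: "s < 4 \<Longrightarrow> Vector_Spaces.linear scale (*) (\<kappa> s)"
    and expand: "(\<Sum>s<4. scale (\<kappa> s x) (e s)) = x"
    and \<kappa>_e: "s < 4 \<Longrightarrow> t < 4 \<Longrightarrow> \<kappa> s (e t) = (if s = t then 1 else 0)"
    and e_zero: "e 0 = 1"
    and mem_iff: "x \<in> R \<longleftrightarrow> (\<forall>s<4. \<kappa> s x \<in> \<int>)"

lemma (in symmetric_quaternion) dd_order_coordinates:
  assumes R: "unital_subring R" "bounded_denominators R" "full R" "dd ` R \<subseteq> R"
  shows "\<exists>e \<kappa>. order_coordinates scale a b i j dd R e \<kappa>"
proof -
  obtain \<alpha> \<beta> \<gamma> where gen: "R = zspan {1, \<alpha>, \<beta>, \<gamma>}" and ind: "lin_indep \<alpha> \<beta> \<gamma>"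
    using dd_order_multiplication_table[OF R] by blast
  define comb where "comb q = scale (q 0) 1 + scale (q 1) \<alpha> + scale (q 2) \<beta> + scale (q 3) \<gamma>" for q :: "nat \<Rightarrow> rat"
  have eqD: "q s = r s" if "comb q = comb r" "s < 4" for q r s
  proof -
    have "s = 0 \<or> s = 1 \<or> s = 2 \<or> s = 3" using \<open>s < 4\<close> by linarith
    then show ?thesis using lin_indep_eq[OF ind that(1)[unfolded comb_def]] by auto
  qed
  have "\<exists>q. comb q = x" for x
  proof -
    obtain m :: int where m: "m > 0" "scale (of_int m) x \<in> R" using R(3) by (auto simp: full_def)
    then obtain m0 m1 m2 m3 where eq: "scale (of_int m) x =
        scale (of_int m0) 1 + scale (of_int m1) \<alpha> + scale (of_int m2) \<beta> + scale (of_int m3) \<gamma>"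
      using gen zspan_basis_iff by blast
    have "x = scale (1 / of_int m) (scale (of_int m) x)" using m(1) by simp
    also have "\<dots> = comb (\<lambda>s. (if s = 0 then of_int m0 else if s = 1 then of_int m1 else if s = 2 then
       of_int m2 else of_int m3) / of_int m)"
      unfolding eq comb_def by (simp add: scale_right_distrib)
    finally show ?thesis by - (rule exI, erule sym)
  qed
  then obtain f where f: "\<And>x. comb (f x) = x" by metis
  define \<kappa> where "\<kappa> s x = f x s" for s x
  define e where "e s = (if s = 0 then 1 else if s = 1 then \<alpha> else if s = 2 then \<beta> else \<gamma>)" for s :: nat
  have \<kappa>_comb: "\<kappa> s (comb q) = q s" if "s < 4" for s q
    unfolding \<kappa>_def by (rule eqD[OF _ that]) (rule f)
  have sum4: "(\<Sum>s<4. g s) = g 0 + g 1 + g 2 + g 3" for g :: "nat \<Rightarrow> 'h"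
    by (simp add: eval_nat_numeral)
  have all4: "(\<forall>s<4. P s) \<longleftrightarrow> P 0 \<and> P 1 \<and> P 2 \<and> P (3::nat)" for P
    by (simp add: eval_nat_numeral All_less_Suc) blast
  have "order_coordinates scale a b i j dd R e \<kappa>"
  proof (rule order_coordinates.intro[OF symmetric_quaternion_axioms], rule order_coordinates_axioms.intro)
    show "unital_subring R" "dd ` R \<subseteq> R" "bounded_denominators R" by (rule R)+
    show "Vector_Spaces.linear scale (*) (\<kappa> s)" if s: "s < 4" for s
      unfolding Vector_Spaces.linear_iff
    proof (intro conjI allI)
      show "vector_space scale" by unfold_locales
      show "vector_space ((*) :: rat \<Rightarrow> rat \<Rightarrow> rat)" by unfold_locales (auto simp: algebra_simps)
      fix x y q
      have "x + y = comb (\<lambda>s. f x s + f y s)"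
        by (subst (1 2) f[symmetric]) (simp add: comb_def scale_left_distrib)
      then show "\<kappa> s (x + y) = \<kappa> s x + \<kappa> s y" using \<kappa>_comb[OF s] by (simp add: \<kappa>_def)
      have "scale q x = comb (\<lambda>s. q * f x s)"
        by (subst f[symmetric]) (simp add: comb_def scale_right_distrib)
      then show "\<kappa> s (scale q x) = q * \<kappa> s x" using \<kappa>_comb[OF s] by (simp add: \<kappa>_def)
    qed
    show "(\<Sum>s<4. scale (\<kappa> s x) (e s)) = x" for x
      unfolding sum4 using f[of x] by (simp add: comb_def \<kappa>_def e_def)
    show "\<kappa> s (e t) = (if s = t then 1 else 0)" if "s < 4" "t < 4" for s t
    proof -
      have "\<forall>t<4. e t = comb (\<lambda>s. if s = t then 1 else 0)"
        unfolding all4 by (simp add: e_def comb_def)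
      then show ?thesis using \<kappa>_comb[OF that(1)] that(2) by simp
    qed
    show "e 0 = 1" by (simp add: e_def)
    show "x \<in> R \<longleftrightarrow> (\<forall>s<4. \<kappa> s x \<in> \<int>)" for x
    proof
      assume "x \<in> R"
      then obtain m0 m1 m2 m3 where
        "x = scale (of_int m0) 1 + scale (of_int m1) \<alpha> + scale (of_int m2) \<beta> + scale (of_int m3) \<gamma>"
        using gen zspan_basis_iff by blast
      then have "x = comb (\<lambda>s. of_int (if s = 0 then m0 else if s = 1 then m1 else if s = 2 then m2 else m3))"
        by (simp add: comb_def)
      then show "\<forall>s<4. \<kappa> s x \<in> \<int>" using \<kappa>_comb by simp
    next
      assume "\<forall>s<4. \<kappa> s x \<in> \<int>"
      then have "f x 0 \<in> \<int>" "f x 1 \<in> \<int>" "f x 2 \<in> \<int>" "f x 3 \<in> \<int>" by (auto simp: \<kappa>_def all4)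
      then obtain m0 m1 m2 m3 where "f x 0 = of_int m0" "f x 1 = of_int m1" "f x 2 = of_int m2"
        "f x 3 = of_int m3" by (auto elim!: Ints_cases)
      then have "x = scale (of_int m0) 1 + scale (of_int m1) \<alpha> + scale (of_int m2) \<beta> + scale (of_int m3) \<gamma>"
        using f[of x] by (simp add: comb_def)
      then show "x \<in> R" unfolding gen zspan_basis_iff by blast
    qed
  qed
  then show ?thesis by blast
qed

context order_coordinates
begin

lemma \<kappa>_add: "s < 4 \<Longrightarrow> \<kappa> s (x + y) = \<kappa> s x + \<kappa> s y"
  and \<kappa>_scale: "s < 4 \<Longrightarrow> \<kappa> s (scale q x) = q * \<kappa> s x"
  using \<kappa>_linear unfolding Vector_Spaces.linear_iff by auto

lemma \<kappa>_zero: "s < 4 \<Longrightarrow> \<kappa> s 0 = 0"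
  using \<kappa>_scale[of s 0 0] by simp

lemma \<kappa>_sum: "s < 4 \<Longrightarrow> \<kappa> s (sum f A) = (\<Sum>x\<in>A. \<kappa> s (f x))"
  by (induction A rule: infinite_finite_induct) (simp_all add: \<kappa>_zero \<kappa>_add)

text \<open>The action on column vectors of length 2 over the algebra, in the basis that consists of two copies
  of \<open>e\<close>.\<close>

definition rep :: "'h mat \<Rightarrow> rat mat" where
  "rep M = mat 8 8 (\<lambda>(r, c). \<kappa> (r mod 4) (M $$ (r div 4, c div 4) * e (c mod 4)))"

lemma rep_carrier [simp]: "rep M \<in> carrier_mat 8 8"
  by (simp add: rep_def)

lemma rep_dim [simp]: "dim_row (rep M) = 8" "dim_col (rep M) = 8"
  by (simp_all add: rep_def)

lemma rep_mult:
  assumes M: "M \<in> carrier_mat 2 2" and N: "N \<in> carrier_mat 2 2"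
  shows "rep (M * N) = rep M * rep N"
proof (rule eq_matI)
  fix r c assume "r < dim_row (rep M * rep N)" "c < dim_col (rep M * rep N)"
  then have rc: "r < 8" "c < 8" by simp_all
  then have d: "r div 4 < 2" "c div 4 < 2" "r mod 4 < 4" "c mod 4 < 4" by auto
  let ?k = "r div 4" and ?s = "r mod 4" and ?l = "c div 4" and ?t = "c mod 4"
  have block: "(\<Sum>t<4. \<kappa> ?s (x * e t) * \<kappa> t y) = \<kappa> ?s (x * y)" for x y
  proof -
    have "x * y = (\<Sum>t<4. scale (\<kappa> t y) (x * e t))"
      by (subst (1) expand[symmetric, of y]) (simp add: sum_distrib_left scale_mult_right)
    then show ?thesis by (simp add: \<kappa>_sum \<kappa>_scale d mult.commute)
  qed
  have sum8: "(\<Sum>t = 0..<8. g t) = (\<Sum>t<4. g t) + (\<Sum>t<4. g (4 + t))" for g :: "nat \<Rightarrow> rat"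
    by (simp add: eval_nat_numeral add_ac)
  have "(rep M * rep N) $$ (r, c) = (\<Sum>t = 0..<8. rep M $$ (r, t) * rep N $$ (t, c))"
    using rc by (auto simp: scalar_prod_def intro!: sum.cong)
  also have "\<dots> = (\<Sum>t<4. \<kappa> ?s (M $$ (?k, 0) * e t) * \<kappa> t (N $$ (0, ?l) * e ?t))
    + (\<Sum>t<4. \<kappa> ?s (M $$ (?k, 1) * e t) * \<kappa> t (N $$ (1, ?l) * e ?t))"
    unfolding sum8 using rc by (intro arg_cong2[of _ _ _ _ "(+)"] sum.cong) (auto simp: rep_def)
  also have "\<dots> = \<kappa> ?s ((M * N) $$ (?k, ?l) * e ?t)"
    unfolding block times_mat2_index[OF M N d(1,2)]
    by (simp add: \<kappa>_add d distrib_right mult.assoc)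
  also have "\<dots> = rep (M * N) $$ (r, c)" using rc by (simp add: rep_def)
  finally show "rep (M * N) $$ (r, c) = (rep M * rep N) $$ (r, c)" by simp
qed simp_all

lemma rep_one: "rep (1\<^sub>m 2) = 1\<^sub>m 8"
proof (rule eq_matI)
  fix r c :: nat assume "r < dim_row (1\<^sub>m 8 :: rat mat)" "c < dim_col (1\<^sub>m 8 :: rat mat)"
  then have rc: "r < 8" "c < 8" by simp_all
  then have d: "r div 4 < 2" "c div 4 < 2" "r mod 4 < 4" "c mod 4 < 4" by auto
  have "r = c \<longleftrightarrow> r div 4 = c div 4 \<and> r mod 4 = c mod 4" by (metis div_mod_decomp)
  then show "rep (1\<^sub>m 2) $$ (r, c) = 1\<^sub>m 8 $$ (r, c)"
    using rc d by (auto simp: rep_def \<kappa>_e \<kappa>_zero)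
qed simp_all

lemma \<kappa>_entry:
  assumes "k < 2" "l < 2" "s < 4"
  shows "\<kappa> s (M $$ (k, l)) = rep M $$ (4 * k + s, 4 * l)"
  using assms by (simp add: rep_def e_zero)

lemma rep_inj:
  assumes "M \<in> carrier_mat 2 2" "N \<in> carrier_mat 2 2" "rep M = rep N"
  shows "M = N"
proof (rule eq_matI)
  fix k l assume "k < dim_row N" "l < dim_col N"
  then have kl: "k < 2" "l < 2" using assms by auto
  have "(\<Sum>s<4. scale (\<kappa> s (M $$ (k, l))) (e s)) = (\<Sum>s<4. scale (\<kappa> s (N $$ (k, l))) (e s))"
    using kl assms(3) by (intro sum.cong) (simp_all add: \<kappa>_entry)
  then show "M $$ (k, l) = N $$ (k, l)" by (simp add: expand)
qed (use assms in auto)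

text \<open>A one-sided inverse over a noncommutative ring is two-sided here because the algebra is finite
  dimensional: the statement is transported to rational 8 by 8 matrices.\<close>

lemma SL_inverse_left:
  assumes "M \<in> carrier (SL_dd dd)" shows "SL_inverse M * M = 1\<^sub>m 2"
proof -
  have M: "M \<in> carrier_mat 2 2" by (rule SL_dd_carrier[OF assms])
  have "rep M * rep (SL_inverse M) = 1\<^sub>m 8"
    using SL_inverse_right[OF assms] rep_mult[OF M SL_inverse_carrier] rep_one by metis
  then have "rep (SL_inverse M) * rep M = 1\<^sub>m 8"
    by (rule mat_mult_left_right_inverse[OF rep_carrier rep_carrier])
  then have "rep (SL_inverse M * M) = rep (1\<^sub>m 2)"
    using rep_mult[OF SL_inverse_carrier M] rep_one by metis
  moreover have "SL_inverse M * M \<in> carrier_mat 2 2" using mult_carrier_mat[OF SL_inverse_carrier M] .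
  ultimately show ?thesis by (intro rep_inj) auto
qed

lemma SL_inverse_closed:
  assumes "M \<in> carrier (SL_dd dd)" shows "SL_inverse M \<in> carrier (SL_dd dd)"
proof -
  have M: "M \<in> carrier_mat 2 2" and eq: "M * symplectic_form * conj_transpose M = symplectic_form" using assms by (auto simp: SL_dd_iff)
  let ?I = "SL_inverse M"
  have IM: "?I * M = 1\<^sub>m 2" by (rule SL_inverse_left[OF assms])
  have "conj_transpose (?I * M) = 1\<^sub>m 2" by (simp add: IM one_mat2 conj_transpose_mat2)
  then have IM': "conj_transpose M * conj_transpose ?I = 1\<^sub>m 2"
    using conj_transpose_mult[OF SL_inverse_carrier M] by simp
  have "?I * symplectic_form * conj_transpose ?I = ?I * (M * symplectic_form * conj_transpose M) * conj_transpose ?I" by (simp add: eq)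
  also have "\<dots> = (?I * M) * symplectic_form * (conj_transpose M * conj_transpose ?I)"
    using M by (simp add: assoc_mult_mat[of _ 2 2 _ 2 _ 2] mult_carrier_mat[of _ 2 2 _ 2])
  also have "\<dots> = symplectic_form" by (simp add: IM IM' left_mult_one_mat[OF symplectic_form_carrier] right_mult_one_mat[OF symplectic_form_carrier])
  finally show ?thesis by (simp add: SL_dd_iff)
qed

lemma group_SL_dd: "group (SL_dd dd)"
proof (rule groupI)
  show "\<one>\<^bsub>SL_dd dd\<^esub> \<in> carrier (SL_dd dd)" by (simp add: SL_dd_one one_mat2 mat2_in_SL_dd_iff)
next
  fix x y z assume "x \<in> carrier (SL_dd dd)" "y \<in> carrier (SL_dd dd)" "z \<in> carrier (SL_dd dd)"
  then show "x \<otimes>\<^bsub>SL_dd dd\<^esub> y \<otimes>\<^bsub>SL_dd dd\<^esub> z = x \<otimes>\<^bsub>SL_dd dd\<^esub> (y \<otimes>\<^bsub>SL_dd dd\<^esub> z)"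
    by (auto simp: SL_dd_mult dest!: SL_dd_carrier)
next
  fix x assume x: "x \<in> carrier (SL_dd dd)"
  then show "\<one>\<^bsub>SL_dd dd\<^esub> \<otimes>\<^bsub>SL_dd dd\<^esub> x = x" by (auto simp: SL_dd_mult SL_dd_one dest!: SL_dd_carrier)
  show "\<exists>y\<in>carrier (SL_dd dd). y \<otimes>\<^bsub>SL_dd dd\<^esub> x = \<one>\<^bsub>SL_dd dd\<^esub>"
    using SL_inverse_left[OF x] SL_inverse_closed[OF x] by (auto simp: SL_dd_mult SL_dd_one)
qed (auto simp: SL_dd_mult SL_dd_mult_closed)

lemma SL_dd_inv: "M \<in> carrier (SL_dd dd) \<Longrightarrow> inv\<^bsub>SL_dd dd\<^esub> M = SL_inverse M"
  by (rule group.inv_equality[OF group_SL_dd])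
    (simp_all add: SL_dd_mult SL_dd_one SL_inverse_left SL_inverse_closed)

end

section \<open>Integral points and common denominators\<close>

lemma carrier_GL_iff: "A \<in> carrier (GL ty n) \<longleftrightarrow>
    A \<in> carrier_mat n n \<and> (\<exists>B\<in>carrier_mat n n. B * A = 1\<^sub>m n \<and> A * B = 1\<^sub>m n)"
  by (auto simp: GL_def units_of_carrier Units_def ring_mat_simps)

lemma GL_mult: "A \<otimes>\<^bsub>GL ty n\<^esub> B = A * B"
  by (simp add: GL_def units_of_mult ring_mat_simps)

lemma integral_mat_cases:
  fixes A :: "rat mat"
  assumes "A \<in> carrier_mat n m" "\<And>r c. r < n \<Longrightarrow> c < m \<Longrightarrow> A $$ (r, c) \<in> \<int>"
  obtains B where "B \<in> carrier_mat n m" "A = map_mat rat_of_int B"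
proof -
  have "A = map_mat rat_of_int (map_mat floor A)"
    using assms by (intro eq_matI) auto
  moreover have "map_mat floor A \<in> carrier_mat n m" using assms(1) by simp
  ultimately show ?thesis using that by blast
qed

lemma GL_integralI:
  assumes A: "A \<in> carrier_mat n n" "\<And>r c. r < n \<Longrightarrow> c < n \<Longrightarrow> A $$ (r, c) \<in> \<int>"
    and B: "B \<in> carrier_mat n n" "\<And>r c. r < n \<Longrightarrow> c < n \<Longrightarrow> B $$ (r, c) \<in> \<int>"
    and AB: "A * B = 1\<^sub>m n" "B * A = 1\<^sub>m n"
  shows "A \<in> GL_integral n"
proof -
  obtain A' where A': "A' \<in> carrier_mat n n" "A = map_mat rat_of_int A'"
    using A by (rule integral_mat_cases)
  obtain B' where B': "B' \<in> carrier_mat n n" "B = map_mat rat_of_int B'"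
    using B by (rule integral_mat_cases)
  have "map_mat rat_of_int (A' * B') = map_mat rat_of_int (1\<^sub>m n)"
    "map_mat rat_of_int (B' * A') = map_mat rat_of_int (1\<^sub>m n)"
    using AB A' B' by (simp_all add: of_int_hom.mat_hom_mult[of _ n n _ n] of_int_hom.mat_hom_one)
  then have "A' * B' = 1\<^sub>m n" "B' * A' = 1\<^sub>m n" by (blast dest: of_int_hom.mat_hom_inj)+
  then have "A' \<in> carrier (GL TYPE(int) n)" unfolding carrier_GL_iff using A'(1) B'(1) by blast
  then show ?thesis unfolding GL_integral_def A'(2) by (rule imageI)
qed

lemma GL_integral_entries:
  assumes "A \<in> GL_integral n"
  shows "A \<in> carrier_mat n n" "r < n \<Longrightarrow> c < n \<Longrightarrow> A $$ (r, c) \<in> \<int>" "1 / det A \<in> \<int>"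
proof -
  obtain B C where B: "A = map_mat rat_of_int B" "B \<in> carrier_mat n n" "C \<in> carrier_mat n n" "B * C = 1\<^sub>m n"
    using assms unfolding GL_integral_def by (auto simp: carrier_GL_iff)
  show "A \<in> carrier_mat n n" "r < n \<Longrightarrow> c < n \<Longrightarrow> A $$ (r, c) \<in> \<int>"
    using B by auto
  have "det B * det C = 1" using det_mult[OF B(2,3)] B(4) by simp
  then have "rat_of_int (det B) * rat_of_int (det C) = 1" by (metis of_int_1 of_int_mult)
  moreover have "det A = rat_of_int (det B)" using B(1) by (simp add: of_int_hom.hom_det)
  ultimately have "1 / det A = rat_of_int (det C)"
    using inverse_unique[of "det A" "rat_of_int (det C)"] by (simp add: inverse_eq_divide)
  then show "1 / det A \<in> \<int>" by simp
qed

text \<open>A common denominator of the coefficients serves all points at once.\<close>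

lemma poly_functions_common_denominator:
  assumes "p \<in> poly_functions C" and "\<And>f x. f \<in> C \<Longrightarrow> x \<in> X \<Longrightarrow> f x \<in> \<int>"
  shows "\<exists>D::int. D > 0 \<and> (\<forall>x\<in>X. of_int D * p x \<in> \<int>)"
  using assms(1)
proof induction
  case (const c)
  obtain d :: int where "d > 0" "of_int d * c \<in> \<int>" using rat_denominator[of c] by blast
  then show ?case by auto
next
  case (coord f)
  then show ?case using assms(2) by (intro exI[of _ 1]) simp
next
  case (add f g)
  then obtain D E :: int where D: "D > 0" "\<And>x. x \<in> X \<Longrightarrow> of_int D * f x \<in> \<int>"
    and E: "E > 0" "\<And>x. x \<in> X \<Longrightarrow> of_int E * g x \<in> \<int>" by blast
  have "of_int (D * E) * (f x + g x) \<in> \<int>" if "x \<in> X" for x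
  proof -
    have "of_int (D * E) * (f x + g x) = of_int E * (of_int D * f x) + of_int D * (of_int E * g x)"
      by (simp add: algebra_simps)
    also have "\<dots> \<in> \<int>" by (intro Ints_add Ints_mult Ints_of_int D E that)
    finally show ?thesis .
  qed
  then show ?case using D(1) E(1) by (intro exI[of _ "D * E"]) auto
next
  case (mult f g)
  then obtain D E :: int where D: "D > 0" "\<And>x. x \<in> X \<Longrightarrow> of_int D * f x \<in> \<int>"
    and E: "E > 0" "\<And>x. x \<in> X \<Longrightarrow> of_int E * g x \<in> \<int>" by blast
  have "of_int (D * E) * (f x * g x) \<in> \<int>" if "x \<in> X" for x
  proof -
    have "of_int (D * E) * (f x * g x) = (of_int D * f x) * (of_int E * g x)"
      by (simp add: algebra_simps)
    also have "\<dots> \<in> \<int>" by (intro Ints_mult D E that)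
    finally show ?thesis .
  qed
  then show ?case using D(1) E(1) by (intro exI[of _ "D * E"]) auto
qed

lemma poly_functions_sum:
  assumes "\<And>s. s \<in> A \<Longrightarrow> f s \<in> poly_functions C"
  shows "(\<lambda>x. \<Sum>s\<in>A. f s x) \<in> poly_functions C"
  using assms
proof (induction A rule: infinite_finite_induct)
  case (insert s A)
  then have "(\<lambda>x. f s x + (\<Sum>s\<in>A. f s x)) \<in> poly_functions C" by (intro poly_functions.add) auto
  then show ?case using insert by simp
qed (simp_all add: poly_functions.const)

lemma SL_dd_over_iff: "M \<in> SL_dd_over dd R \<longleftrightarrow> M \<in> carrier (SL_dd dd) \<and> (\<forall>k<2. \<forall>l<2. M $$ (k, l) \<in> R)"
proof -
  have "elements_mat M \<subseteq> R \<longleftrightarrow> (\<forall>k<2. \<forall>l<2. M $$ (k, l) \<in> R)" if "M \<in> carrier_mat 2 2"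
    using that by (force intro: elements_matI[OF that])
  then show ?thesis by (auto simp: SL_dd_over_def SL_dd_def)
qed

context order_coordinates
begin

section \<open>Arithmeticity of the group over a stable order\<close>

lemma R_additive: "additive_subgroup R" by (rule unital_subring_additive[OF subring])

lemma R_mult: "x \<in> R \<Longrightarrow> y \<in> R \<Longrightarrow> x * y \<in> R" and R_one: "1 \<in> R"
  using subring by (auto simp: unital_subring_def)

lemma R_scale: "x \<in> R \<Longrightarrow> scale (of_int m) x \<in> R"
  unfolding scale_of_int by (rule additive_subgroup_of_int[OF R_additive])

lemma e_in_R: "t < 4 \<Longrightarrow> e t \<in> R"
  unfolding mem_iff by (simp add: \<kappa>_e)

lemma rep_integral:
  assumes "\<And>k l. k < 2 \<Longrightarrow> l < 2 \<Longrightarrow> M $$ (k, l) \<in> R" and rc: "r < 8" "c < 8"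
  shows "rep M $$ (r, c) \<in> \<int>"
proof -
  have "M $$ (r div 4, c div 4) * e (c mod 4) \<in> R"
    using rc by (intro R_mult assms(1) e_in_R) auto
  then show ?thesis using rc by (simp add: rep_def mem_iff)
qed

lemma SL_inverse_over:
  assumes "M \<in> SL_dd_over dd R" shows "SL_inverse M \<in> SL_dd_over dd R"
proof -
  have "- dd x \<in> R" "dd x \<in> R" if "x \<in> R" for x
    using that dd_closed additive_subgroup_uminus[OF R_additive] by auto
  then have "SL_inverse M $$ (k, l) \<in> R" if "k < 2" "l < 2" for k l
    using that assms unfolding SL_dd_over_iff SL_inverse_def by (auto simp: less_two_cases)
  then show ?thesis using assms by (simp add: SL_dd_over_iff SL_inverse_closed)
qed

text \<open>An integral image has integral columns at the basis vectors \<open>1\<close>, whose coordinates are those of the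
  matrix entries. Conversely, the inverse of a matrix over the order is again over the order.\<close>

lemma rep_GL_integral_iff:
  assumes M: "M \<in> carrier (SL_dd dd)"
  shows "rep M \<in> GL_integral 8 \<longleftrightarrow> M \<in> SL_dd_over dd R"
proof
  assume int: "rep M \<in> GL_integral 8"
  have "M $$ (k, l) \<in> R" if "k < 2" "l < 2" for k l
    unfolding mem_iff using that by (auto simp: \<kappa>_entry intro!: GL_integral_entries(2)[OF int])
  with M show "M \<in> SL_dd_over dd R" by (simp add: SL_dd_over_iff)
next
  assume over: "M \<in> SL_dd_over dd R"
  have "rep M * rep (SL_inverse M) = 1\<^sub>m 8" "rep (SL_inverse M) * rep M = 1\<^sub>m 8"
    using rep_mult[OF SL_dd_carrier[OF M] SL_inverse_carrier] rep_mult[OF SL_inverse_carrier SL_dd_carrier[OF M]]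
      SL_inverse_left[OF M] SL_inverse_right[OF M] rep_one by metis+
  then show "rep M \<in> GL_integral 8"
    using over SL_inverse_over[OF over]
    by (intro GL_integralI[of _ _ "rep (SL_inverse M)"] rep_integral) (auto simp: SL_dd_over_iff)
qed

lemma \<kappa>_coord: "s < 4 \<Longrightarrow> k < 2 \<Longrightarrow> l < 2 \<Longrightarrow> (\<lambda>M. \<kappa> s (M $$ (k, l))) \<in> mat2_coords scale"
  unfolding mat2_coords_def using \<kappa>_linear by blast

text \<open>The entries of the representation are linear in the matrix entries, and conversely a linear form
  in a matrix entry is a linear combination of entries of the representation because \<open>e 0 = 1\<close>.\<close>

lemma rep_faithful: "faithful_rational_rep scale dd 8 rep"
  unfolding faithful_rational_rep_def
proof (intro conjI allI impI ballI)
  show "rep \<in> hom (SL_dd dd) (GL TYPE(rat) 8)"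
  proof (rule homI)
    fix M assume M: "M \<in> carrier (SL_dd dd)"
    then have "rep M * rep (SL_inverse M) = 1\<^sub>m 8" "rep (SL_inverse M) * rep M = 1\<^sub>m 8"
      using rep_mult[OF SL_dd_carrier[OF M] SL_inverse_carrier] rep_mult[OF SL_inverse_carrier SL_dd_carrier[OF M]]
        SL_inverse_left[OF M] SL_inverse_right[OF M] rep_one by metis+
    then show "rep M \<in> carrier (GL TYPE(rat) 8)" by (auto simp: carrier_GL_iff)
  next
    fix M N assume "M \<in> carrier (SL_dd dd)" "N \<in> carrier (SL_dd dd)"
    then show "rep (M \<otimes>\<^bsub>SL_dd dd\<^esub> N) = rep M \<otimes>\<^bsub>GL TYPE(rat) 8\<^esub> rep N"
      by (simp add: SL_dd_mult GL_mult rep_mult SL_dd_carrier)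
  qed
next
  fix r c :: nat assume rc: "r < 8" "c < 8"
  let ?\<phi> = "\<lambda>x. \<kappa> (r mod 4) (x * e (c mod 4))"
  have "Vector_Spaces.linear scale (*) ?\<phi>"
    using \<kappa>_linear[of "r mod 4"] unfolding Vector_Spaces.linear_iff
    by (simp add: distrib_right scale_mult_left)
  moreover have "r div 4 < 2" "c div 4 < 2" using rc by auto
  ultimately have "(\<lambda>M. ?\<phi> (M $$ (r div 4, c div 4))) \<in> mat2_coords scale"
    unfolding mat2_coords_def by (intro CollectI exI[of _ ?\<phi>] exI[of _ "r div 4"] exI[of _ "c div 4"] conjI refl)
  then show "\<exists>p\<in>poly_functions (mat2_coords scale). \<forall>M\<in>carrier (SL_dd dd). rep M $$ (r, c) = p M"
    using rc by (intro bexI[OF _ poly_functions.coord]) (auto simp: rep_def)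
next
  fix f assume "f \<in> mat2_coords scale"
  then obtain \<phi> k l where f: "f = (\<lambda>M. \<phi> (M $$ (k, l)))" and \<phi>: "Vector_Spaces.linear scale (*) \<phi>"
    and kl: "k < 2" "l < 2" unfolding mat2_coords_def by blast
  interpret \<phi>: Vector_Spaces.linear scale "(*)" \<phi> by (rule \<phi>)
  define p where "p A = (\<Sum>s<4. \<phi> (e s) * A $$ (4 * k + s, 4 * l))" for A :: "rat mat"
  have "p \<in> poly_functions (GL_coords 8)"
    unfolding p_def
  proof (intro poly_functions_sum poly_functions.mult poly_functions.const poly_functions.coord)
    fix s :: nat assume "s \<in> {..<4}"
    then show "(\<lambda>A. A $$ (4 * k + s, 4 * l)) \<in> GL_coords 8"
      using kl unfolding GL_coords_def
      by (intro UnI1 CollectI exI[of _ "4 * k + s"] exI[of _ "4 * l"] conjI refl) auto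
  qed
  moreover have "f M = p (rep M)" for M
  proof -
    have "f M = \<phi> (\<Sum>s<4. scale (\<kappa> s (M $$ (k, l))) (e s))" by (simp add: f expand)
    also have "\<dots> = (\<Sum>s<4. \<kappa> s (M $$ (k, l)) * \<phi> (e s))" by (simp add: \<phi>.sum \<phi>.scale)
    also have "\<dots> = p (rep M)" unfolding p_def using kl by (intro sum.cong) (simp_all add: \<kappa>_entry)
    finally show ?thesis .
  qed
  ultimately show "\<exists>p\<in>poly_functions (GL_coords 8). \<forall>M\<in>carrier (SL_dd dd). f M = p (rep M)" by blast
qed

lemma subgroup_SL_dd_over: "subgroup (SL_dd_over dd R) (SL_dd dd)"
proof (rule subgroup.intro)
  show "SL_dd_over dd R \<subseteq> carrier (SL_dd dd)" by (auto simp: SL_dd_over_def)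
next
  fix M N assume M: "M \<in> SL_dd_over dd R" and N: "N \<in> SL_dd_over dd R"
  then have "(M * N) $$ (k, l) \<in> R" if "k < 2" "l < 2" for k l
    using that by (subst times_mat2_index)
      (auto simp: SL_dd_over_iff SL_dd_carrier intro!: additive_subgroup_add[OF R_additive] R_mult)
  with M N show "M \<otimes>\<^bsub>SL_dd dd\<^esub> N \<in> SL_dd_over dd R"
    by (auto simp: SL_dd_over_iff SL_dd_mult SL_dd_mult_closed)
next
  show "\<one>\<^bsub>SL_dd dd\<^esub> \<in> SL_dd_over dd R"
    using R_one additive_subgroup_zero[OF R_additive]
    by (auto simp: SL_dd_over_iff SL_dd_one one_mat2 mat2_in_SL_dd_iff less_two_cases)
next
  fix M assume "M \<in> SL_dd_over dd R"
  then show "inv\<^bsub>SL_dd dd\<^esub> M \<in> SL_dd_over dd R"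
    using SL_inverse_over by (simp add: SL_dd_inv SL_dd_over_iff)
qed

lemma arithmetic_SL_dd_over: "arithmetic_subgroup scale dd (SL_dd_over dd R)"
proof -
  let ?G = "SL_dd dd" and ?\<Gamma> = "SL_dd_over dd R"
  interpret group ?G by (rule group_SL_dd)
  have eq: "{M \<in> carrier ?G. rep M \<in> GL_integral 8} = ?\<Gamma>"
    using rep_GL_integral_iff by (auto simp: SL_dd_over_def)
  have "?\<Gamma> #>\<^bsub>?G\<^esub> M = ?\<Gamma>" if "M \<in> ?\<Gamma>" for M
    using that subgroup_SL_dd_over by (intro subgroup.rcos_const is_group)
  then have "(\<lambda>M. ?\<Gamma> #>\<^bsub>?G\<^esub> M) ` ?\<Gamma> \<subseteq> {?\<Gamma>}" by blast
  then have "finite_index ?G ?\<Gamma> ?\<Gamma>"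
    unfolding finite_index_def using finite_subset by blast
  then have "commensurable ?G ?\<Gamma> {M \<in> carrier ?G. rep M \<in> GL_integral 8}"
    unfolding eq commensurable_def by simp
  then show ?thesis
    unfolding arithmetic_subgroup_def using subgroup_SL_dd_over rep_faithful by blast
qed

section \<open>Arithmetic groups containing the group over a maximal order\<close>

lemma ex_multiple_in_R: "\<exists>m::int. m > 0 \<and> scale (of_int m) x \<in> R"
proof -
  have "\<exists>d::int. d > 0 \<and> of_int d * \<kappa> s x \<in> \<int>" for s using rat_denominator[of "\<kappa> s x"] by blast
  then obtain d :: "nat \<Rightarrow> int" where d: "\<And>s. d s > 0" "\<And>s. of_int (d s) * \<kappa> s x \<in> \<int>" by metis
  have "of_int (\<Prod>t<4. d t) * \<kappa> s x \<in> \<int>" if "s < 4" for s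
  proof -
    have "(\<Prod>t<4. d t) = (\<Prod>t\<in>{..<4} - {s}. d t) * d s"
      using that by (subst prod.remove[of _ s]) auto
    then have "of_int (\<Prod>t<4. d t) * \<kappa> s x = of_int (\<Prod>t\<in>{..<4} - {s}. d t) * (of_int (d s) * \<kappa> s x)"
      by (simp only: of_int_mult mult.assoc)
    also have "\<dots> \<in> \<int>" by (intro Ints_mult Ints_of_int d)
    finally show ?thesis .
  qed
  then have "scale (of_int (\<Prod>t<4. d t)) x \<in> R" unfolding mem_iff by (simp add: \<kappa>_scale)
  moreover have "(\<Prod>t<4. d t) > 0" by (intro prod_pos) (simp add: d)
  ultimately show ?thesis by blast
qed

text \<open>Each coordinate of a matrix entry is a regular function of \<open>\<rho> M\<close>, whose generators, the entries and
  the inverse of the determinant, take integral values on integral invertible matrices.\<close>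

lemma integral_points_denominator:
  assumes \<rho>: "faithful_rational_rep scale dd n \<rho>"
    and X: "X = {M \<in> carrier (SL_dd dd). \<rho> M \<in> GL_integral n}"
  shows "\<exists>D::int. D > 0 \<and> (\<forall>M\<in>X. \<forall>k<2. \<forall>l<2. scale (of_int D) (M $$ (k, l)) \<in> R)"
proof -
  have denom: "\<exists>D::int. D > 0 \<and> (\<forall>M\<in>X. of_int D * \<kappa> s (M $$ (k, l)) \<in> \<int>)"
    if skl: "s < 4" "k < 2" "l < 2" for s k l
  proof -
    obtain p where p: "p \<in> poly_functions (GL_coords n)"
      "\<And>M. M \<in> carrier (SL_dd dd) \<Longrightarrow> \<kappa> s (M $$ (k, l)) = p (\<rho> M)"
      using \<rho> \<kappa>_coord[OF skl] unfolding faithful_rational_rep_def by metis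
    have "f A \<in> \<int>" if "f \<in> GL_coords n" "A \<in> GL_integral n" for f A
      using that GL_integral_entries[OF that(2)] by (auto simp: GL_coords_def)
    then obtain D :: int where "D > 0" "\<forall>A\<in>GL_integral n. of_int D * p A \<in> \<int>"
      using poly_functions_common_denominator[OF p(1)] by blast
    then show ?thesis using p(2) X by auto
  qed
  have "\<forall>s k l. \<exists>D::int. D > 0 \<and> (s < 4 \<longrightarrow> k < 2 \<longrightarrow> l < 2 \<longrightarrow> (\<forall>M\<in>X. of_int D * \<kappa> s (M $$ (k, l)) \<in> \<int>))"
  proof (intro allI)
    fix s k l :: nat
    show "\<exists>D::int. D > 0 \<and> (s < 4 \<longrightarrow> k < 2 \<longrightarrow> l < 2 \<longrightarrow> (\<forall>M\<in>X. of_int D * \<kappa> s (M $$ (k, l)) \<in> \<int>))"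
    proof (cases "s < 4 \<and> k < 2 \<and> l < 2")
      case True
      then show ?thesis using denom[of s k l] by blast
    next
      case False
      then show ?thesis by (intro exI[of _ 1]) auto
    qed
  qed
  then obtain D :: "nat \<Rightarrow> nat \<Rightarrow> nat \<Rightarrow> int" where D: "\<And>s k l. D s k l > 0"
    "\<And>s k l M. s < 4 \<Longrightarrow> k < 2 \<Longrightarrow> l < 2 \<Longrightarrow> M \<in> X \<Longrightarrow> of_int (D s k l) * \<kappa> s (M $$ (k, l)) \<in> \<int>" by metis
  define I where "I = {..<4::nat} \<times> {..<2::nat} \<times> {..<2::nat}"
  define E where "E = (\<Prod>(s, k, l)\<in>I. D s k l)"
  have fin: "finite I" by (simp add: I_def)
  have "scale (of_int E) (M $$ (k, l)) \<in> R" if M: "M \<in> X" "k < 2" "l < 2" for M k l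
    unfolding mem_iff
  proof (intro allI impI)
    fix s :: nat assume s: "s < 4"
    have "(s, k, l) \<in> I" using s M by (simp add: I_def)
    then have "E = D s k l * (\<Prod>(s, k, l)\<in>I - {(s, k, l)}. D s k l)"
      unfolding E_def by (subst prod.remove[OF fin]) auto
    then have "\<kappa> s (scale (of_int E) (M $$ (k, l)))
        = of_int (\<Prod>(s, k, l)\<in>I - {(s, k, l)}. D s k l) * (of_int (D s k l) * \<kappa> s (M $$ (k, l)))"
      by (simp only: \<kappa>_scale[OF s] of_int_mult mult_ac)
    also have "\<dots> \<in> \<int>" by (intro Ints_mult Ints_of_int D s M)
    finally show "\<kappa> s (scale (of_int E) (M $$ (k, l))) \<in> \<int>" .
  qed
  moreover have "E > 0" unfolding E_def by (intro prod_pos) (auto simp: D)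
  ultimately show ?thesis by blast
qed

lemma finite_index_coset_representatives:
  assumes "finite_index (SL_dd dd) K A" "A \<subseteq> carrier (SL_dd dd)" "1\<^sub>m 2 \<in> K"
  shows "\<exists>F. finite F \<and> F \<subseteq> A \<and> (\<forall>M\<in>A. \<exists>N\<in>K. \<exists>x\<in>F. M = N * x)"
proof -
  let ?c = "\<lambda>x. K #>\<^bsub>SL_dd dd\<^esub> x"
  have "finite (?c ` A)" using assms(1) by (simp add: finite_index_def)
  then obtain F where F: "F \<subseteq> A" "finite F" "?c ` A = ?c ` F"
    using finite_subset_image[of "?c ` A" ?c A] by blast
  have "\<exists>N\<in>K. \<exists>x\<in>F. M = N * x" if "M \<in> A" for M
  proof -
    have "1\<^sub>m 2 * M \<in> ?c M" using assms(3) by (auto simp: r_coset_def SL_dd_mult)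
    moreover have "1\<^sub>m 2 * M = M"
      by (rule left_mult_one_mat) (use that assms(2) SL_dd_carrier in blast)
    moreover have "?c M \<in> ?c ` F" unfolding F(3)[symmetric] using that by (rule imageI)
    then obtain x where "x \<in> F" "?c M = ?c x" by (elim imageE)
    ultimately have "M \<in> ?c x" "x \<in> F" by simp_all
    then show ?thesis by (auto simp: r_coset_def SL_dd_mult)
  qed
  then show ?thesis using F by blast
qed

text \<open>An element of \<open>\<Delta>\<close> is a product of an integral point and one of finitely many coset
  representatives. Both kinds have bounded denominators with respect to the ring \<open>R\<close>, hence so do the products.\<close>

lemma arithmetic_subgroup_denominator:
  assumes "arithmetic_subgroup scale dd \<Delta>"
  shows "\<exists>D::int. D > 0 \<and> (\<forall>M\<in>\<Delta>. \<forall>k<2. \<forall>l<2. scale (of_int D) (M $$ (k, l)) \<in> R)"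
proof -
  obtain n \<rho> where sub: "subgroup \<Delta> (SL_dd dd)" and \<rho>: "faithful_rational_rep scale dd n \<rho>"
    and com: "commensurable (SL_dd dd) \<Delta> {M \<in> carrier (SL_dd dd). \<rho> M \<in> GL_integral n}"
    using assms unfolding arithmetic_subgroup_def by blast
  define X where "X = {M \<in> carrier (SL_dd dd). \<rho> M \<in> GL_integral n}"
  have \<Delta>: "\<Delta> \<subseteq> carrier (SL_dd dd)" "1\<^sub>m 2 \<in> \<Delta>"
    using subgroup.subset[OF sub] subgroup.one_closed[OF sub] by (auto simp: SL_dd_one)
  have idx: "finite_index (SL_dd dd) (\<Delta> \<inter> X) \<Delta>"
    using com unfolding commensurable_def X_def by blast
  have hom: "\<rho> \<in> hom (SL_dd dd) (GL TYPE(rat) n)" using \<rho> by (simp add: faithful_rational_rep_def)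
  have "\<rho> (1\<^sub>m 2) = 1\<^sub>m n"
  proof -
    have c: "\<rho> (1\<^sub>m 2) \<in> carrier (GL TYPE(rat) n)"
      using hom_in_carrier[OF hom] \<Delta> by blast
    then obtain B where B: "\<rho> (1\<^sub>m 2) \<in> carrier_mat n n" "B \<in> carrier_mat n n" "B * \<rho> (1\<^sub>m 2) = 1\<^sub>m n"
      by (auto simp: carrier_GL_iff)
    have one: "1\<^sub>m 2 \<in> carrier (SL_dd dd)" using \<Delta> by blast
    have "\<rho> (1\<^sub>m 2) * \<rho> (1\<^sub>m 2) = \<rho> (1\<^sub>m 2 * 1\<^sub>m 2)"
      using hom_mult[OF hom one one] by (simp add: SL_dd_mult GL_mult)
    then have "\<rho> (1\<^sub>m 2) * \<rho> (1\<^sub>m 2) = \<rho> (1\<^sub>m 2)" by simp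
    then have "(B * \<rho> (1\<^sub>m 2)) * \<rho> (1\<^sub>m 2) = B * \<rho> (1\<^sub>m 2)"
      by (simp only: assoc_mult_mat[OF B(2,1,1)])
    then show ?thesis unfolding B(3) left_mult_one_mat[OF B(1)] .
  qed
  moreover have "1\<^sub>m n \<in> GL_integral n" by (rule GL_integralI[of _ _ "1\<^sub>m n"]) auto
  ultimately have "1\<^sub>m 2 \<in> \<Delta> \<inter> X" using \<Delta> by (auto simp: X_def)
  then obtain F where F: "finite F" "F \<subseteq> \<Delta>" and rep: "\<And>M. M \<in> \<Delta> \<Longrightarrow> \<exists>N\<in>\<Delta> \<inter> X. \<exists>x\<in>F. M = N * x"
    using finite_index_coset_representatives[OF idx \<Delta>(1)] by blast
  obtain D :: int where D: "D > 0" "\<And>M k l. M \<in> X \<Longrightarrow> k < 2 \<Longrightarrow> l < 2 \<Longrightarrow> scale (of_int D) (M $$ (k, l)) \<in> R"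
    using integral_points_denominator[OF \<rho> X_def] by blast
  obtain m :: "'h \<Rightarrow> int" where m: "\<And>x. m x > 0" "\<And>x. scale (of_int (m x)) x \<in> R"
    using ex_multiple_in_R by metis
  define S where "S = (\<lambda>(x, k, l). x $$ (k, l)) ` (F \<times> {..<2::nat} \<times> {..<2::nat})"
  have finS: "finite S" using F by (simp add: S_def)
  define E where "E = prod m S"
  have E: "E > 0" unfolding E_def by (intro prod_pos) (simp add: m)
  have ES: "scale (of_int E) y \<in> R" if y: "y \<in> S" for y
  proof -
    have "E = prod m (S - {y}) * m y" unfolding E_def using prod.remove[OF finS y, of m] by simp
    then have "scale (of_int E) y = scale (of_int (prod m (S - {y}))) (scale (of_int (m y)) y)"
      by (simp only: of_int_mult scale_scale)
    then show ?thesis using R_scale m(2) by metis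
  qed
  have "scale (of_int (D * E)) (M $$ (k, l)) \<in> R" if M: "M \<in> \<Delta>" and kl: "k < 2" "l < 2" for M k l
  proof -
    obtain N x where N: "N \<in> X" "N \<in> \<Delta>" and x: "x \<in> F" and eq: "M = N * x" using rep[OF M] by blast
    have c: "N \<in> carrier_mat 2 2" "x \<in> carrier_mat 2 2" using N x F \<Delta> SL_dd_carrier by blast+
    have "x $$ (r, l) \<in> S" if "r < 2" for r
      unfolding S_def using that kl x by (intro image_eqI[of _ _ "(x, r, l)"]) auto
    then have "scale (of_int D) (N $$ (k, r)) * scale (of_int E) (x $$ (r, l)) \<in> R" if "r < 2" for r
      using that by (intro R_mult D N kl ES)
    then have "scale (of_int D) (N $$ (k, 0)) * scale (of_int E) (x $$ (0, l))
        + scale (of_int D) (N $$ (k, 1)) * scale (of_int E) (x $$ (1, l)) \<in> R"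
      by (intro additive_subgroup_add[OF R_additive]) simp_all
    then show ?thesis
      unfolding eq times_mat2_index[OF c kl]
      by (simp add: scale_mult_left scale_mult_right scale_right_distrib mult.commute)
  qed
  then show ?thesis using D(1) E by (intro exI[of _ "D * E"]) auto
qed

text \<open>For \<open>P\<close> in \<open>SL(2,\<int>)\<close> the entries of \<open>MPN\<close> lie in \<open>T\<close>. With \<open>U\<close>, \<open>L\<close> the elementary unipotent matrices,
  \<open>U - 1\<close>, \<open>L - 1\<close>, \<open>UL - U - L + 1\<close> and \<open>LU - U - L + 1\<close> are the matrix units, so each single product
  of an entry of \<open>M\<close> and an entry of \<open>N\<close> lies in \<open>T\<close>.\<close>

lemma entry_ring:
  assumes \<Delta>: "subgroup \<Delta> (SL_dd dd)" and sub: "SL_dd_over dd R \<subseteq> \<Delta>"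
    and T: "T = zspan {M $$ (k, l) | M k l. M \<in> \<Delta> \<and> k < 2 \<and> l < 2}"
  shows "unital_subring T" "dd ` T \<subseteq> T" "\<And>r. r \<in> R \<Longrightarrow> dd r = r \<Longrightarrow> r \<in> T"
proof -
  let ?E = "{M $$ (k, l) | M k l. M \<in> \<Delta> \<and> k < 2 \<and> l < 2}"
  have Ta: "additive_subgroup T" unfolding T by (rule additive_subgroup_zspan)
  have ent: "M $$ (k, l) \<in> T" if "M \<in> \<Delta>" "k < 2" "l < 2" for M k l
    unfolding T using that by (intro zspan.gen) blast
  have c: "M \<in> carrier_mat 2 2" if "M \<in> \<Delta>" for M
    using that subgroup.subset[OF \<Delta>] SL_dd_carrier by blast
  have mul: "M * N \<in> \<Delta>" if "M \<in> \<Delta>" "N \<in> \<Delta>" for M N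
    using subgroup.m_closed[OF \<Delta> that] by (simp add: SL_dd_mult)
  have zero: "0 \<in> R" and one: "1 \<in> R" by (simp_all add: R_one additive_subgroup_zero[OF R_additive])
  have U: "mat2 1 r 0 1 \<in> \<Delta>" and L: "mat2 1 0 r 1 \<in> \<Delta>" if "r \<in> R" "dd r = r" for r
    using sub that zero one by (auto simp: SL_dd_over_iff mat2_in_SL_dd_iff less_two_cases)
  show "r \<in> T" if "r \<in> R" "dd r = r" for r
    using ent[OF U[OF that], of 0 1] by simp
  have one_T: "1 \<in> T" using ent[OF U[OF one dd_one], of 0 0] by simp
  have prod_T: "M $$ (k, r) * N $$ (s, l) \<in> T"
    if M: "M \<in> \<Delta>" and N: "N \<in> \<Delta>" and i: "k < 2" "r < 2" "s < 2" "l < 2" for M N k r s l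
  proof -
    let ?U = "mat2 1 1 0 (1::'h)" and ?L = "mat2 1 0 1 (1::'h)"
    have UL: "?U \<in> \<Delta>" "?L \<in> \<Delta>" using U[OF one] L[OF one] by simp_all
    have m3: "(M * P * N) $$ (k, l) \<in> T" if "P \<in> \<Delta>" for P by (intro ent mul M N that i)
    have f: "(M * mat2 p q u v * N) $$ (k, l) =
       (M $$ (k, 0) * p + M $$ (k, 1) * u) * N $$ (0, l) + (M $$ (k, 0) * q + M $$ (k, 1) * v) * N $$ (1, l)"
      for p q u v :: 'h
    proof -
      have "(M * mat2 p q u v) $$ (k, 0) = M $$ (k, 0) * p + M $$ (k, 1) * u"
        "(M * mat2 p q u v) $$ (k, 1) = M $$ (k, 0) * q + M $$ (k, 1) * v"
        using times_mat2_index[OF c[OF M] mat2_carrier i(1), of 0 p q u v]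
          times_mat2_index[OF c[OF M] mat2_carrier i(1), of 1 p q u v] by simp_all
      then show ?thesis
        using times_mat2_index[OF mult_carrier_mat[OF c[OF M] mat2_carrier] c[OF N] i(1,4)] by simp
    qed
    have I: "mat2 1 0 0 1 \<in> \<Delta>" using subgroup.one_closed[OF \<Delta>] by (simp add: SL_dd_one one_mat2)
    have ULp: "?U * ?L = mat2 (1 + 1) 1 1 1" "?L * ?U = mat2 1 1 1 (1 + 1)" by (simp_all add: mat2_mult)
    note mem = m3[OF I, unfolded f] m3[OF UL(1), unfolded f] m3[OF UL(2), unfolded f]
      m3[OF mul[OF UL], unfolded ULp f] m3[OF mul[OF UL(2,1)], unfolded ULp f]
    let ?m = "\<lambda>r s. M $$ (k, r) * N $$ (s, l)"
    have i01: "?m 0 0 + ?m 1 1 \<in> T" "?m 0 0 + ?m 0 1 + ?m 1 1 \<in> T" "?m 0 0 + ?m 1 0 + ?m 1 1 \<in> T"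
      "?m 0 0 + ?m 0 0 + ?m 1 0 + ?m 0 1 + ?m 1 1 \<in> T" "?m 0 0 + ?m 1 0 + ?m 0 1 + ?m 1 1 + ?m 1 1 \<in> T"
      using mem by (simp_all add: distrib_left distrib_right add_ac del: one_add_one)
    have m01: "?m 0 1 \<in> T" using additive_subgroup_diff[OF Ta i01(2,1)] by (simp add: algebra_simps)
    have m10: "?m 1 0 \<in> T" using additive_subgroup_diff[OF Ta i01(3,1)] by (simp add: algebra_simps)
    have m00: "?m 0 0 \<in> T"
      using additive_subgroup_diff[OF Ta additive_subgroup_diff[OF Ta i01(4,2)] m10] by (simp add: algebra_simps)
    have m11: "?m 1 1 \<in> T" using additive_subgroup_diff[OF Ta i01(1) m00] by (simp add: algebra_simps)
    show ?thesis using i m00 m01 m10 m11 by (auto simp: less_two_cases)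
  qed
  have "x * y \<in> T" if "x \<in> T" "y \<in> T" for x y
  proof -
    have "g * h \<in> zspan ?E" if gh: "g \<in> ?E" "h \<in> ?E" for g h
    proof -
      obtain M k r where M: "g = M $$ (k, r)" "M \<in> \<Delta>" "k < 2" "r < 2" using gh(1) by blast
      obtain N s l where N: "h = N $$ (s, l)" "N \<in> \<Delta>" "s < 2" "l < 2" using gh(2) by blast
      show ?thesis unfolding M(1) N(1) T[symmetric] by (rule prod_T[OF M(2) N(2) M(3,4) N(3,4)])
    qed
    from zspan_mult_closed[OF this] that show ?thesis unfolding T by simp
  qed
  then show "unital_subring T"
    unfolding unital_subring_def using one_T additive_subgroup_diff[OF Ta] by blast
  have inv: "SL_inverse M \<in> \<Delta>" if "M \<in> \<Delta>" for M
    using subgroup.m_inv_closed[OF \<Delta> that] SL_dd_inv subgroup.subset[OF \<Delta>] that by auto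
  have "T \<subseteq> {x. dd x \<in> T}" unfolding T
  proof (rule zspan_least, unfold T[symmetric])
    show "additive_subgroup {x. dd x \<in> T}"
      using Ta by (auto simp: additive_subgroup_def dd_diff)
    show "?E \<subseteq> {x. dd x \<in> T}"
    proof
      fix x assume "x \<in> ?E"
      then obtain M k l where x: "x = M $$ (k, l)" "M \<in> \<Delta>" "k < 2" "l < 2" by blast
      have "SL_inverse M $$ (p, q) \<in> T" if "p < 2" "q < 2" for p q by (rule ent[OF inv[OF x(2)] that])
      from this[of 0 0] this[of 0 1] this[of 1 0] this[of 1 1]
      have "dd (M $$ (1,1)) \<in> T" "dd (M $$ (0,0)) \<in> T" "- dd (M $$ (0,1)) \<in> T" "- dd (M $$ (1,0)) \<in> T"
        by (simp_all add: SL_inverse_def)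
      moreover from this(3,4) have "dd (M $$ (0,1)) \<in> T" "dd (M $$ (1,0)) \<in> T"
        using additive_subgroup_uminus[OF Ta, of "- dd (M $$ (0,1))"]
          additive_subgroup_uminus[OF Ta, of "- dd (M $$ (1,0))"] by simp_all
      ultimately show "x \<in> {x. dd x \<in> T}"
        using x(3,4) unfolding x(1) less_two_cases by auto
    qed
  qed
  then show "dd ` T \<subseteq> T" by blast
qed

lemma arithmetic_overgroup_contained:
  assumes max: "is_maximal_dd_order scale dd R"
    and ar: "arithmetic_subgroup scale dd \<Delta>" and sub: "SL_dd_over dd R \<subseteq> \<Delta>"
  shows "\<Delta> \<subseteq> SL_dd_over dd R"
proof
  define T where "T = zspan {M $$ (k, l) | M k l. M \<in> \<Delta> \<and> k < 2 \<and> l < 2}"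
  have \<Delta>: "subgroup \<Delta> (SL_dd dd)" using ar by (simp add: arithmetic_subgroup_def)
  obtain D :: int where D: "D > 0" "\<And>M k l. M \<in> \<Delta> \<Longrightarrow> k < 2 \<Longrightarrow> l < 2 \<Longrightarrow> scale (of_int D) (M $$ (k, l)) \<in> R"
    using arithmetic_subgroup_denominator[OF ar] by blast
  obtain E :: int where E: "E > 0" "\<And>x. x \<in> R \<Longrightarrow> scale (of_int E) x \<in> integral_coords"
    using bounded unfolding bounded_denominators_def by blast
  have "scale (of_int (E * D)) (M $$ (k, l)) \<in> integral_coords" if "M \<in> \<Delta>" "k < 2" "l < 2" for M k l
    using E(2)[OF D(2)[OF that]] by simp
  then have "bounded_denominators {M $$ (k, l) | M k l. M \<in> \<Delta> \<and> k < 2 \<and> l < 2}"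
    unfolding bounded_denominators_def using D(1) E(1) by (intro exI[of _ "E * D"]) auto
  then have bd: "bounded_denominators T" unfolding T_def by (rule bounded_denominators_zspan)
  note ring = entry_ring[OF \<Delta> sub T_def]
  have "T \<subseteq> R" by (rule maximal_dd_order_contains[OF max ring(1) bd ring(2,3)])
  fix M assume M: "M \<in> \<Delta>"
  have "M $$ (k, l) \<in> R" if "k < 2" "l < 2" for k l
    using that M \<open>T \<subseteq> R\<close> unfolding T_def by (blast intro: zspan.gen)
  with M subgroup.subset[OF \<Delta>] show "M \<in> SL_dd_over dd R" by (auto simp: SL_dd_over_iff)
qed

end

theorem theorem6p1:
  fixes scale :: "rat \<Rightarrow> 'h::ring_1 \<Rightarrow> 'h"
    and a b :: rat and i j :: 'h
    and dd :: "'h \<Rightarrow> 'h"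
    and R :: "'h set"
  assumes "orthogonal_involution scale a b i j dd"
    and "is_maximal_dd_order scale dd R"
  shows "maximal_arithmetic_subgroup scale dd (SL_dd_over dd R)"
proof -
  obtain a' b' i' j' where "symmetric_quaternion scale a' b' i' j' dd"
    using orthogonal_involution.ex_symmetric_generators[OF assms(1)] by blast
  then interpret symmetric_quaternion scale a' b' i' j' dd .
  obtain e \<kappa> where "order_coordinates scale a' b' i' j' dd R e \<kappa>"
    using dd_order_coordinates[OF maximal_dd_orderD[OF assms(2)]] by blast
  then interpret order_coordinates scale a' b' i' j' dd R e \<kappa> .
  show ?thesis
    unfolding maximal_arithmetic_subgroup_def
    using arithmetic_SL_dd_over arithmetic_overgroup_contained[OF assms(2)] by blast
qed

end
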